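(* Let $1\le p<2$ and let $f\in L^p(\mathbb R)$ be complex-valued. For $R>0$ put $f_R:=f\,\mathbf 1_{[-R,R]}$, and let $$a_f(\xi):=\lim_{R\to\infty}a_{f_R}(\xi),$$ the limit existing for almost every $\xi\in\mathbb R$. Then $$\big\|(\log|a_f|^2)^{1/2}\big\|_{L^{p'}(\mathbb R)}\le\|f\|_{L^p(\mathbb R)} .$$
   Context: $p'=p/(p-1)$ is the conjugate exponent, with $1'=\infty$. For $g\in L^1(\mathbb R)$ and $\xi\in\mathbb R$, let $x\mapsto(a(x,\xi),b(x,\xi))$ be the unique absolutely continuous solution of $$\partial_x\binom{a}{b}=\begin{pmatrix}0&\overline{g(x)}e^{2\pi i x\xi}\\ g(x)e^{-2\pi i x\xi}&0\end{pmatrix}\binom{a}{b},\qquad \binom{a}{b}(-\infty,\xi)=\binom10 ,$$ where the initial condition is understood as a limit as $x\to-\infty$; its limit as $x\to+\infty$ exists for every $\xi$ and is denoted $(a_g(\xi),b_g(\xi))$. One has $|a_g|^2-|b_g|^2=1$. By Hölder's inequality $f_R\in L^1(\mathbb R)\cap L^p(\mathbb R)$, so $a_{f_R}$ is defined in this sense. It is a known theorem of Christ and Kiselev (which may be taken as given) that for every $f\in L^p(\mathbb R)$ with $1\le p<2$ the limit $\lim_{R\to\infty}a_{f_R}(\xi)$ exists for almost every $\xi\in\mathbb R$; this limit is the definition of $a_f$ for $f\in L^p(\mathbb R)$. *)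

theory Defs
  imports "HOL-Analysis.Analysis" "HOL-Probability.Essential_Supremum"
begin

text \<open>
  Absolute continuity in the usual epsilon-delta sense. A finite family of non-overlapping compact
  intervals is rendered as a division of its own union.
\<close>

definition abs_continuous_on :: "real set \<Rightarrow> (real \<Rightarrow> 'a::real_normed_vector) \<Rightarrow> bool" where
  "abs_continuous_on S f \<longleftrightarrow>
     (\<forall>\<epsilon>>0. \<exists>\<delta>>0. \<forall>D. D division_of \<Union>D \<and> \<Union>D \<subseteq> S \<and> (\<Sum>K\<in>D. Sup K - Inf K) < \<delta> \<longrightarrow>
        (\<Sum>K\<in>D. norm (f (Sup K) - f (Inf K))) < \<epsilon>)"

text \<open>
  The \<open>L\<^sup>p\<close> norm on the real line with Lebesgue measure, for an exponent in \<open>[1, \<infinity>]\<close>. As for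
  \<^const>\<open>esssup\<close>, the norm of a non-measurable function is \<open>\<infinity>\<close>, so that a finite norm means membership
  in \<open>L\<^sup>p\<close>.
\<close>

definition Lp_norm :: "ennreal \<Rightarrow> (real \<Rightarrow> 'a::real_normed_vector) \<Rightarrow> ennreal" where
  "Lp_norm p f =
     (if f \<notin> borel_measurable lebesgue then \<infinity>
      else if p = \<infinity> then esssup lebesgue (\<lambda>x. ennreal (norm (f x)))
      else let I = \<integral>\<^sup>+ x. ennreal (norm (f x) powr enn2real p) \<partial>lebesgue
           in if I = \<infinity> then \<infinity> else ennreal (enn2real I powr (1 / enn2real p)))"

definition conj_exponent :: "real \<Rightarrow> ennreal" where
  "conj_exponent p = (if p = 1 then \<infinity> else ennreal (p / (p - 1)))"

definition nlft_solution ::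
  "(real \<Rightarrow> complex) \<Rightarrow> real \<Rightarrow> (real \<Rightarrow> complex) \<Rightarrow> (real \<Rightarrow> complex) \<Rightarrow> bool" where
  "nlft_solution g \<xi> a b \<longleftrightarrow>
     abs_continuous_on UNIV a \<and> abs_continuous_on UNIV b \<and>
     (AE x in lebesgue.
        (a has_vector_derivative cnj (g x) * exp (2 * pi * \<i> * x * \<xi>) * b x) (at x) \<and>
        (b has_vector_derivative g x * exp (- (2 * pi * \<i> * x * \<xi>)) * a x) (at x)) \<and>
     (a \<longlongrightarrow> 1) at_bot \<and> (b \<longlongrightarrow> 0) at_bot"

text \<open>The first component of the nonlinear Fourier transform of an integrable function \<open>g\<close>.\<close>

definition nlft_a :: "(real \<Rightarrow> complex) \<Rightarrow> real \<Rightarrow> complex" where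
  "nlft_a g \<xi> = Lim at_top (fst (THE (a, b). nlft_solution g \<xi> a b))"

definition truncation :: "real \<Rightarrow> (real \<Rightarrow> complex) \<Rightarrow> real \<Rightarrow> complex" where
  "truncation R f x = indicator {-R..R} x * f x"

text \<open>
  The extension to \<open>L\<^sup>p\<close>, \<open>1 \<le> p < 2\<close>. The value is meaningful only at those \<open>\<xi>\<close> where the limit
  exists, which is almost every \<open>\<xi>\<close> by the theorem of Christ and Kiselev.
\<close>

definition nlft_a_Lp :: "(real \<Rightarrow> complex) \<Rightarrow> real \<Rightarrow> complex" where
  "nlft_a_Lp f \<xi> = Lim at_top (\<lambda>R. nlft_a (truncation R f) \<xi>)"

end

theory Submission
  imports Defs "HOL-Complex_Analysis.Complex_Analysis"
begin

text \<open>
  The function \<open>log |a|\<^sup>2 = - log (1 - |b/a|\<^sup>2)\<close> is the squared norm of a cocycle of \<open>SU(1,1)\<close>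
  with values in the Dirichlet space of the disc, whose kernel is \<open>- log (1 - cnj w * z)\<close>. Along a
  product of \<open>N\<close> matrices the cocycle is a sum of \<open>N\<close> increments, so \<open>log |a|\<^sup>2\<close> is the sum of the
  entries of their Gram matrix \<open>E\<^sub>i\<^sub>j\<close>. With \<open>c\<^sub>i\<close> the norm of the \<open>i\<close>-th increment one has
  \<open>|E\<^sub>i\<^sub>j| \<le> c\<^sub>i c\<^sub>j\<close> for every frequency, while the mean over the frequency is \<open>E\<^sub>i\<^sub>i = c\<^sub>i\<^sup>2\<close> on the
  diagonal and \<open>0\<close> off it, because the off-diagonal entries extend holomorphically to the disc and
  vanish at its centre. These are the \<open>L\<^sup>1 \<rightarrow> L\<^sup>\<infinity>\<close> and \<open>L\<^sup>2 \<rightarrow> L\<^sup>2\<close> bounds, with constant \<open>1\<close>, of a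
  linear map from sequences to vector-valued functions which takes \<open>(c\<^sub>i)\<close> to a function of norm
  \<open>(log |a|\<^sup>2)\<^sup>1\<^sup>/\<^sup>2\<close>; the three lines theorem gives the intermediate exponents. Fine discretizations
  of the potential and Fatou's lemma give the claim.
\<close>

section \<open>Primitives and absolute continuity\<close>

text \<open>The transform is nonlinear, so interpolation cannot be applied to it directly. For one
  discretized potential, however, the increments are fixed vectors depending on the frequency; only
  their coefficients and a dual density are deformed analytically, and the nonlinearity stays inside
  the Gram matrix. The delicate point is the vanishing of the off-diagonal means. Equal spacing of
  the nodes makes the phase of the j-th step z^j, up to a common phase. Removing the automorphism
  shared by two increments leaves a conjugate only on z^i, which cancels on the unit circle against
  the phase of the later path. What remains is holomorphic in z and carries a factor z. The constant
  1 survives the refinement because the scales cancel: on cells of length \<delta>, Hoelder's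
  inequality costs \<delta>^(p-1), the exponent 1/(p-1) turns this into \<delta>, and one period in
  the frequency has length 1/\<delta>. For p = 1 the entry bound already holds at every frequency,
  so that case is settled pointwise.\<close>

lemma division_real_interval:
  fixes D :: "real set set"
  assumes "D division_of S" "K \<in> D"
  obtains a b where "a \<le> b" "K = {a..b}" "Inf K = a" "Sup K = b" "measure lebesgue K = b - a"
proof -
  obtain a b where "K = cbox a b" using division_ofD(4)[OF assms] by blast
  with division_ofD(3)[OF assms] have K: "K = cbox a b" "K \<noteq> {}" by auto
  then have "a \<le> b" by simp
  then show ?thesis using that[of a b] K by simp
qed

text \<open>Dominated convergence makes the excess of the norm over a high level small. Absolute
  continuity of a primitive then splits into a Lipschitz part with constant M and this
  excess.\<close>

lemma abs_integrable_norm_small: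
  fixes h :: "real \<Rightarrow> 'a::euclidean_space"
  assumes h: "h absolutely_integrable_on UNIV" and \<epsilon>: "0 < \<epsilon>"
  obtains M where "0 < M" "(\<lambda>x. max 0 (norm (h x) - M)) integrable_on UNIV"
    "integral UNIV (\<lambda>x. max 0 (norm (h x) - M)) < \<epsilon>"
proof -
  have meas: "h \<in> borel_measurable lebesgue"
    using h by (simp add: set_integrable_def)
  have nh: "(\<lambda>x. norm (h x)) integrable_on UNIV"
    using h by (simp add: absolutely_integrable_on_def)
  have ai: "(\<lambda>x. max 0 (norm (h x) - M)) absolutely_integrable_on UNIV" if "0 \<le> M" for M
    by (rule measurable_bounded_by_integrable_imp_absolutely_integrable[OF _ _ nh])
       (use meas that in \<open>auto simp: lebesgue_on_UNIV_eq\<close>)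
  have "(\<lambda>n. integral UNIV (\<lambda>x. max 0 (norm (h x) - real n))) \<longlonglongrightarrow> integral UNIV (\<lambda>x::real. 0::real)"
  proof (rule dominated_convergence(2)[OF _ nh])
    show "(\<lambda>x. max 0 (norm (h x) - real n)) integrable_on UNIV" for n
      using ai[of "real n"] by (simp add: absolutely_integrable_on_def)
    show "norm (max 0 (norm (h x) - real n)) \<le> norm (h x)" for n x by auto
    show "(\<lambda>n. max 0 (norm (h x) - real n)) \<longlonglongrightarrow> 0" for x
    proof (rule tendsto_eventually)
      obtain m where "norm (h x) \<le> real m" using real_arch_simple by blast
      then show "\<forall>\<^sub>F n in sequentially. max 0 (norm (h x) - real n) = 0"
        by (intro eventually_sequentiallyI[of m]) auto
    qed
  qed
  then have "\<forall>\<^sub>F n in sequentially. integral UNIV (\<lambda>x. max 0 (norm (h x) - real n)) < \<epsilon>"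
    using \<epsilon> by (simp add: order_tendsto_iff)
  then have "\<forall>\<^sub>F n in sequentially. integral UNIV (\<lambda>x. max 0 (norm (h x) - real n)) < \<epsilon> \<and> 0 < n"
    by (simp add: eventually_conj eventually_gt_at_top)
  then obtain n :: nat where "integral UNIV (\<lambda>x. max 0 (norm (h x) - real n)) < \<epsilon>" "0 < n"
    using eventually_happens'[OF sequentially_bot] by blast
  then show ?thesis using that[of "real n"] ai[of "real n"] by (simp add: absolutely_integrable_on_def)
qed

text \<open>Comparing increments, rather than composing with a Lipschitz map, lets the same
  statement serve for the components of a solution and for the exponential of the mass, which is
  Lipschitz only on a bounded range.\<close>

lemma abs_continuous_on_Lipschitz:
  assumes F: "abs_continuous_on UNIV F"
    and G: "\<And>x y. norm (G y - G x) \<le> C * norm (F y - F x)" and C: "0 < C"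
  shows "abs_continuous_on UNIV G"
  unfolding abs_continuous_on_def
proof (intro allI impI)
  fix \<epsilon> :: real assume "0 < \<epsilon>"
  then have "0 < \<epsilon> / C" using C by simp
  then obtain \<delta> where \<delta>: "0 < \<delta>"
    "\<And>D. D division_of \<Union>D \<Longrightarrow> (\<Sum>K\<in>D. Sup K - Inf K) < \<delta> \<Longrightarrow> (\<Sum>K\<in>D. norm (F (Sup K) - F (Inf K))) < \<epsilon> / C"
    using F unfolding abs_continuous_on_def by (meson subset_UNIV)
  have "(\<Sum>K\<in>D. norm (G (Sup K) - G (Inf K))) < \<epsilon>"
    if "D division_of \<Union>D" "(\<Sum>K\<in>D. Sup K - Inf K) < \<delta>" for D
  proof -
    have "(\<Sum>K\<in>D. norm (G (Sup K) - G (Inf K))) \<le> C * (\<Sum>K\<in>D. norm (F (Sup K) - F (Inf K)))"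
      unfolding sum_distrib_left by (intro sum_mono G)
    also have "\<dots> < C * (\<epsilon> / C)" using \<delta>(2)[OF that] C by (intro mult_strict_left_mono)
    finally show ?thesis using C by simp
  qed
  then show "\<exists>\<delta>>0. \<forall>D. D division_of \<Union>D \<and> \<Union>D \<subseteq> UNIV \<and> (\<Sum>K\<in>D. Sup K - Inf K) < \<delta> \<longrightarrow>
      (\<Sum>K\<in>D. norm (G (Sup K) - G (Inf K))) < \<epsilon>"
    using \<delta>(1) by blast
qed

lemma abs_continuous_on_Pair:
  assumes "abs_continuous_on UNIV F" "abs_continuous_on UNIV G"
  shows "abs_continuous_on UNIV (\<lambda>x. (F x, G x))"
  unfolding abs_continuous_on_def
proof (intro allI impI)
  fix \<epsilon> :: real assume "0 < \<epsilon>"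
  then have \<epsilon>: "0 < \<epsilon> / 2" by simp
  obtain \<delta>1 where \<delta>1: "0 < \<delta>1"
    "\<And>D. D division_of \<Union>D \<Longrightarrow> (\<Sum>K\<in>D. Sup K - Inf K) < \<delta>1 \<Longrightarrow> (\<Sum>K\<in>D. norm (F (Sup K) - F (Inf K))) < \<epsilon> / 2"
    using assms(1) \<epsilon> unfolding abs_continuous_on_def by (meson subset_UNIV)
  obtain \<delta>2 where \<delta>2: "0 < \<delta>2"
    "\<And>D. D division_of \<Union>D \<Longrightarrow> (\<Sum>K\<in>D. Sup K - Inf K) < \<delta>2 \<Longrightarrow> (\<Sum>K\<in>D. norm (G (Sup K) - G (Inf K))) < \<epsilon> / 2"
    using assms(2) \<epsilon> unfolding abs_continuous_on_def by (meson subset_UNIV)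
  have "(\<Sum>K\<in>D. norm ((F (Sup K), G (Sup K)) - (F (Inf K), G (Inf K)))) < \<epsilon>"
    if "D division_of \<Union>D" "(\<Sum>K\<in>D. Sup K - Inf K) < min \<delta>1 \<delta>2" for D
  proof -
    have "(\<Sum>K\<in>D. norm ((F (Sup K), G (Sup K)) - (F (Inf K), G (Inf K))))
        \<le> (\<Sum>K\<in>D. norm (F (Sup K) - F (Inf K)) + norm (G (Sup K) - G (Inf K)))"
      by (intro sum_mono) (simp add: norm_Pair_le)
    then show ?thesis using \<delta>1(2)[OF that(1)] \<delta>2(2)[OF that(1)] that(2) by (simp add: sum.distrib)
  qed
  then show "\<exists>\<delta>>0. \<forall>D. D division_of \<Union>D \<and> \<Union>D \<subseteq> UNIV \<and> (\<Sum>K\<in>D. Sup K - Inf K) < \<delta> \<longrightarrow>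
      (\<Sum>K\<in>D. norm ((F (Sup K), G (Sup K)) - (F (Inf K), G (Inf K)))) < \<epsilon>"
    using \<delta>1(1) \<delta>2(1) by (intro exI[of _ "min \<delta>1 \<delta>2"]) auto
qed

lemma abs_continuous_on_uniformly_continuous:
  assumes "abs_continuous_on UNIV F"
  shows "uniformly_continuous_on UNIV F"
  unfolding uniformly_continuous_on_def
proof (intro allI impI)
  fix \<epsilon> :: real assume "0 < \<epsilon>"
  then obtain \<delta> where \<delta>: "0 < \<delta>"
    "\<And>D. D division_of \<Union>D \<Longrightarrow> (\<Sum>K\<in>D. Sup K - Inf K) < \<delta> \<Longrightarrow> (\<Sum>K\<in>D. norm (F (Sup K) - F (Inf K))) < \<epsilon>"
    using assms unfolding abs_continuous_on_def by (meson subset_UNIV)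
  have *: "norm (F y - F x) < \<epsilon>" if "x \<le> y" "y - x < \<delta>" for x y
  proof -
    have "{{x..y}} division_of \<Union>{{x..y}}" using division_of_self[of x y] that by simp
    then show ?thesis using \<delta>(2)[of "{{x..y}}"] that by simp
  qed
  have "dist (F y) (F x) < \<epsilon>" if "dist y x < \<delta>" for x y
    using *[of x y] *[of y x] that by (cases "x \<le> y") (auto simp: dist_norm norm_minus_commute)
  then show "\<exists>\<delta>>0. \<forall>x\<in>UNIV. \<forall>x'\<in>UNIV. dist x' x < \<delta> \<longrightarrow> dist (F x') (F x) < \<epsilon>"
    using \<delta>(1) by blast
qed

text \<open>Tags in the exceptional null set are confined to an open set of small measure, where absolute
  continuity controls the increments; elsewhere the derivative does.\<close>

lemma abs_continuous_ftc:
  fixes F :: "real \<Rightarrow> 'a::euclidean_space"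
  assumes ac: "abs_continuous_on UNIV F" and N: "negligible N"
    and der: "\<And>x. x \<notin> N \<Longrightarrow> (F has_vector_derivative f x) (at x)" and ab: "a \<le> b"
  shows "(f has_integral (F b - F a)) {a..b}"
proof -
  \<comment> \<open>Tags in N now contribute nothing to Riemann sums; the change on a null set is
    undone at the end.\<close>
  define g where "g x = (if x \<in> N then 0 else f x)" for x
  have "(g has_integral (F b - F a)) {a..b}"
    unfolding has_integral_real
  proof (intro allI impI)
    fix \<epsilon> :: real assume \<epsilon>: "0 < \<epsilon>"
    obtain \<delta> where \<delta>: "0 < \<delta>"
      "\<And>D. D division_of \<Union>D \<Longrightarrow> (\<Sum>K\<in>D. Sup K - Inf K) < \<delta> \<Longrightarrow> (\<Sum>K\<in>D. norm (F (Sup K) - F (Inf K))) < \<epsilon> / 2"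
      using ac \<epsilon> half_gt_zero[OF \<epsilon>] unfolding abs_continuous_on_def by (meson subset_UNIV)
    define \<eta> where "\<eta> = \<epsilon> / (2 * (b - a + 1))"
    have \<eta>: "0 < \<eta>" "\<eta> * (b - a) < \<epsilon> / 2" using \<epsilon> ab by (auto simp: \<eta>_def field_simps)
    obtain T where T: "open T" "N \<subseteq> T" "T \<in> lmeasurable" "measure lebesgue T < \<delta>"
    proof -
      obtain T where T: "open T" "N \<subseteq> T" "T - N \<in> lmeasurable" "emeasure lebesgue (T - N) < ennreal \<delta>"
        using sets_lebesgue_outer_open[OF negligible_imp_sets[OF N] \<delta>(1)] by blast
      have "T = (T - N) \<union> N" using T(2) by blast
      then have Tm: "T \<in> lmeasurable"
        using T(3) negligible_imp_measurable[OF N] by (metis fmeasurable.Un)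
      have "measure lebesgue T = measure lebesgue (T - N)"
        using measure_negligible_symdiff[of T "T - N"] Tm N
        by (metis (no_types, lifting) Diff_Diff_Int Diff_subset T(3) Un_Diff_Int measure_Diff_null_set negligible_iff_null_sets sup.absorb_iff2 fmeasurableD)
      also have "\<dots> < \<delta>"
        using T(3,4) \<delta>(1) by (simp add: emeasure_eq_measure2 ennreal_less_iff)
      finally show ?thesis using that T Tm by blast
    qed
    have "\<exists>d>0. \<forall>y. norm (y - x) < d \<longrightarrow> norm (F y - F x - (y - x) *\<^sub>R f x) \<le> \<eta> * norm (y - x)" if "x \<notin> N" for x
      using der[OF that] \<eta>(1) unfolding has_vector_derivative_def has_derivative_within_alt by auto
    then obtain d where d: "\<And>x. x \<notin> N \<Longrightarrow> 0 < d x"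
      "\<And>x y. x \<notin> N \<Longrightarrow> norm (y - x) < d x \<Longrightarrow> norm (F y - F x - (y - x) *\<^sub>R f x) \<le> \<eta> * norm (y - x)"
      by metis
    define \<gamma> where "\<gamma> x = (if x \<in> N then T else ball x (d x))" for x
    have gauge: "gauge \<gamma>" unfolding gauge_def \<gamma>_def using T d(1) by auto
    have bound: "norm ((\<Sum>(x,K)\<in>\<D>. measure lborel K *\<^sub>R g x) - (F b - F a)) < \<epsilon>"
      if D: "\<D> tagged_division_of {a..b}" and fine: "\<gamma> fine \<D>" for \<D>
    proof -
      let ?e = "\<lambda>(x, K). measure lborel K *\<^sub>R g x - (F (Sup K) - F (Inf K))"
      define P where "P = {(x, K) \<in> \<D>. x \<in> N}"
      have fin: "finite \<D>" using D by auto
      have "(\<Sum>(x,K)\<in>\<D>. measure lborel K *\<^sub>R g x) - (F b - F a) = (\<Sum>z\<in>\<D>. ?e z)"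
        unfolding additive_tagged_division_1[OF ab D, symmetric, of F]
        by (simp add: sum_subtractf[symmetric] case_prod_beta)
      also have "\<dots> = sum ?e (\<D> - P) + sum ?e P"
        using fin by (intro sum.subset_diff) (auto simp: P_def)
      finally have eq: "(\<Sum>(x,K)\<in>\<D>. measure lborel K *\<^sub>R g x) - (F b - F a) = sum ?e (\<D> - P) + sum ?e P" .
      have "norm (sum ?e (\<D> - P)) \<le> (\<Sum>(x, K)\<in>\<D> - P. \<eta> * measure lborel K)"
      proof (intro sum_norm_le, clarify)
        fix x K assume xK: "(x, K) \<in> \<D>" "(x, K) \<notin> P"
        then have x: "x \<notin> N" by (auto simp: P_def)
        obtain u v where K: "K = {u..v}" "u \<le> v"
          using D xK by (metis box_real(2) tagged_division_ofD(2,4) atLeastAtMost_iff order_trans)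
        have xK': "u \<le> x" "x \<le> v" using tagged_division_ofD(2)[OF D xK(1)] K by auto
        have sub: "{u..v} \<subseteq> ball x (d x)" using fineD[OF fine xK(1)] K x by (simp add: \<gamma>_def)
        then have "v \<in> ball x (d x)" "u \<in> ball x (d x)" using K by auto
        then have "norm (v - x) < d x" "norm (u - x) < d x" by (auto simp: dist_real_def)
        then have 1: "norm (F v - F x - (v - x) *\<^sub>R f x) \<le> \<eta> * (v - x)"
          and 2: "norm (F u - F x - (u - x) *\<^sub>R f x) \<le> \<eta> * (x - u)"
          using d(2)[OF x, of v] d(2)[OF x, of u] xK' by auto
        have e: "(v - u) *\<^sub>R f x - (F v - F u)
           = (F u - F x - (u - x) *\<^sub>R f x) - (F v - F x - (v - x) *\<^sub>R f x)"
          by (simp add: algebra_simps)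
        have "norm ((v - u) *\<^sub>R f x - (F v - F u)) \<le> \<eta> * (x - u) + \<eta> * (v - x)"
          unfolding e by (rule norm_triangle_le_diff) (use 1 2 in linarith)
        then show "norm (measure lborel K *\<^sub>R g x - (F (Sup K) - F (Inf K))) \<le> \<eta> * measure lborel K"
          using K x by (simp add: g_def algebra_simps)
      qed
      also have "\<dots> \<le> (\<Sum>(x, K)\<in>\<D>. \<eta> * measure lborel K)"
        using fin \<eta> by (intro sum_mono2) auto
      also have "\<dots> = \<eta> * (b - a)"
        using additive_content_tagged_division[of \<D> a b] D ab
        by (simp add: case_prod_beta sum_distrib_left[symmetric])
      finally have A: "norm (sum ?e (\<D> - P)) < \<epsilon> / 2" using \<eta> by simp
      have "P tagged_partial_division_of {a..b}"
        by (rule tagged_partial_division_subset[of \<D>]) (use D in \<open>auto simp: P_def tagged_division_of_def\<close>)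
      then have Pt: "P tagged_division_of \<Union>(snd ` P)" by (rule tagged_partial_division_of_Union_self)
      then have Pd: "snd ` P division_of \<Union>(snd ` P)" by (rule division_of_tagged_division)
      \<comment> \<open>The sum over tagged pairs is turned into a sum over intervals, which
        requires a set function vanishing on degenerate intervals. The empty interval gets the value
        0 explicitly, since \<open>Sup\<close> and \<open>Inf\<close> carry no information
        there.\<close>
      define \<omega> where "\<omega> K = (if K = {} then 0 else norm (F (Sup K) - F (Inf K)))" for K
      have \<omega>: "\<omega> K = norm (F (Sup K) - F (Inf K))" if "K \<in> snd ` P" for K
        using division_ofD(3)[OF Pd that] by (simp add: \<omega>_def)
      have "norm (sum ?e P) \<le> (\<Sum>(x, K)\<in>P. \<omega> K)"
      proof (intro sum_norm_le, clarify)
        fix x K assume xK: "(x, K) \<in> P"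
        then have "\<omega> K = norm (F (Sup K) - F (Inf K))" by (intro \<omega>) force
        then show "norm (measure lborel K *\<^sub>R g x - (F (Sup K) - F (Inf K))) \<le> \<omega> K"
          using xK by (simp add: P_def g_def norm_minus_commute)
      qed
      also have "\<dots> = (\<Sum>K\<in>snd ` P. \<omega> K)"
      proof (rule sum.over_tagged_division_lemma[OF Pt])
        fix u v :: real assume "box u v = {}"
        then have "v \<le> u" by simp
        then show "\<omega> (cbox u v) = 0"
          by (cases "u = v") (auto simp: \<omega>_def)
      qed
      also have "\<dots> = (\<Sum>K\<in>snd ` P. norm (F (Sup K) - F (Inf K)))"
        by (intro sum.cong refl \<omega>)
      also have "\<dots> < \<epsilon> / 2"
      proof (rule \<delta>(2)[OF Pd])
        have "(\<Sum>K\<in>snd ` P. Sup K - Inf K) = (\<Sum>K\<in>snd ` P. measure lebesgue K)"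
          by (intro sum.cong refl) (metis division_real_interval[OF Pd])
        also have "\<dots> = measure lebesgue (\<Union>(snd ` P))" by (rule content_division[OF Pd])
        also have "\<dots> \<le> measure lebesgue T"
        proof (rule measure_mono_fmeasurable)
          have "K \<subseteq> T" if "(x, K) \<in> P" for x K
            using fineD[OF fine, of x K] that by (simp add: P_def \<gamma>_def)
          then show "\<Union>(snd ` P) \<subseteq> T" by fastforce
          show "\<Union>(snd ` P) \<in> sets lebesgue" using lmeasurable_division[OF Pd] by auto
        qed (rule T(3))
        finally show "(\<Sum>K\<in>snd ` P. Sup K - Inf K) < \<delta>" using T by simp
      qed
      finally have B: "norm (sum ?e P) < \<epsilon> / 2" .
      show ?thesis unfolding eq using norm_triangle_ineq[of "sum ?e (\<D> - P)" "sum ?e P"] A B by linarith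
    qed
    show "\<exists>\<gamma>. gauge \<gamma> \<and> (\<forall>\<D>. \<D> tagged_division_of {a..b} \<and> \<gamma> fine \<D> \<longrightarrow>
        norm ((\<Sum>(x,K)\<in>\<D>. measure lborel K *\<^sub>R g x) - (F b - F a)) < \<epsilon>)"
      by (intro exI[of _ \<gamma>] conjI allI impI gauge bound) simp_all
  qed
  then show ?thesis
    by (rule has_integral_spike[OF N, rotated]) (auto simp: g_def)
qed

section \<open>Primitives of integrable functions, started at minus infinity\<close>

definition primitive :: "(real \<Rightarrow> 'a::euclidean_space) \<Rightarrow> real \<Rightarrow> 'a" where
  "primitive h x = integral {..x} h"

context
  fixes h :: "real \<Rightarrow> 'a::euclidean_space"
  assumes h: "h absolutely_integrable_on UNIV"
begin

lemma abs_integrable_subset: "S \<in> sets lebesgue \<Longrightarrow> h absolutely_integrable_on S"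
  using h by (rule set_integrable_subset) auto

lemma primitive_diff: "a \<le> b \<Longrightarrow> primitive h b - primitive h a = integral {a..b} h"
proof -
  assume ab: "a \<le> b"
  have "(h has_integral (integral {..a} h + integral {a..b} h)) ({..a} \<union> {a..b})"
  proof (rule has_integral_Un)
    show "negligible ({..a} \<inter> {a..b})" by (rule negligible_subset[of "{a}"]) auto
  qed (use abs_integrable_subset in \<open>auto intro!: integrable_integral simp: absolutely_integrable_on_def\<close>)
  moreover have "{..a} \<union> {a..b} = {..b}" using ab by auto
  ultimately show ?thesis unfolding primitive_def by (simp add: integral_unique)
qed

lemma primitive_diff_norm: "a \<le> b \<Longrightarrow> norm (primitive h b - primitive h a) \<le> integral {a..b} (\<lambda>x. norm (h x))"
  using abs_integrable_subset[of "{a..b}"]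
  by (simp add: primitive_diff absolutely_integrable_on_def integral_norm_bound_integral)

lemma primitive_abs_continuous: "abs_continuous_on UNIV (primitive h)"
  unfolding abs_continuous_on_def
proof (intro allI impI)
  fix \<epsilon> :: real assume \<epsilon>: "0 < \<epsilon>"
  then obtain M where M: "0 < M" "(\<lambda>x. max 0 (norm (h x) - M)) integrable_on UNIV"
    "integral UNIV (\<lambda>x. max 0 (norm (h x) - M)) < \<epsilon> / 2"
    using abs_integrable_norm_small[OF h, of "\<epsilon> / 2"] by auto
  let ?k = "\<lambda>x. max 0 (norm (h x) - M)"
  have "(\<Sum>K\<in>D. norm (primitive h (Sup K) - primitive h (Inf K))) < \<epsilon>"
    if D: "D division_of \<Union>D" and small: "(\<Sum>K\<in>D. Sup K - Inf K) < \<epsilon> / (2 * M)" for D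
  proof -
    have kK: "?k integrable_on K" if "K \<in> D" for K
      by (rule division_real_interval[OF D that]) (use integrable_on_subinterval[OF M(2)] in auto)
    have "norm (primitive h (Sup K) - primitive h (Inf K)) \<le> M * (Sup K - Inf K) + integral K ?k" if KD: "K \<in> D" for K
    proof -
      obtain a b where K: "a \<le> b" "K = {a..b}" "Inf K = a" "Sup K = b"
        using division_real_interval[OF D KD] by metis
      have "norm (primitive h b - primitive h a) \<le> integral {a..b} (\<lambda>x. norm (h x))"
        by (rule primitive_diff_norm[OF K(1)])
      also have "\<dots> \<le> integral {a..b} (\<lambda>x. M + ?k x)"
        using abs_integrable_subset[of "{a..b}"] kK[OF KD] K
        by (intro integral_le integrable_add) (auto simp: absolutely_integrable_on_def)
      also have "\<dots> = M * (b - a) + integral {a..b} ?k"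
        using kK[OF KD] K by (subst integral_add) auto
      finally show ?thesis using K by simp
    qed
    then have "(\<Sum>K\<in>D. norm (primitive h (Sup K) - primitive h (Inf K)))
        \<le> M * (\<Sum>K\<in>D. Sup K - Inf K) + (\<Sum>K\<in>D. integral K ?k)"
      by (simp add: sum_distrib_left sum.distrib[symmetric] sum_mono)
    also have "(\<Sum>K\<in>D. integral K ?k) = integral (\<Union>D) ?k"
      using has_integral_combine_division_topdown[OF M(2) D] by (simp add: integral_unique)
    also have "\<dots> \<le> integral UNIV ?k"
      using has_integral_combine_division_topdown[OF M(2) D] M(2)
      by (intro integral_subset_le) (auto simp: has_integral_integrable)
    also have "M * (\<Sum>K\<in>D. Sup K - Inf K) + integral UNIV ?k < \<epsilon>"
      using M small by (simp add: field_simps)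
    finally show ?thesis by simp
  qed
  moreover have "0 < \<epsilon> / (2 * M)" using \<epsilon> M by simp
  ultimately show "\<exists>\<delta>>0. \<forall>D. D division_of \<Union>D \<and> \<Union>D \<subseteq> UNIV \<and> (\<Sum>K\<in>D. Sup K - Inf K) < \<delta> \<longrightarrow>
      (\<Sum>K\<in>D. norm (primitive h (Sup K) - primitive h (Inf K))) < \<epsilon>" by blast
qed

lemma primitive_continuous: "continuous_on UNIV (primitive h)"
  using primitive_abs_continuous abs_continuous_on_uniformly_continuous uniformly_continuous_imp_continuous by blast

lemma primitive_tendsto:
  "(primitive h \<longlongrightarrow> integral UNIV h) at_top" "(primitive h \<longlongrightarrow> 0) at_bot"
proof -
  have eq: "primitive h x = (LINT t|lebesgue. indicator {..x} t *\<^sub>R h t)" for x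
    unfolding primitive_def
    using set_lebesgue_integral_eq_integral(2)[OF abs_integrable_subset[of "{..x}"]]
    by (simp add: set_lebesgue_integral_def)
  have hi: "integrable lebesgue h" using h by (simp add: set_integrable_def)
  have meas: "(\<lambda>t. indicator {..x} t *\<^sub>R h t) \<in> borel_measurable lebesgue" for x :: real
    by (intro borel_measurable_scaleR borel_measurable_indicator borel_measurable_integrable[OF hi]) auto
  have "((\<lambda>x. LINT t|lebesgue. indicator {..x} t *\<^sub>R h t) \<longlongrightarrow> (LINT t|lebesgue. h t)) at_top"
  proof (rule integral_dominated_convergence_at_top[where w = "\<lambda>t. norm (h t)"])
    show "AE t in lebesgue. ((\<lambda>x. indicator {..x} t *\<^sub>R h t) \<longlongrightarrow> h t) at_top"
    proof (intro AE_I2 tendsto_eventually)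
      show "\<forall>\<^sub>F x in at_top. indicator {..x} t *\<^sub>R h t = h t" for t
        using eventually_ge_at_top[of t] by eventually_elim simp
    qed
  qed (use hi meas in \<open>auto intro!: always_eventually simp: indicator_times_eq_if split: split_indicator\<close>)
  moreover have "(LINT t|lebesgue. h t) = integral UNIV h"
    using set_lebesgue_integral_eq_integral(2)[OF h] by (simp add: set_lebesgue_integral_def)
  ultimately show "(primitive h \<longlongrightarrow> integral UNIV h) at_top" by (simp add: eq[abs_def])
  have "((\<lambda>x. LINT t|lebesgue. indicator {..-x} t *\<^sub>R h t) \<longlongrightarrow> (LINT t::real|lebesgue. (0::'a))) at_top"
  proof (rule integral_dominated_convergence_at_top[where w = "\<lambda>t. norm (h t)"
        and f = "\<lambda>_::real. 0::'a" and s = "\<lambda>x t. indicator {..-x} t *\<^sub>R h t"])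
    show "AE t in lebesgue. ((\<lambda>x. indicator {..-x} t *\<^sub>R h t) \<longlongrightarrow> 0) at_top"
    proof (intro AE_I2 tendsto_eventually)
      show "\<forall>\<^sub>F x in at_top. indicator {..-x} t *\<^sub>R h t = 0" for t
        using eventually_gt_at_top[of "-t"] by eventually_elim simp
    qed
  qed (use hi meas in \<open>auto intro!: always_eventually simp: indicator_times_eq_if split: split_indicator\<close>)
  then show "(primitive h \<longlongrightarrow> 0) at_bot"
    by (simp add: eq[abs_def] filterlim_at_bot_mirror)
qed

text \<open>Lebesgue differentiation is applied to averages over intervals with left endpoint x,
  which yields only the right-hand derivative. The estimate is written without division so that k =
  0 is included.\<close>

lemma primitive_right_derivative:
  obtains N where "negligible N"
    "\<And>x e. x \<notin> N \<Longrightarrow> 0 < e \<Longrightarrow> \<exists>d>0. \<forall>k. 0 \<le> k \<and> k < d \<longrightarrow>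
       norm (integral {x..x + k} h - k *\<^sub>R h x) \<le> e * k"
proof -
  obtain N where N: "negligible N"
    "\<And>x e. \<lbrakk>x \<notin> N; 0 < e\<rbrakk> \<Longrightarrow> \<exists>d>0. \<forall>k. 0 < k \<and> k < d \<longrightarrow>
        norm (integral (cbox x (x + k *\<^sub>R One)) h /\<^sub>R k ^ DIM(real) - h x) < e"
  proof (rule integrable_ccontinuous_explicit)
    show "h integrable_on cbox a b" for a b
      using abs_integrable_subset[of "cbox a b"] by (simp add: absolutely_integrable_on_def)
  qed blast
  show ?thesis
  proof (rule that[OF N(1)])
    fix x and e :: real assume "x \<notin> N" "0 < e"
    then obtain d where d: "0 < d" "\<And>k. 0 < k \<Longrightarrow> k < d \<Longrightarrow> norm (integral {x..x+k} h /\<^sub>R k - h x) < e"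
      using N(2)[of x e] by auto
    have "norm (integral {x..x + k} h - k *\<^sub>R h x) \<le> e * k" if "0 \<le> k" "k < d" for k
    proof (cases "k = 0")
      case False
      then have k: "0 < k" using that by simp
      have "integral {x..x + k} h - k *\<^sub>R h x = k *\<^sub>R (integral {x..x+k} h /\<^sub>R k - h x)"
        using k by (simp add: algebra_simps)
      then have "norm (integral {x..x + k} h - k *\<^sub>R h x) = k * norm (integral {x..x+k} h /\<^sub>R k - h x)"
        using k by simp
      then show ?thesis using d(2)[of k] k that by (simp add: mult.commute)
    qed simp
    then show "\<exists>d>0. \<forall>k. 0 \<le> k \<and> k < d \<longrightarrow> norm (integral {x..x + k} h - k *\<^sub>R h x) \<le> e * k"
      using d(1) by blast
  qed
qed

end

text \<open>The left-hand derivative at x is the right-hand one of the reflected function at -x; the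
  exceptional set is the union of one null set and the reflection of another.\<close>

lemma primitive_derivative:
  fixes h :: "real \<Rightarrow> 'a::euclidean_space"
  assumes h: "h absolutely_integrable_on UNIV"
  obtains N where "negligible N" "\<And>x. x \<notin> N \<Longrightarrow> (primitive h has_vector_derivative h x) (at x)"
proof -
  obtain N1 where N1: "negligible N1"
    "\<And>x e. x \<notin> N1 \<Longrightarrow> 0 < e \<Longrightarrow> \<exists>d>0. \<forall>k. 0 \<le> k \<and> k < d \<longrightarrow> norm (integral {x..x + k} h - k *\<^sub>R h x) \<le> e * k"
    using primitive_right_derivative[OF h] by metis
  have h': "(\<lambda>x. h (- x)) absolutely_integrable_on UNIV"
    using h lebesgue_integrable_real_affine[of h "-1" 0] by (simp add: set_integrable_def)
  obtain N2 where N2: "negligible N2"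
    "\<And>x e. x \<notin> N2 \<Longrightarrow> 0 < e \<Longrightarrow> \<exists>d>0. \<forall>k. 0 \<le> k \<and> k < d \<longrightarrow> norm (integral {x..x + k} (\<lambda>x. h (- x)) - k *\<^sub>R h (- x)) \<le> e * k"
    using primitive_right_derivative[OF h'] by metis
  show ?thesis
  proof (rule that[of "N1 \<union> uminus ` N2"])
    have "negligible (uminus ` N2)"
      by (rule negligible_differentiable_image_negligible[OF _ N2(1)]) (auto intro!: derivative_intros)
    then show "negligible (N1 \<union> uminus ` N2)" using N1(1) by simp
    fix x assume x: "x \<notin> N1 \<union> uminus ` N2"
    then have x1: "x \<notin> N1" and x2: "- x \<notin> N2" by force+
    show "(primitive h has_vector_derivative h x) (at x)"
      unfolding has_vector_derivative_def has_derivative_within_alt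
    proof (intro conjI allI impI)
      show "bounded_linear (\<lambda>t. t *\<^sub>R h x)" by (rule bounded_linear_scaleR_left)
      fix e :: real assume e: "0 < e"
      obtain d1 where d1: "0 < d1" "\<And>k. 0 \<le> k \<Longrightarrow> k < d1 \<Longrightarrow> norm (integral {x..x + k} h - k *\<^sub>R h x) \<le> e * k"
        using N1(2)[OF x1 e] by blast
      obtain d2 where d2: "0 < d2" "\<And>k. 0 \<le> k \<Longrightarrow> k < d2 \<Longrightarrow> norm (integral {- x..- x + k} (\<lambda>x. h (- x)) - k *\<^sub>R h x) \<le> e * k"
        using N2(2)[OF x2 e] by auto
      have "norm (primitive h y - primitive h x - (y - x) *\<^sub>R h x) \<le> e * norm (y - x)"
        if y: "norm (y - x) < min d1 d2" for y
      proof (cases "x \<le> y")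
        case True
        then show ?thesis using d1(2)[of "y - x"] y primitive_diff[OF h True] by simp
      next
        case False
        then have "primitive h x - primitive h y = integral {y..x} h" using primitive_diff[OF h, of y x] by simp
        also have "\<dots> = integral {-x..-y} (\<lambda>x. h (- x))"
          by (simp add: Henstock_Kurzweil_Integration.integral_reflect_real)
        finally have "primitive h y - primitive h x - (y - x) *\<^sub>R h x
             = - (integral {- x..- x + (x - y)} (\<lambda>x. h (- x)) - (x - y) *\<^sub>R h x)"
          by (simp add: algebra_simps)
        then show ?thesis using d2(2)[of "x - y"] y False by (simp add: norm_minus_commute)
      qed
      then show "\<exists>d>0. \<forall>y\<in>UNIV. norm (y - x) < d \<longrightarrow>
          norm (primitive h y - primitive h x - (y - x) *\<^sub>R h x) \<le> e * norm (y - x)"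
        using d1(1) d2(1) by (intro exI[of _ "min d1 d2"]) auto
    qed
  qed
qed

section \<open>The differential equation\<close>

definition nlft_field :: "(real \<Rightarrow> complex) \<Rightarrow> real \<Rightarrow> real \<Rightarrow> complex \<times> complex \<Rightarrow> complex \<times> complex" where
  "nlft_field g \<xi> x y = (cnj (g x) * exp (2 * pi * \<i> * x * \<xi>) * snd y, g x * exp (- (2 * pi * \<i> * x * \<xi>)) * fst y)"

text \<open>The coefficient matrix is \<open>cmod (g x)\<close> times an antidiagonal unitary
  matrix, hence equality and not just a bound.\<close>

lemma nlft_field_norm: "norm (nlft_field g \<xi> x y) = cmod (g x) * norm y"
proof -
  have "cmod (exp (2 * pi * \<i> * x * \<xi>)) = 1" "cmod (exp (- (2 * pi * \<i> * x * \<xi>))) = 1"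
    by (simp_all add: norm_exp_eq_Re)
  then have "norm (nlft_field g \<xi> x y) = sqrt ((cmod (g x) * cmod (snd y))\<^sup>2 + (cmod (g x) * cmod (fst y))\<^sup>2)"
    by (simp add: nlft_field_def norm_Pair norm_mult)
  also have "\<dots> = sqrt ((cmod (g x))\<^sup>2 * ((cmod (fst y))\<^sup>2 + (cmod (snd y))\<^sup>2))"
    by (simp add: power_mult_distrib algebra_simps)
  also have "\<dots> = cmod (g x) * norm y" by (simp add: real_sqrt_mult norm_prod_def)
  finally show ?thesis .
qed

lemma nlft_field_diff: "nlft_field g \<xi> x y - nlft_field g \<xi> x z = nlft_field g \<xi> x (y - z)"
  by (simp add: nlft_field_def algebra_simps)

lemma continuous_imp_lebesgue_measurable:
  fixes f :: "real \<Rightarrow> 'a::euclidean_space"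
  assumes "continuous_on UNIV f"
  shows "f \<in> borel_measurable lebesgue"
  using borel_measurable_continuous_onI[OF assms] by (simp add: measurable_completion)

lemma nlft_field_absolutely_integrable:
  assumes g: "g absolutely_integrable_on UNIV" and y: "continuous_on UNIV y" "\<And>x. norm (y x) \<le> B"
  shows "(\<lambda>x. nlft_field g \<xi> x (y x)) absolutely_integrable_on UNIV"
proof (rule measurable_bounded_by_integrable_imp_absolutely_integrable)
  have gm: "g \<in> borel_measurable lebesgue" using g by (simp add: set_integrable_def)
  have cgm: "(\<lambda>x. cnj (g x)) \<in> borel_measurable lebesgue"
    by (rule measurable_compose[OF gm borel_measurable_continuous_onI]) (intro continuous_intros)
  show "(\<lambda>x. nlft_field g \<xi> x (y x)) \<in> borel_measurable (lebesgue_on UNIV)"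
    unfolding nlft_field_def lebesgue_on_UNIV_eq
    by (intro borel_measurable_Pair borel_measurable_times gm cgm continuous_imp_lebesgue_measurable continuous_intros y)
  show "(\<lambda>x. cmod (g x) * B) integrable_on UNIV"
    using g by (intro integrable_on_mult_left) (simp add: absolutely_integrable_on_def)
  show "norm (nlft_field g \<xi> x (y x)) \<le> cmod (g x) * B" for x
    unfolding nlft_field_norm using y(2) by (intro mult_left_mono) auto
qed auto

text \<open>The natural clock of the equation: the accumulated operator norm of the coefficient
  matrix.\<close>

definition mass :: "(real \<Rightarrow> complex) \<Rightarrow> real \<Rightarrow> real" where
  "mass g = primitive (\<lambda>x. cmod (g x))"

context
  fixes g :: "real \<Rightarrow> complex" and \<xi> :: real
  assumes g: "g absolutely_integrable_on UNIV"
begin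

lemma norm_absolutely_integrable: "(\<lambda>x. cmod (g x)) absolutely_integrable_on UNIV"
  using absolutely_integrable_norm[OF g] by (simp add: o_def)

lemma mass_bounds: "0 \<le> mass g x" "mass g x \<le> integral UNIV (\<lambda>x. cmod (g x))"
  unfolding mass_def primitive_def
  using norm_absolutely_integrable abs_integrable_subset[OF norm_absolutely_integrable, of "{..x}"]
  by (auto intro!: integral_nonneg integral_subset_le simp: absolutely_integrable_on_def)

lemma mass_continuous: "continuous_on UNIV (mass g)"
  unfolding mass_def by (rule primitive_continuous[OF norm_absolutely_integrable])

lemma exp_mass_bounded: "exp (2 * mass g x) \<le> exp (2 * integral UNIV (\<lambda>x. cmod (g x)))"
  using mass_bounds by simp

text \<open>The weight \<open>exp (2 * mass)\<close> turns the Volterra operator into a contraction with factor \<open>1/2\<close>.\<close>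

lemma weight_integral:
  assumes "a \<le> b"
  shows "((\<lambda>x. cmod (g x) * exp (2 * mass g x)) has_integral (exp (2 * mass g b) - exp (2 * mass g a)) / 2) {a..b}"
proof -
  obtain N where N: "negligible N" "\<And>x. x \<notin> N \<Longrightarrow> (mass g has_vector_derivative cmod (g x)) (at x)"
    using primitive_derivative[OF norm_absolutely_integrable] unfolding mass_def by metis
  let ?C = "exp (2 * integral UNIV (\<lambda>x. cmod (g x)))"
  \<comment> \<open>The function exp(2u)/2 has derivative exp(2u), which is at most
    \<open>?C\<close> on the range of the mass. This makes the composition absolutely continuous, so
    its derivative almost everywhere determines it.\<close>
  have Lip: "\<bar>exp (2 * v) / 2 - exp (2 * u) / 2\<bar> \<le> ?C * \<bar>v - u\<bar>"
    if "u \<le> integral UNIV (\<lambda>x. cmod (g x))" "v \<le> integral UNIV (\<lambda>x. cmod (g x))" for u v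
  proof -
    have *: "\<bar>exp (2 * v) / 2 - exp (2 * u) / 2\<bar> \<le> ?C * \<bar>v - u\<bar>"
      if "u \<le> v" "v \<le> integral UNIV (\<lambda>x. cmod (g x))" for u v
    proof -
      have "1 - exp (2 * k) \<le> 2 * (- k)" for k :: real using exp_ge_add_one_self[of "2 * k"] by linarith
      from this[of "u - v"] have "1 - exp (2 * (u - v)) \<le> 2 * (v - u)" by simp
      then have "exp (2 * v) * (1 - exp (2 * (u - v))) \<le> ?C * (2 * (v - u))"
        using that by (intro mult_mono) auto
      moreover have "exp (2 * v) * (1 - exp (2 * (u - v))) = exp (2 * v) - exp (2 * u)"
        by (simp add: algebra_simps flip: exp_add)
      ultimately have "exp (2 * v) - exp (2 * u) \<le> 2 * (?C * (v - u))" by (simp only: mult_ac)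
      moreover have "\<bar>exp (2 * v) / 2 - exp (2 * u) / 2\<bar> = (exp (2 * v) - exp (2 * u)) / 2" "\<bar>v - u\<bar> = v - u"
        using that by simp_all
      ultimately show ?thesis by (simp only:) simp
    qed
    show ?thesis using *[of u v] *[of v u] that by (cases "u \<le> v") (auto simp: abs_minus_commute)
  qed
  have "abs_continuous_on UNIV (\<lambda>x. exp (2 * mass g x) / 2)"
    by (rule abs_continuous_on_Lipschitz[where F = "mass g" and C = ?C])
       (use Lip mass_bounds primitive_abs_continuous[OF norm_absolutely_integrable] in \<open>auto simp: mass_def\<close>)
  then have "((\<lambda>x. cmod (g x) * exp (2 * mass g x)) has_integral (exp (2 * mass g b) / 2 - exp (2 * mass g a) / 2)) {a..b}"
  proof (rule abs_continuous_ftc[OF _ N(1) _ assms])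
    show "((\<lambda>x. exp (2 * mass g x) / 2) has_vector_derivative cmod (g x) * exp (2 * mass g x)) (at x)" if "x \<notin> N" for x
      using N(2)[OF that] unfolding has_real_derivative_iff_has_vector_derivative[symmetric]
      by (auto intro!: derivative_eq_intros)
  qed
  then show ?thesis by (simp add: diff_divide_distrib)
qed

lemma weighted_absolutely_integrable: "(\<lambda>x. cmod (g x) * exp (2 * mass g x)) absolutely_integrable_on UNIV"
proof (rule measurable_bounded_by_integrable_imp_absolutely_integrable)
  have "g \<in> borel_measurable lebesgue" using g by (simp add: set_integrable_def)
  moreover have "(\<lambda>x. exp (2 * mass g x)) \<in> borel_measurable lebesgue"
    by (intro continuous_imp_lebesgue_measurable continuous_intros mass_continuous)
  ultimately show "(\<lambda>x. cmod (g x) * exp (2 * mass g x)) \<in> borel_measurable (lebesgue_on UNIV)"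
    unfolding lebesgue_on_UNIV_eq by measurable
  show "(\<lambda>x. cmod (g x) * exp (2 * integral UNIV (\<lambda>x. cmod (g x)))) integrable_on UNIV"
    using g by (intro integrable_on_mult_left) (simp add: absolutely_integrable_on_def)
  show "norm (cmod (g x) * exp (2 * mass g x)) \<le> cmod (g x) * exp (2 * integral UNIV (\<lambda>x. cmod (g x)))" for x
    using exp_mass_bounded[of x] by (simp add: abs_mult mult_left_mono)
qed auto

lemma weighted_primitive_le: "primitive (\<lambda>x. cmod (g x) * exp (2 * mass g x)) x \<le> exp (2 * mass g x) / 2"
proof -
  let ?w = "\<lambda>x. cmod (g x) * exp (2 * mass g x)"
  have 1: "((\<lambda>t. primitive ?w x - primitive ?w t) \<longlongrightarrow> primitive ?w x - 0) at_bot"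
    by (intro tendsto_intros primitive_tendsto weighted_absolutely_integrable)
  have 2: "\<forall>\<^sub>F t in at_bot. primitive ?w x - primitive ?w t \<le> exp (2 * mass g x) / 2"
    using eventually_le_at_bot[of x]
  proof eventually_elim
    case (elim t)
    have "primitive ?w x - primitive ?w t = (exp (2 * mass g x) - exp (2 * mass g t)) / 2"
      using primitive_diff[OF weighted_absolutely_integrable elim] weight_integral[OF elim] by (simp add: integral_unique)
    then show ?case by (simp add: diff_divide_distrib)
  qed
  show ?thesis using tendsto_upperbound[OF 1 2] by simp
qed

text \<open>Integrating \<open>cmod (g x)\<close> against the weight returns at most half of the
  weight. This gain of 1/2 is the contraction constant of the fixed point argument.\<close>

lemma nlft_field_primitive_bound:
  assumes d: "continuous_on UNIV d" "\<And>x. norm (d x) \<le> B * exp (2 * mass g x)"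
  shows "norm (primitive (\<lambda>x. nlft_field g \<xi> x (d x)) x) \<le> B * exp (2 * mass g x) / 2"
proof -
  have B: "0 \<le> B" using order_trans[OF norm_ge_zero d(2)[of 0]] by (simp add: zero_le_mult_iff)
  have "norm (d x) \<le> B * exp (2 * integral UNIV (\<lambda>x. cmod (g x)))" for x
    using d(2)[of x] mult_left_mono[OF exp_mass_bounded[of x] B] by simp
  note ai = nlft_field_absolutely_integrable[OF g d(1) this, of \<xi>]
  have "norm (primitive (\<lambda>x. nlft_field g \<xi> x (d x)) x)
     \<le> integral {..x} (\<lambda>x. B * (cmod (g x) * exp (2 * mass g x)))"
    unfolding primitive_def
  proof (rule integral_norm_bound_integral)
    show "(\<lambda>x. nlft_field g \<xi> x (d x)) integrable_on {..x}"
      using abs_integrable_subset[OF ai, of "{..x}"] by (simp add: absolutely_integrable_on_def)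
    show "(\<lambda>x. B * (cmod (g x) * exp (2 * mass g x))) integrable_on {..x}"
      using abs_integrable_subset[OF weighted_absolutely_integrable, of "{..x}"]
      by (intro integrable_on_mult_right) (simp add: absolutely_integrable_on_def)
    show "norm (nlft_field g \<xi> t (d t)) \<le> B * (cmod (g t) * exp (2 * mass g t))" for t
      unfolding nlft_field_norm using mult_left_mono[OF d(2)[of t], of "cmod (g t)"] by (simp add: mult_ac)
  qed
  also have "\<dots> = B * primitive (\<lambda>x. cmod (g x) * exp (2 * mass g x)) x"
    by (simp add: primitive_def)
  also have "\<dots> \<le> B * (exp (2 * mass g x) / 2)"
    by (intro mult_left_mono weighted_primitive_le B)
  finally show ?thesis by simp
qed

text \<open>Banach's fixed point theorem on bounded continuous functions. The unknown is y divided
  by \<open>exp (2 * mass g x)\<close>, so the plain supremum norm of w is the weighted norm of y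
  and the whole line is handled at once, without subdividing.\<close>

lemma nlft_integral_equation:
  obtains y B where "continuous_on UNIV y" "\<And>x. norm (y x) \<le> B"
    "\<And>x. y x = (1, 0) + primitive (\<lambda>x. nlft_field g \<xi> x (y x)) x"
proof -
  let ?I = "integral UNIV (\<lambda>x. cmod (g x))"
  let ?y = "\<lambda>(w :: real \<Rightarrow>\<^sub>C (complex \<times> complex)) x. exp (2 * mass g x) *\<^sub>R apply_bcontfun w x"
  define T where "T w x = exp (- 2 * mass g x) *\<^sub>R ((1, 0) + primitive (\<lambda>x. nlft_field g \<xi> x (?y w x)) x)"
    for w :: "real \<Rightarrow>\<^sub>C (complex \<times> complex)" and x
  have yc: "continuous_on UNIV (?y w)" for w
    by (intro continuous_intros mass_continuous continuous_on_apply_bcontfun)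
  have yb: "norm (?y w x) \<le> norm w * exp (2 * mass g x)" for w x
    using Bounded_Continuous_Function.norm_bounded[of w x] by (simp add: mult.commute)
  have yB: "norm (?y w x) \<le> norm w * exp (2 * ?I)" for w x
    by (rule order_trans[OF yb]) (intro mult_left_mono exp_mass_bounded norm_ge_zero)
  have ai: "(\<lambda>x. nlft_field g \<xi> x (?y w x)) absolutely_integrable_on UNIV" for w
    by (rule nlft_field_absolutely_integrable[OF g yc yB])
  have yp: "norm (primitive (\<lambda>x. nlft_field g \<xi> x (?y w x)) x) \<le> norm w * exp (2 * mass g x) / 2" for w x
    by (rule nlft_field_primitive_bound[OF yc yb])
  have "T w \<in> bcontfun" for w
  proof (rule bcontfun_normI)
    show "continuous_on UNIV (T w)"
      unfolding T_def by (intro continuous_intros mass_continuous primitive_continuous ai)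
    show "norm (T w x) \<le> 1 + norm w / 2" for x
    proof -
      have "norm (T w x) \<le> exp (- 2 * mass g x) * (norm (1 :: complex, 0 :: complex) + norm w * exp (2 * mass g x) / 2)"
        unfolding T_def norm_scaleR
        using yp[where w = w and x = x]
        by (intro mult_mono order_trans[OF norm_triangle_ineq] add_mono) auto
      also have "\<dots> = exp (- 2 * mass g x) + norm w / 2"
        by (simp add: norm_Pair algebra_simps flip: exp_add)
      also have "\<dots> \<le> 1 + norm w / 2" using mass_bounds[of x] by simp
      finally show ?thesis .
    qed
  qed
  then have app: "apply_bcontfun (Bcontfun (T w)) x = T w x" for w x
    by (simp add: Bcontfun_inverse)
  have "dist (Bcontfun (T w)) (Bcontfun (T w')) \<le> 1/2 * dist w w'" for w w'
  proof (rule dist_bound)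
    fix x
    have "T w x - T w' x = exp (- 2 * mass g x) *\<^sub>R primitive (\<lambda>x. nlft_field g \<xi> x (?y (w - w') x)) x"
    proof -
      have "primitive (\<lambda>x. nlft_field g \<xi> x (?y w x)) x - primitive (\<lambda>x. nlft_field g \<xi> x (?y w' x)) x
        = primitive (\<lambda>x. nlft_field g \<xi> x (?y w x) - nlft_field g \<xi> x (?y w' x)) x"
        unfolding primitive_def
        using abs_integrable_subset[OF ai, of "{..x}"] by (subst integral_diff) (auto simp: absolutely_integrable_on_def)
      also have "(\<lambda>x. nlft_field g \<xi> x (?y w x) - nlft_field g \<xi> x (?y w' x)) = (\<lambda>x. nlft_field g \<xi> x (?y (w - w') x))"
        by (simp add: nlft_field_diff scaleR_diff_right)
      finally show ?thesis by (simp add: T_def algebra_simps)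
    qed
    then have "norm (T w x - T w' x) \<le> exp (- 2 * mass g x) * (norm (w - w') * exp (2 * mass g x) / 2)"
      using yp[where w = "w - w'" and x = x] by (simp add: mult_left_mono)
    also have "\<dots> = norm (w - w') / 2" by (simp add: algebra_simps flip: exp_add)
    finally show "dist (apply_bcontfun (Bcontfun (T w)) x) (apply_bcontfun (Bcontfun (T w')) x) \<le> 1 / 2 * dist w w'"
      by (simp add: app dist_norm)
  qed
  then have "\<exists>!w. Bcontfun (T w) = w"
    by (intro banach_fix_type[of "1/2"]) auto
  then obtain w where w: "Bcontfun (T w) = w" by blast
  have "?y w x = (1, 0) + primitive (\<lambda>x. nlft_field g \<xi> x (?y w x)) x" for x
  proof -
    have "apply_bcontfun w x = T w x" using app[of w x] w by simp
    then have "?y w x = exp (2 * mass g x) *\<^sub>R T w x" by simp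
    also have "\<dots> = (1, 0) + primitive (\<lambda>x. nlft_field g \<xi> x (?y w x)) x"
      unfolding T_def by (simp flip: exp_add)
    finally show ?thesis .
  qed
  then show ?thesis using that[OF yc yB] by blast
qed

lemma nlft_solution_exists:
  obtains y B where "continuous_on UNIV y" "\<And>x. norm (y x) \<le> B"
    "\<And>x. y x = (1, 0) + primitive (\<lambda>x. nlft_field g \<xi> x (y x)) x"
    "nlft_solution g \<xi> (fst \<circ> y) (snd \<circ> y)"
proof -
  obtain y B where y: "continuous_on UNIV y" "\<And>x. norm (y x) \<le> B"
    "\<And>x. y x = (1, 0) + primitive (\<lambda>x. nlft_field g \<xi> x (y x)) x"
    using nlft_integral_equation by blast
  let ?h = "\<lambda>x. nlft_field g \<xi> x (y x)"
  note ai = nlft_field_absolutely_integrable[OF g y(1,2), of \<xi>]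
  have y_eq: "y = (\<lambda>x. (1, 0) + primitive ?h x)" using y(3) by (rule ext)
  have acy: "norm (y s - y t) \<le> norm (primitive ?h s - primitive ?h t)" for s t
    using y(3)[of s] y(3)[of t] by (metis add_diff_cancel_left order_refl)
  have fy: "norm ((fst \<circ> y) s - (fst \<circ> y) t) \<le> 1 * norm (primitive ?h s - primitive ?h t)"
    and sy: "norm ((snd \<circ> y) s - (snd \<circ> y) t) \<le> 1 * norm (primitive ?h s - primitive ?h t)" for s t
    using acy[of s t] norm_fst_le[of "fst (y s - y t)" "snd (y s - y t)", unfolded prod.collapse]
      norm_snd_le[of "snd (y s - y t)" "fst (y s - y t)", unfolded prod.collapse] by simp_all
  have ac: "abs_continuous_on UNIV (fst \<circ> y)" "abs_continuous_on UNIV (snd \<circ> y)"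
    by (rule abs_continuous_on_Lipschitz[OF primitive_abs_continuous[OF ai] fy], simp)
       (rule abs_continuous_on_Lipschitz[OF primitive_abs_continuous[OF ai] sy], simp)
  obtain N where N: "negligible N" "\<And>x. x \<notin> N \<Longrightarrow> (primitive ?h has_vector_derivative ?h x) (at x)"
    using primitive_derivative[OF ai] by metis
  have der: "AE x in lebesgue. ((fst \<circ> y) has_vector_derivative cnj (g x) * exp (2 * pi * \<i> * x * \<xi>) * (snd \<circ> y) x) (at x) \<and>
        ((snd \<circ> y) has_vector_derivative g x * exp (- (2 * pi * \<i> * x * \<xi>)) * (fst \<circ> y) x) (at x)"
  proof (rule AE_I')
    show "N \<in> null_sets lebesgue" using N(1) by (simp add: negligible_iff_null_sets)
    have "(y has_vector_derivative ?h x) (at x)" if "x \<notin> N" for x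
      using N(2)[OF that] by (subst y_eq) (auto intro!: derivative_eq_intros)
    then have "(fst \<circ> y has_vector_derivative fst (?h x)) (at x)" "(snd \<circ> y has_vector_derivative snd (?h x)) (at x)"
      if "x \<notin> N" for x
      using bounded_linear.has_vector_derivative[OF bounded_linear_fst] bounded_linear.has_vector_derivative[OF bounded_linear_snd] that
      unfolding o_def by blast+
    then show "{x \<in> space lebesgue. \<not> (((fst \<circ> y) has_vector_derivative cnj (g x) * exp (2 * pi * \<i> * x * \<xi>) * (snd \<circ> y) x) (at x) \<and>
        ((snd \<circ> y) has_vector_derivative g x * exp (- (2 * pi * \<i> * x * \<xi>)) * (fst \<circ> y) x) (at x))} \<subseteq> N"
      by (auto simp: nlft_field_def)
  qed
  have "(y \<longlongrightarrow> (1, 0) + 0) at_bot"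
    by (subst y_eq) (intro tendsto_intros primitive_tendsto ai)
  then have "((fst \<circ> y) \<longlongrightarrow> 1) at_bot" "((snd \<circ> y) \<longlongrightarrow> 0) at_bot"
    using tendsto_fst tendsto_snd by (force simp: o_def)+
  then have "nlft_solution g \<xi> (fst \<circ> y) (snd \<circ> y)"
    unfolding nlft_solution_def using ac der by blast
  then show ?thesis using that y by blast
qed

lemma nlft_solution_integral:
  assumes "nlft_solution g \<xi> a b" "s \<le> t"
  shows "((\<lambda>x. nlft_field g \<xi> x (a x, b x)) has_integral ((a t, b t) - (a s, b s))) {s..t}"
proof -
  have ac: "abs_continuous_on UNIV a" "abs_continuous_on UNIV b"
    using assms unfolding nlft_solution_def by auto
  have "AE x in lebesgue. (a has_vector_derivative fst (nlft_field g \<xi> x (a x, b x))) (at x) \<and>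
      (b has_vector_derivative snd (nlft_field g \<xi> x (a x, b x))) (at x)"
    using assms unfolding nlft_solution_def by (simp add: nlft_field_def)
  then obtain N where N: "N \<in> null_sets lebesgue"
    "{x \<in> space lebesgue. \<not> ((a has_vector_derivative fst (nlft_field g \<xi> x (a x, b x))) (at x) \<and>
      (b has_vector_derivative snd (nlft_field g \<xi> x (a x, b x))) (at x))} \<subseteq> N"
    by (auto elim: AE_E2 simp: eventually_ae_filter)
  show ?thesis
  proof (rule abs_continuous_ftc[OF abs_continuous_on_Pair[OF ac] _ _ assms(2)])
    show "negligible N" using N(1) by (simp add: negligible_iff_null_sets)
    fix x assume "x \<notin> N"
    then have "(a has_vector_derivative fst (nlft_field g \<xi> x (a x, b x))) (at x)"
      "(b has_vector_derivative snd (nlft_field g \<xi> x (a x, b x))) (at x)"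
      using N(2) by auto
    from has_derivative_Pair[OF this[unfolded has_vector_derivative_def]]
    show "((\<lambda>x. (a x, b x)) has_vector_derivative nlft_field g \<xi> x (a x, b x)) (at x)"
      unfolding has_vector_derivative_def by (simp add: scaleR_prod_def)
  qed
qed

text \<open>The difference d of two solutions solves the homogeneous equation and vanishes at minus
  infinity. Its weighted supremum S satisfies S \<le> S/2. The supremum is taken over a half-line
  ending at X, where d is bounded: near minus infinity by its limit, on the remaining compact
  interval by continuity.\<close>

lemma nlft_solution_unique:
  assumes 1: "nlft_solution g \<xi> a b" and 2: "nlft_solution g \<xi> a' b'"
  shows "a = a' \<and> b = b'"
proof -
  define d where "d x = (a x, b x) - (a' x, b' x)" for x
  have cont: "continuous_on UNIV f" if "f \<in> {a, b, a', b'}" for f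
    using that 1 2 abs_continuous_on_uniformly_continuous uniformly_continuous_imp_continuous
    unfolding nlft_solution_def by blast
  have dc: "continuous_on UNIV d"
    unfolding d_def using cont by (intro continuous_intros) auto
  have "(d \<longlongrightarrow> (1, 0) - (1, 0)) at_bot"
    unfolding d_def using 1 2 unfolding nlft_solution_def by (intro tendsto_intros) auto
  then have dlim: "(d \<longlongrightarrow> 0) at_bot" by simp
  have dint: "((\<lambda>x. nlft_field g \<xi> x (d x)) has_integral (d t - d s)) {s..t}" if "s \<le> t" for s t
    using has_integral_diff[OF nlft_solution_integral[OF 1 that] nlft_solution_integral[OF 2 that]]
    by (simp add: nlft_field_diff d_def algebra_simps)
  have "d X = 0" for X
  proof -
    have "\<forall>\<^sub>F x in at_bot. norm (d x) < 1" using tendstoD[OF dlim, of 1] by simp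
    then obtain L where L: "\<And>x. x \<le> L \<Longrightarrow> norm (d x) < 1" by (auto simp: eventually_at_bot_linorder)
    have "compact (d ` {L..X})" using dc by (intro compact_continuous_image) (auto intro: continuous_on_subset)
    then obtain B where B: "\<And>x. x \<in> {L..X} \<Longrightarrow> norm (d x) \<le> B"
      by (metis bounded_iff compact_imp_bounded imageI)
    define S where "S = (SUP x\<in>{..X}. exp (- 2 * mass g x) * norm (d x))"
    have bdd: "bdd_above ((\<lambda>x. exp (- 2 * mass g x) * norm (d x)) ` {..X})"
    proof (rule bdd_aboveI2)
      fix x assume x: "x \<in> {..X}"
      have "norm (d x) \<le> max 1 B" using L[of x] B[of x] x by (cases "x \<le> L") (auto simp: less_imp_le max_def)
      moreover have "exp (- 2 * mass g x) \<le> 1" using mass_bounds[of x] by simp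
      ultimately show "exp (- 2 * mass g x) * norm (d x) \<le> max 1 B"
        using mult_mono[of "exp (- 2 * mass g x)" 1 "norm (d x)" "max 1 B"] by simp
    qed
    have S_up: "norm (d x) \<le> S * exp (2 * mass g x)" if "x \<le> X" for x
    proof -
      have "exp (- 2 * mass g x) * norm (d x) \<le> S" unfolding S_def using that by (intro cSUP_upper bdd) auto
      then have "exp (2 * mass g x) * (exp (- 2 * mass g x) * norm (d x)) \<le> exp (2 * mass g x) * S"
        by (intro mult_left_mono) auto
      moreover have "exp (2 * mass g x) * (exp (- 2 * mass g x) * norm (d x)) = norm (d x)"
        by (simp flip: exp_add mult.assoc)
      ultimately show ?thesis by (simp only: mult.commute[of S])
    qed
    have S0: "0 \<le> S" using order_trans[OF norm_ge_zero S_up[of X]] by (simp add: zero_le_mult_iff)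
    have half: "norm (d x) \<le> S * exp (2 * mass g x) / 2" if x: "x \<le> X" for x
    proof -
      have 1: "((\<lambda>s. norm (d x - d s)) \<longlongrightarrow> norm (d x - 0)) at_bot" by (intro tendsto_intros dlim)
      have 2: "\<forall>\<^sub>F s in at_bot. norm (d x - d s) \<le> S * exp (2 * mass g x) / 2"
        using eventually_le_at_bot[of x]
      proof eventually_elim
        case (elim s)
        have "norm (d x - d s) = norm (integral {s..x} (\<lambda>x. nlft_field g \<xi> x (d x)))"
          using dint[OF elim] by (simp add: integral_unique)
        also have "\<dots> \<le> integral {s..x} (\<lambda>x. S * (cmod (g x) * exp (2 * mass g x)))"
        proof (rule integral_norm_bound_integral)
          show "(\<lambda>x. nlft_field g \<xi> x (d x)) integrable_on {s..x}" using dint[OF elim] by blast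
          show "(\<lambda>x. S * (cmod (g x) * exp (2 * mass g x))) integrable_on {s..x}"
            using weight_integral[OF elim] by (intro integrable_on_mult_right) blast
          show "norm (nlft_field g \<xi> u (d u)) \<le> S * (cmod (g u) * exp (2 * mass g u))" if "u \<in> {s..x}" for u
            unfolding nlft_field_norm using mult_left_mono[OF S_up[of u], of "cmod (g u)"] that x by (simp add: mult_ac)
        qed
        also have "\<dots> = S * ((exp (2 * mass g x) - exp (2 * mass g s)) / 2)"
          using weight_integral[OF elim] by (simp add: integral_unique)
        also have "\<dots> \<le> S * (exp (2 * mass g x) / 2)" using S0 by (intro mult_left_mono) auto
        finally show ?case by simp
      qed
      show ?thesis using tendsto_upperbound[OF 1 2] by simp
    qed
    have "S \<le> S / 2"
      unfolding S_def
    proof (rule cSUP_least)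
      fix x assume "x \<in> {..X}"
      then have "exp (- 2 * mass g x) * norm (d x) \<le> exp (- 2 * mass g x) * (S * exp (2 * mass g x) / 2)"
        using half by (intro mult_left_mono) auto
      also have "\<dots> = S / 2" by (simp add: algebra_simps flip: exp_add)
      finally show "exp (- 2 * mass g x) * norm (d x) \<le> (SUP x\<in>{..X}. exp (- 2 * mass g x) * norm (d x)) / 2"
        by (simp add: S_def)
    qed auto
    then have "S = 0" using S0 by simp
    then show ?thesis using S_up[of X] by simp
  qed
  then have "a x = a' x \<and> b x = b' x" for x
    by (metis d_def eq_iff_diff_eq_0 prod.inject)
  then show ?thesis by (simp add: fun_eq_iff)
qed

text \<open>Uniqueness resolves the definite description and integrability of the field provides the
  limit at infinity. Everything later about \<open>nlft_a\<close> rests on this integral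
  equation.\<close>

theorem nlft_a_integral_equation:
  obtains y B where "continuous_on UNIV y" "\<And>x. norm (y x) \<le> B"
    "\<And>x. y x = (1, 0) + primitive (\<lambda>x. nlft_field g \<xi> x (y x)) x"
    "((\<lambda>x. fst (y x)) \<longlongrightarrow> nlft_a g \<xi>) at_top"
proof -
  obtain y B where y: "continuous_on UNIV y" "\<And>x. norm (y x) \<le> B"
    "\<And>x. y x = (1, 0) + primitive (\<lambda>x. nlft_field g \<xi> x (y x)) x"
    and sol: "nlft_solution g \<xi> (fst \<circ> y) (snd \<circ> y)"
    using nlft_solution_exists by blast
  have "(THE (a, b). nlft_solution g \<xi> a b) = (fst \<circ> y, snd \<circ> y)"
    by (rule the_equality) (use sol nlft_solution_unique in \<open>auto split: prod.splits\<close>)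
  then have a: "nlft_a g \<xi> = Lim at_top (fst \<circ> y)"
    by (simp add: nlft_a_def)
  note ai = nlft_field_absolutely_integrable[OF g y(1,2), of \<xi>]
  let ?l = "(1, 0) + integral UNIV (\<lambda>x. nlft_field g \<xi> x (y x))"
  have "((\<lambda>x. (1, 0) + primitive (\<lambda>x. nlft_field g \<xi> x (y x)) x) \<longlongrightarrow> ?l) at_top"
    by (intro tendsto_intros primitive_tendsto ai)
  then have "(y \<longlongrightarrow> ?l) at_top" by (simp only: y(3)[symmetric])
  then have l: "((\<lambda>x. fst (y x)) \<longlongrightarrow> fst ?l) at_top" by (rule tendsto_fst)
  then have "nlft_a g \<xi> = fst ?l" unfolding a by (intro tendsto_Lim) (auto simp: o_def)
  then show ?thesis using that[OF y] l by simp
qed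

end

section \<open>Increments in the Dirichlet space\<close>

definition dirichlet_kernel :: "complex \<Rightarrow> complex \<Rightarrow> complex" where
  "dirichlet_kernel w z = - Ln (1 - cnj w * z)"

text \<open>The inner product of two feature differences, from p' to p and from q' to q. The double
  difference removes every term that depends on only one side.\<close>

definition kernel_diff :: "complex \<Rightarrow> complex \<Rightarrow> complex \<Rightarrow> complex \<Rightarrow> complex" where
  "kernel_diff p p' q q' = dirichlet_kernel p q - dirichlet_kernel p q'
     - dirichlet_kernel p' q + dirichlet_kernel p' q'"

text \<open>The disc automorphism that sends t to 0 and 0 to -t.\<close>

definition disc_step :: "complex \<Rightarrow> complex \<Rightarrow> complex" where
  "disc_step t w = (w - t) / (1 - cnj t * w)"

lemma Re_one_minus_pos: "cmod z < 1 \<Longrightarrow> 0 < Re (1 - z)"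
  using complex_Re_le_cmod[of z] by simp

lemma cmod_cnj_mult_less_1: "cmod w < 1 \<Longrightarrow> cmod z < 1 \<Longrightarrow> cmod (cnj w * z) < 1"
  using mult_strict_mono[of "cmod w" 1 "cmod z" 1] by (simp add: norm_mult)

lemma disc_step_norm_identity:
  assumes "cmod t < 1" "cmod w < 1"
  shows "1 - (cmod (disc_step t w))\<^sup>2
           = (1 - (cmod t)\<^sup>2) * (1 - (cmod w)\<^sup>2) / (cmod (1 - cnj t * w))\<^sup>2"
proof -
  have nz: "1 - cnj t * w \<noteq> 0"
    using Re_one_minus_pos[OF cmod_cnj_mult_less_1[OF assms]] by (metis less_irrefl zero_complex.sel(1))
  have "(cmod (1 - cnj t * w))\<^sup>2 - (cmod (w - t))\<^sup>2 = (1 - (cmod t)\<^sup>2) * (1 - (cmod w)\<^sup>2)"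
    unfolding cmod_power2 by (simp add: power2_eq_square algebra_simps)
  then show ?thesis
    using nz by (simp add: disc_step_def norm_divide power_divide field_simps)
qed

lemma disc_step_norm_less_1:
  assumes "cmod t < 1" "cmod w < 1"
  shows "cmod (disc_step t w) < 1"
proof -
  have nz: "1 - cnj t * w \<noteq> 0"
    using Re_one_minus_pos[OF cmod_cnj_mult_less_1[OF assms]] by (metis less_irrefl zero_complex.sel(1))
  have "(cmod t)\<^sup>2 < 1" "(cmod w)\<^sup>2 < 1"
    using assms by (simp_all add: abs_square_less_1)
  then have "0 < 1 - (cmod (disc_step t w))\<^sup>2"
    unfolding disc_step_norm_identity[OF assms] using nz by simp
  then show ?thesis by (simp add: abs_square_less_1)
qed

text \<open>All four factors lie in the right half-plane, so the arguments add up without a jump.\<close>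

lemma Ln_product_identity:
  assumes "0 < Re A" "0 < Re B" "0 < Re C" "0 < Re D" "r > 0"
    and eq: "A * C * D = of_real r * B"
  shows "Ln A = of_real (ln r) + Ln B - Ln C - Ln D"
proof -
  have nz: "A \<noteq> 0" "B \<noteq> 0" "C \<noteq> 0" "D \<noteq> 0" using assms by auto
  define X where "X = Ln A - (of_real (ln r) + Ln B - Ln C - Ln D)"
  have "exp X = A / (of_real r * B / C / D)"
    unfolding X_def using nz \<open>r > 0\<close> by (simp add: exp_diff exp_add exp_of_real)
  also have "\<dots> = 1" using nz eq \<open>r > 0\<close> by (simp add: field_simps)
  finally obtain n where n: "X = \<i> * of_real (of_int (2 * n) * pi)"
    using exp_eq_1 complex_eq_iff by (auto simp: complex_eq_iff exp_eq_1)
  have "\<bar>Im (Ln A)\<bar> < pi/2" "\<bar>Im (Ln B)\<bar> < pi/2" "\<bar>Im (Ln C)\<bar> < pi/2" "\<bar>Im (Ln D)\<bar> < pi/2"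
    using assms(1-4) nz Re_Ln_pos_lt by blast+
  then have "\<bar>Im X\<bar> < 2 * pi" unfolding X_def by simp
  then have "n = 0"
    by (simp add: n abs_mult)
  then show ?thesis using n X_def by simp
qed

text \<open>Logarithm of the transformation law of 1 - cnj p * q under a disc automorphism. The
  correction terms are a constant, a function of p and a function of q.\<close>

lemma dirichlet_kernel_disc_step:
  assumes t: "cmod t < 1" and p: "cmod p < 1" and q: "cmod q < 1"
  shows "dirichlet_kernel (disc_step t p) (disc_step t q) =
     dirichlet_kernel p q - of_real (ln (1 - (cmod t)\<^sup>2)) + Ln (1 - t * cnj p) + Ln (1 - cnj t * q)"
proof -
  have t2: "(cmod t)\<^sup>2 < 1" using t by (simp add: abs_square_less_1)
  have nzp: "Re (1 - t * cnj p) > 0"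
    using Re_one_minus_pos[OF cmod_cnj_mult_less_1[OF p t]] by (simp add: mult.commute)
  have nzq: "Re (1 - cnj t * q) > 0" by (rule Re_one_minus_pos[OF cmod_cnj_mult_less_1[OF t q]])
  have nz: "1 - t * cnj p \<noteq> 0" "1 - cnj t * q \<noteq> 0" using nzp nzq by (metis less_irrefl zero_complex.sel(1))+
  have tt: "t * cnj t = of_real ((cmod t)\<^sup>2)" by (rule complex_norm_square[symmetric, unfolded of_real_power[symmetric]])
  have e: "(1 - cnj (disc_step t p) * disc_step t q) * (1 - t * cnj p) * (1 - cnj t * q)
        = of_real (1 - (cmod t)\<^sup>2) * (1 - cnj p * q)"
  proof -
    have "cnj (disc_step t p) = (cnj p - cnj t) / (1 - t * cnj p)"
      by (simp add: disc_step_def)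
    then have "(1 - cnj (disc_step t p) * disc_step t q) * (1 - t * cnj p) * (1 - cnj t * q)
      = (1 - t * cnj p) * (1 - cnj t * q) - (cnj p - cnj t) * (q - t)"
      using nz by (simp add: disc_step_def divide_simps)
    also have "\<dots> = (1 - t * cnj t) * (1 - cnj p * q)" by (simp add: algebra_simps)
    finally show ?thesis by (simp add: tt)
  qed
  have "Ln (1 - cnj (disc_step t p) * disc_step t q) =
     of_real (ln (1 - (cmod t)\<^sup>2)) + Ln (1 - cnj p * q) - Ln (1 - t * cnj p) - Ln (1 - cnj t * q)"
    by (rule Ln_product_identity[OF _ _ nzp nzq _ e])
       (use t2 p q t in \<open>simp_all only: Re_one_minus_pos cmod_cnj_mult_less_1 disc_step_norm_less_1 diff_gt_0_iff_gt\<close>)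
  then show ?thesis by (simp add: dirichlet_kernel_def)
qed

text \<open>The corrections in the transformation law depend on at most one argument and cancel in
  the double difference. Thus automorphisms act on increments by isometries, which is the cocycle
  property behind the overview.\<close>

lemma kernel_diff_disc_step:
  assumes "cmod t < 1" "cmod p < 1" "cmod p' < 1" "cmod q < 1" "cmod q' < 1"
  shows "kernel_diff (disc_step t p) (disc_step t p') (disc_step t q) (disc_step t q')
      = kernel_diff p p' q q'"
  using assms by (simp add: kernel_diff_def dirichlet_kernel_disc_step)

text \<open>The term n = 0 is 0 because division by \<open>sqrt 0\<close> gives 0, so this is the
  logarithmic series starting at n = 1.\<close>

lemma dirichlet_kernel_sums:
  assumes "cmod w < 1" "cmod z < 1"
  shows "(\<lambda>n. cnj (w ^ n / sqrt n) * (z ^ n / sqrt n)) sums dirichlet_kernel w z"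
proof -
  have "(\<lambda>n. - (- ((-(- (cnj w * z)))^n) / of_nat n)) sums - Ln (1 + (- (cnj w * z)))"
    by (intro sums_minus Ln_series') (use cmod_cnj_mult_less_1[OF assms] in simp)
  moreover have "- (- ((-(- (cnj w * z)))^n) / of_nat n) = cnj (w ^ n / sqrt n) * (z ^ n / sqrt n)" for n
  proof -
    have "complex_of_real (sqrt n) * complex_of_real (sqrt n) = of_nat n"
      by (metis of_nat_0_le_iff of_real_mult of_real_of_nat_eq real_sqrt_mult_self abs_of_nat)
    then show ?thesis by (simp add: power_mult_distrib)
  qed
  ultimately show ?thesis by (simp add: dirichlet_kernel_def)
qed

lemma kernel_diff_sums:
  assumes "cmod p < 1" "cmod p' < 1" "cmod q < 1" "cmod q' < 1"
  shows "(\<lambda>n. cnj (p ^ n / sqrt n - p' ^ n / sqrt n) * (q ^ n / sqrt n - q' ^ n / sqrt n))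
      sums kernel_diff p p' q q'"
proof -
  have "(\<lambda>n. cnj (p ^ n / sqrt n) * (q ^ n / sqrt n) - cnj (p ^ n / sqrt n) * (q' ^ n / sqrt n)
      - cnj (p' ^ n / sqrt n) * (q ^ n / sqrt n) + cnj (p' ^ n / sqrt n) * (q' ^ n / sqrt n))
      sums kernel_diff p p' q q'"
    unfolding kernel_diff_def by (intro sums_add sums_diff dirichlet_kernel_sums assms)
  then show ?thesis by (simp add: algebra_simps)
qed

text \<open>The newest step acts innermost. Hence the automorphism
  \<open>disc_path \<tau> (Suc i)\<close> is a common outer factor of all later points of the path
  and can be stripped from a Gram entry by invariance.\<close>

fun disc_path :: "(nat \<Rightarrow> complex) \<Rightarrow> nat \<Rightarrow> complex \<Rightarrow> complex" where
  "disc_path \<tau> 0 w = w"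
| "disc_path \<tau> (Suc k) w = disc_path \<tau> k (disc_step (\<tau> k) w)"

lemma disc_path_norm_less_1:
  "(\<And>k. cmod (\<tau> k) < 1) \<Longrightarrow> cmod w < 1 \<Longrightarrow> cmod (disc_path \<tau> k w) < 1"
  by (induction k arbitrary: w) (auto simp: disc_step_norm_less_1)

lemma kernel_diff_disc_path:
  assumes "\<And>k. cmod (\<tau> k) < 1" "cmod p < 1" "cmod p' < 1" "cmod q < 1" "cmod q' < 1"
  shows "kernel_diff (disc_path \<tau> k p) (disc_path \<tau> k p') (disc_path \<tau> k q) (disc_path \<tau> k q')
      = kernel_diff p p' q q'"
  using assms(2-)
  by (induction k arbitrary: p p' q q') (simp_all add: assms(1) disc_step_norm_less_1 kernel_diff_disc_step)

lemma disc_path_shift: "disc_path \<tau> (Suc k) w = disc_step (\<tau> 0) (disc_path (\<lambda>n. \<tau> (Suc n)) k w)"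
  by (induction k arbitrary: w) auto

lemma disc_path_add: "disc_path \<tau> (m + k) w = disc_path \<tau> m (disc_path (\<lambda>n. \<tau> (m + n)) k w)"
proof (induction k arbitrary: w)
  case (Suc k)
  show ?case using Suc[of "disc_step (\<tau> (m + k)) w"] by simp
qed simp

text \<open>The vectors whose Gram matrix is \<open>gram\<close> are the increments of the Dirichlet feature
  map \<open>z \<mapsto> (z\<^sup>n / \<surd>n)\<^sub>n\<close> along the path.\<close>

definition gram :: "(nat \<Rightarrow> complex) \<Rightarrow> nat \<Rightarrow> nat \<Rightarrow> complex" where
  "gram \<tau> i j = kernel_diff (disc_path \<tau> (Suc i) 0) (disc_path \<tau> i 0)
                            (disc_path \<tau> (Suc j) 0) (disc_path \<tau> j 0)"

definition disc_increment :: "(nat \<Rightarrow> complex) \<Rightarrow> nat \<Rightarrow> nat \<Rightarrow> complex" where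
  "disc_increment \<tau> j n = disc_path \<tau> (Suc j) 0 ^ n / sqrt n - disc_path \<tau> j 0 ^ n / sqrt n"

lemma disc_step_self [simp]: "disc_step t t = 0"
  by (simp add: disc_step_def)

context
  fixes \<tau> :: "nat \<Rightarrow> complex"
  assumes \<tau>: "\<And>k. cmod (\<tau> k) < 1"
begin

lemma gram_sums: "(\<lambda>n. cnj (disc_increment \<tau> i n) * disc_increment \<tau> j n) sums gram \<tau> i j"
  unfolding gram_def disc_increment_def
  by (intro kernel_diff_sums disc_path_norm_less_1 \<tau>) auto

lemma gram_cnj: "gram \<tau> j i = cnj (gram \<tau> i j)"
proof -
  have "(\<lambda>n. cnj (cnj (disc_increment \<tau> i n) * disc_increment \<tau> j n)) sums cnj (gram \<tau> i j)"
    using gram_sums[of i j] by (simp only: sums_cnj)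
  then show ?thesis using gram_sums[of j i] by (simp add: mult.commute sums_unique2)
qed

text \<open>Stripping \<open>disc_path \<tau> (Suc i)\<close> moves the i-th increment to the pair
  \<open>0\<close>, \<open>\<tau> i\<close>, because \<open>disc_step (\<tau> i)\<close> sends
  \<open>\<tau> i\<close> to 0, and kernel values with first argument 0 vanish. For i = j the second
  pair is \<open>0\<close>, \<open>\<tau> i\<close> as well and the index \<open>j - Suc i\<close>
  no longer describes it, hence the case distinctions.\<close>

lemma gram_eq:
  assumes "i \<le> j"
  shows "gram \<tau> i j = Ln (1 - cnj (\<tau> i) * disc_path (\<lambda>n. \<tau> (Suc i + n)) (j - i) 0)
     - (if i = j then 0 else Ln (1 - cnj (\<tau> i) * disc_path (\<lambda>n. \<tau> (Suc i + n)) (j - Suc i) 0))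
     - (if i = j then Ln (1 - of_real ((cmod (\<tau> i))\<^sup>2)) else 0)"
proof -
  let ?\<sigma> = "\<lambda>n. \<tau> (Suc i + n)"
  have a: "disc_path \<tau> i 0 = disc_path \<tau> (Suc i) (\<tau> i)" by simp
  have j: "disc_path \<tau> (Suc j) 0 = disc_path \<tau> (Suc i) (disc_path ?\<sigma> (j - i) 0)"
    using disc_path_add[of \<tau> "Suc i" "j - i" 0] assms by simp
  show ?thesis
  proof (cases "i = j")
    case True
    have "gram \<tau> i j = kernel_diff 0 (\<tau> i) 0 (\<tau> i)"
      unfolding gram_def True[symmetric] a
      by (intro kernel_diff_disc_path \<tau>) (auto simp: \<tau>)
    also have "\<dots> = - Ln (1 - cnj (\<tau> i) * \<tau> i)"
      by (simp add: kernel_diff_def dirichlet_kernel_def)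
    also have "cnj (\<tau> i) * \<tau> i = of_real ((cmod (\<tau> i))\<^sup>2)"
      by (metis complex_norm_square mult.commute of_real_power)
    finally show ?thesis
      using True by (simp del: of_real_power)
  next
    case False
    have "Suc i + (j - Suc i) = j" using assms False by simp
    then have j': "disc_path \<tau> j 0 = disc_path \<tau> (Suc i) (disc_path ?\<sigma> (j - Suc i) 0)"
      using disc_path_add[of \<tau> "Suc i" "j - Suc i" 0] by (simp only:)
    have "gram \<tau> i j = kernel_diff 0 (\<tau> i) (disc_path ?\<sigma> (j - i) 0) (disc_path ?\<sigma> (j - Suc i) 0)"
      unfolding gram_def a j j'
      by (intro kernel_diff_disc_path \<tau> disc_path_norm_less_1) (auto simp: \<tau>)
    then show ?thesis
      using False by (simp add: kernel_diff_def dirichlet_kernel_def)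
  qed
qed

lemma gram_diag: "gram \<tau> i i = of_real (- ln (1 - (cmod (\<tau> i))\<^sup>2))"
proof -
  have "(cmod (\<tau> i))\<^sup>2 < 1" using \<tau>[of i] by (simp add: abs_square_less_1)
  then show ?thesis
    using gram_eq[of i i] Ln_of_real[of "1 - (cmod (\<tau> i))\<^sup>2"] by simp
qed

lemma gram_form_sums:
  "(\<lambda>n. cnj (\<Sum>i<N. x i * disc_increment \<tau> i n) * (\<Sum>j<N. y j * disc_increment \<tau> j n))
     sums (\<Sum>i<N. \<Sum>j<N. cnj (x i) * y j * gram \<tau> i j)"
proof -
  have "(\<lambda>n. \<Sum>i<N. \<Sum>j<N. cnj (x i) * y j * (cnj (disc_increment \<tau> i n) * disc_increment \<tau> j n))
     sums (\<Sum>i<N. \<Sum>j<N. cnj (x i) * y j * gram \<tau> i j)"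
    by (intro sums_sum sums_mult gram_sums)
  moreover have "(\<Sum>i<N. \<Sum>j<N. cnj (x i) * y j * (cnj (disc_increment \<tau> i n) * disc_increment \<tau> j n))
     = cnj (\<Sum>i<N. x i * disc_increment \<tau> i n) * (\<Sum>j<N. y j * disc_increment \<tau> j n)" for n
    unfolding cnj_sum complex_cnj_mult sum_product by (intro sum.cong refl) (simp add: mult_ac)
  ultimately show ?thesis by simp
qed

lemma gram_form_Re_sums:
  "(\<lambda>n. (cmod (\<Sum>i<N. x i * disc_increment \<tau> i n))\<^sup>2)
     sums Re (\<Sum>i<N. \<Sum>j<N. cnj (x i) * x j * gram \<tau> i j)"
proof -
  have "cnj z * z = of_real ((cmod z)\<^sup>2)" for z
    by (metis complex_norm_square mult.commute of_real_power)
  then show ?thesis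
    using sums_Re[OF gram_form_sums[where N = N and x = x and y = x]] by (simp only: Re_complex_of_real)
qed

text \<open>The arithmetic-geometric form of the Cauchy--Schwarz inequality is all that is needed.\<close>

lemma gram_form_bound:
  "cmod (\<Sum>i<N. \<Sum>j<N. cnj (x i) * y j * gram \<tau> i j)
     \<le> (Re (\<Sum>i<N. \<Sum>j<N. cnj (x i) * x j * gram \<tau> i j)
          + Re (\<Sum>i<N. \<Sum>j<N. cnj (y i) * y j * gram \<tau> i j)) / 2"
proof -
  let ?X = "\<lambda>n. \<Sum>i<N. x i * disc_increment \<tau> i n" and ?Y = "\<lambda>n. \<Sum>i<N. y i * disc_increment \<tau> i n"
  have "norm (cnj (?X n) * ?Y n) \<le> ((cmod (?X n))\<^sup>2 + (cmod (?Y n))\<^sup>2) / 2" for n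
    using sum_squares_bound[of "cmod (?X n)" "cmod (?Y n)"] by (simp add: norm_mult del: cnj_sum)
  from sums_divide[OF sums_add[OF gram_form_Re_sums[where N = N and x = x] gram_form_Re_sums[where N = N and x = y]], of 2]
    and gram_form_sums[where N = N and x = x and y = y] this
  show ?thesis
    by (metis (no_types, lifting) norm_suminf_le sums_iff)
qed

text \<open>Cauchy-Schwarz for the partial sums, followed by the limit; the squared norms of the
  increments are the diagonal entries.\<close>

lemma gram_le:
  "cmod (gram \<tau> i j) \<le> sqrt (- ln (1 - (cmod (\<tau> i))\<^sup>2)) * sqrt (- ln (1 - (cmod (\<tau> j))\<^sup>2))"
proof -
  define c where "c k = - ln (1 - (cmod (\<tau> k))\<^sup>2)" for k
  have cd: "(\<lambda>n. (cmod (disc_increment \<tau> k n))\<^sup>2) sums c k" for k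
  proof -
    have "cnj z * z = of_real ((cmod z)\<^sup>2)" for z
      by (metis complex_norm_square mult.commute of_real_power)
    then show ?thesis
      using sums_Re[OF gram_sums[of k k]] by (simp add: gram_diag c_def del: of_real_power)
  qed
  have c0: "c k \<ge> 0" for k using cd[of k] sums_le[OF _ sums_zero cd[of k]] by simp
  have fin: "cmod (\<Sum>n<M. cnj (disc_increment \<tau> i n) * disc_increment \<tau> j n) \<le> sqrt (c i) * sqrt (c j)" for M
  proof -
    have "cmod (\<Sum>n<M. cnj (disc_increment \<tau> i n) * disc_increment \<tau> j n)
       \<le> (\<Sum>n<M. \<bar>cmod (disc_increment \<tau> i n)\<bar> * \<bar>cmod (disc_increment \<tau> j n)\<bar>)"
      by (rule order_trans[OF norm_sum]) (simp add: norm_mult)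
    also have "\<dots> \<le> L2_set (\<lambda>n. cmod (disc_increment \<tau> i n)) {..<M} * L2_set (\<lambda>n. cmod (disc_increment \<tau> j n)) {..<M}"
      by (rule L2_set_mult_ineq)
    also have "\<dots> \<le> sqrt (c i) * sqrt (c j)"
      unfolding L2_set_def using cd c0
      by (intro mult_mono real_sqrt_le_mono sum_le_suminf[THEN order_trans]) (auto simp: sums_iff intro: sum_nonneg)
    finally show ?thesis .
  qed
  have "(\<lambda>M. cmod (\<Sum>n<M. cnj (disc_increment \<tau> i n) * disc_increment \<tau> j n)) \<longlonglongrightarrow> cmod (gram \<tau> i j)"
    using gram_sums[of i j] unfolding sums_def by (intro tendsto_norm)
  then show ?thesis
    using fin c_def by (auto intro: LIMSEQ_le_const2)
qed

text \<open>The increments telescope to the feature vector of the endpoint, because the path starts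
  at 0, whose feature vector is zero.\<close>

lemma gram_sum:
  "(\<Sum>i<N. \<Sum>j<N. gram \<tau> i j) = of_real (- ln (1 - (cmod (disc_path \<tau> N 0))\<^sup>2))"
proof -
  let ?g = "disc_path \<tau> N 0"
  have g: "cmod ?g < 1" by (rule disc_path_norm_less_1[OF \<tau>]) simp
  have "(\<Sum>i<N. 1 * disc_increment \<tau> i n) = ?g ^ n / sqrt n - (0::complex) ^ n / sqrt n" for n
    using sum_lessThan_telescope[of "\<lambda>j. disc_path \<tau> j 0 ^ n / sqrt n" N]
    by (simp add: disc_increment_def)
  \<comment> \<open>For n = 0 the numerator is 1, and it is the division by \<open>sqrt 0\<close>
    that gives 0.\<close>
  moreover have "(0::complex) ^ n / sqrt n = 0" for n by (cases n) auto
  ultimately have *: "(\<Sum>i<N. 1 * disc_increment \<tau> i n) = ?g ^ n / sqrt n" for n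
    by (simp only: diff_zero)
  have "(\<lambda>n. cnj (?g ^ n / sqrt n) * (?g ^ n / sqrt n)) sums (\<Sum>i<N. \<Sum>j<N. gram \<tau> i j)"
    using gram_form_sums[where x = "\<lambda>_. 1" and y = "\<lambda>_. 1" and N = N]
    unfolding * by (simp only: complex_cnj_one mult_1)
  then have "(\<Sum>i<N. \<Sum>j<N. gram \<tau> i j) = dirichlet_kernel ?g ?g"
    using dirichlet_kernel_sums[OF g g] sums_unique2 by blast
  moreover have "(cmod ?g)\<^sup>2 < 1" using g by (simp add: abs_square_less_1)
  moreover have "1 - cnj ?g * ?g = of_real (1 - (cmod ?g)\<^sup>2)"
    by (metis complex_norm_square mult.commute of_real_1 of_real_diff of_real_power)
  ultimately show ?thesis
    using Ln_of_real[of "1 - (cmod ?g)\<^sup>2"] by (simp add: dirichlet_kernel_def)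
qed

end

section \<open>Schur functions and means over the circle\<close>

fun schur :: "(nat \<Rightarrow> complex) \<Rightarrow> nat \<Rightarrow> complex \<Rightarrow> complex" where
  "schur t 0 z = 0"
| "schur t (Suc k) z = disc_step (t 0) (z * schur (\<lambda>n. t (Suc n)) k z)"

text \<open>Rotating t by z^m conjugates the corresponding disc step by that rotation. On the unit
  circle the phases in the conjugated parameter therefore cancel, and a path that contains z and its
  conjugate equals, up to a power of z, the Schur recursion, which contains z alone.\<close>

lemma disc_path_eq_schur:
  assumes "cmod z = 1"
  shows "disc_path (\<lambda>n. t n * z ^ (m + n)) k 0 = z ^ m * schur t k z"
proof (induction k arbitrary: t m)
  case (Suc k)
  have kz: "cnj (z ^ m) * z ^ m = 1"
    using assms by (metis complex_norm_square mult.commute norm_power of_real_1 power_one)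
  have *: "cnj (t 0 * z ^ m) * (z ^ Suc m * w) = cnj (t 0) * (z * w)" for w
  proof -
    have "cnj (t 0 * z ^ m) * (z ^ Suc m * w) = (cnj (z ^ m) * z ^ m) * (cnj (t 0) * (z * w))"
      by (simp add: mult_ac)
    then show ?thesis by (simp only: kz mult_1)
  qed
  have "disc_path (\<lambda>n. t n * z ^ (m + n)) (Suc k) 0
      = disc_step (t 0 * z ^ m) (disc_path (\<lambda>n. t (Suc n) * z ^ (Suc m + n)) k 0)"
    by (simp only: disc_path_shift add_0_right add_Suc_right add_Suc)
  also have "\<dots> = disc_step (t 0 * z ^ m) (z ^ Suc m * schur (\<lambda>n. t (Suc n)) k z)"
    by (simp only: Suc)
  also have "\<dots> = z ^ m * schur t (Suc k) z"
    unfolding disc_step_def[of "t 0 * z ^ m"] * by (simp add: disc_step_def algebra_simps)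
  finally show ?case .
qed simp

lemma schur_norm_less_1:
  "(\<And>n. cmod (t n) < 1) \<Longrightarrow> cmod z \<le> 1 \<Longrightarrow> cmod (schur t k z) < 1"
proof (induction k arbitrary: t)
  case (Suc k)
  have "cmod (z * schur (\<lambda>n. t (Suc n)) k z) < 1"
    using Suc.IH[of "\<lambda>n. t (Suc n)"] Suc.prems
    by (metis mult_1 norm_mult mult_left_le_one_le norm_ge_zero order.strict_trans1)
  then show ?case using Suc.prems by (simp add: disc_step_norm_less_1)
qed simp

lemma schur_nonzero:
  assumes "\<And>n. cmod (t n) < 1" "cmod z \<le> 1" "cmod s < 1"
  shows "0 < Re (1 - cnj s * (z * schur t k z))"
proof -
  have "cmod (z * schur t k z) < 1"
    using schur_norm_less_1[of t z k] assms
    by (metis mult_1 norm_mult mult_left_le_one_le norm_ge_zero order.strict_trans1)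
  then show ?thesis using assms by (intro Re_one_minus_pos cmod_cnj_mult_less_1)
qed

lemma schur_continuous_on:
  assumes "\<And>n. cmod (t n) < 1"
  shows "continuous_on (cball 0 1) (schur t k)"
  using assms
proof (induction k arbitrary: t)
  case (Suc k)
  have nz: "1 - cnj (t 0) * (z * schur (\<lambda>n. t (Suc n)) k z) \<noteq> 0" if "z \<in> cball 0 1" for z
    using schur_nonzero[of "\<lambda>n. t (Suc n)" z "t 0" k] Suc.prems that by fastforce
  show ?case
    unfolding schur.simps disc_step_def using nz Suc.prems
    by (intro continuous_intros Suc.IH) auto
qed simp

lemma schur_holomorphic_on:
  assumes "\<And>n. cmod (t n) < 1"
  shows "schur t k holomorphic_on ball 0 1"
  using assms
proof (induction k arbitrary: t)
  case 0
  have "schur t 0 = (\<lambda>_. 0)" by (simp add: fun_eq_iff)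
  then show ?case by simp
next
  case (Suc k)
  have nz: "1 - cnj (t 0) * (z * schur (\<lambda>n. t (Suc n)) k z) \<noteq> 0" if "z \<in> ball 0 1" for z
    using schur_nonzero[of "\<lambda>n. t (Suc n)" z "t 0" k] Suc.prems that by fastforce
  show ?case
    unfolding schur.simps disc_step_def using nz Suc.prems
    by (intro holomorphic_intros Suc.IH) auto
qed

text \<open>The holomorphic extension of the logarithms in \<open>gram_eq\<close>; the factor z in
  front of the Schur function is what makes it vanish at the centre.\<close>

definition log_schur :: "complex \<Rightarrow> (nat \<Rightarrow> complex) \<Rightarrow> nat \<Rightarrow> complex \<Rightarrow> complex" where
  "log_schur s t k z = Ln (1 - cnj s * (z * schur t k z))"

lemma log_schur_arg:
  assumes "\<And>n. cmod (t n) < 1" "cmod s < 1" "cmod z \<le> 1"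
  shows "1 - cnj s * (z * schur t k z) \<notin> \<real>\<^sub>\<le>\<^sub>0"
  using schur_nonzero[where t = t and s = s and z = z and k = k] assms
  by (metis complex_nonpos_Reals_iff not_less)

lemma log_schur_continuous_on:
  assumes "\<And>n. cmod (t n) < 1" "cmod s < 1"
  shows "continuous_on (cball 0 1) (log_schur s t k)"
  unfolding log_schur_def
  by (intro continuous_intros schur_continuous_on assms log_schur_arg[OF assms]) auto

text \<open>Cauchy's formula at the centre, where the logarithm is Ln 1. The minus sign merely
  starts the circle at -1; it makes x = 1/2 the point z = 1 and so the frequency window symmetric
  about 0.\<close>

lemma log_schur_mean_zero:
  assumes "\<And>n. cmod (t n) < 1" "cmod s < 1"
  shows "((\<lambda>x. log_schur s t k (- exp (2 * pi * \<i> * of_real x))) has_integral 0) {0..1}"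
proof -
  define f where "f z = log_schur s t k (- z)" for z
  have cont: "continuous_on (cball 0 1) f"
    unfolding f_def by (rule continuous_on_compose2[OF log_schur_continuous_on[OF assms]]) (auto intro!: continuous_intros)
  have hol0: "log_schur s t k holomorphic_on ball 0 1"
    unfolding log_schur_def
    by (intro holomorphic_intros schur_holomorphic_on assms log_schur_arg[OF assms]) auto
  have hol: "f holomorphic_on ball 0 1"
    unfolding f_def by (rule holomorphic_on_compose_gen[OF _ hol0, unfolded o_def]) (auto intro!: holomorphic_intros)
  have "((\<lambda>u. f u / (u - 0)) has_contour_integral (2 * of_real pi * \<i> * f 0)) (circlepath 0 1)"
    by (rule Cauchy_integral_circlepath[OF cont hol]) simp
  moreover have "f 0 = 0"
    by (simp add: f_def log_schur_def)
  ultimately have "((\<lambda>x. f (circlepath 0 1 x) / (circlepath 0 1 x - 0) *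
      vector_derivative (circlepath 0 1) (at x within {0..1})) has_integral 0) {0..1}"
    unfolding has_contour_integral_def by simp
  then have "((\<lambda>x. f (exp (2 * pi * \<i> * of_real x)) * (2 * pi * \<i>)) has_integral 0) {0..1}"
    by (rule has_integral_eq[rotated]) (simp only: vector_derivative_circlepath01 atLeastAtMost_iff, simp add: circlepath)
  from has_integral_mult_left[OF this, of "1 / (2 * pi * \<i>)"]
  show ?thesis by (simp add: f_def)
qed

text \<open>The conjugate of z^i from the i-th parameter meets z^(i+1) from the later path. Their
  product on the circle is exactly one factor z.\<close>

lemma gram_eq_log_schur:
  assumes t: "\<And>n. cmod (t n) < 1" and z: "cmod z = 1" and ij: "i < j"
  shows "gram (\<lambda>n. t n * z ^ n) i j =
     log_schur (t i) (\<lambda>n. t (Suc i + n)) (j - i) z - log_schur (t i) (\<lambda>n. t (Suc i + n)) (j - Suc i) z"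
proof -
  have \<tau>: "cmod (t n * z ^ n) < 1" for n
    using t[of n] z by (simp add: norm_mult norm_power)
  have kz: "cnj (z ^ i) * z ^ i = 1"
    using z by (metis complex_norm_square mult.commute norm_power of_real_1 power_one)
  have *: "cnj (t i * z ^ i) * disc_path (\<lambda>n. t (Suc i + n) * z ^ (Suc i + n)) k 0
     = cnj (t i) * (z * schur (\<lambda>n. t (Suc i + n)) k z)" for k
  proof -
    have "cnj (t i * z ^ i) * (z ^ Suc i * schur (\<lambda>n. t (Suc i + n)) k z)
      = (cnj (z ^ i) * z ^ i) * (cnj (t i) * (z * schur (\<lambda>n. t (Suc i + n)) k z))"
      by (simp add: mult_ac)
    then show ?thesis
      by (simp only: kz mult_1 disc_path_eq_schur[OF z, where t = "\<lambda>n. t (Suc i + n)" and m = "Suc i"])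
  qed
  show ?thesis
    using gram_eq[where \<tau> = "\<lambda>n. t n * z ^ n" and i = i and j = j, OF \<tau>] ij
    unfolding * log_schur_def by simp
qed

lemma circle_point_norm: "cmod (- exp (2 * pi * \<i> * of_real x)) = 1"
  by simp

lemma gram_continuous_on:
  assumes t: "\<And>n. cmod (t n) < 1"
  shows "continuous_on {0..1} (\<lambda>x. gram (\<lambda>n. t n * (- exp (2 * pi * \<i> * of_real x)) ^ n) i j)"
proof -
  let ?z = "\<lambda>x::real. - exp (2 * pi * \<i> * of_real x)"
  have lt: "continuous_on {0..1} (\<lambda>x. gram (\<lambda>n. t n * ?z x ^ n) i j)" if "i < j" for i j
    unfolding gram_eq_log_schur[OF t circle_point_norm that]
    by (intro continuous_intros continuous_on_compose2[OF log_schur_continuous_on]) (auto simp: t)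
  have \<tau>: "cmod (t n * ?z x ^ n) < 1" for n x
    using t[of n] by (simp add: norm_mult norm_power)
  consider "i < j" | "i = j" | "j < i" by linarith
  then show ?thesis
  proof cases
    case 1 then show ?thesis by (rule lt)
  next
    case 2
    then show ?thesis
      using gram_diag[where \<tau> = "\<lambda>n. t n * ?z _ ^ n" and i = i, OF \<tau>]
      by (simp add: norm_mult norm_power)
  next
    case 3
    then show ?thesis
      using continuous_on_cnj[OF lt[OF 3]]
      by (subst gram_cnj[OF \<tau>]) simp
  qed
qed

lemma gram_integral:
  assumes t: "\<And>n. cmod (t n) < 1"
  shows "((\<lambda>x. gram (\<lambda>n. t n * (- exp (2 * pi * \<i> * of_real x)) ^ n) i j) has_integral
            (if i = j then of_real (- ln (1 - (cmod (t i))\<^sup>2)) else 0)) {0..1}"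
proof -
  let ?z = "\<lambda>x::real. - exp (2 * pi * \<i> * of_real x)"
  have lt: "((\<lambda>x. gram (\<lambda>n. t n * ?z x ^ n) i j) has_integral 0) {0..1}" if "i < j" for i j
    unfolding gram_eq_log_schur[OF t circle_point_norm that]
    using has_integral_diff[OF log_schur_mean_zero log_schur_mean_zero] t by fastforce
  have \<tau>: "cmod (t n * ?z x ^ n) < 1" for n x
    using t[of n] by (simp add: norm_mult norm_power)
  consider "i < j" | "i = j" | "j < i" by linarith
  then show ?thesis
  proof cases
    case 1 then show ?thesis using lt by simp
  next
    case 2
    then show ?thesis
      using has_integral_const_real[of "complex_of_real (- ln (1 - (cmod (t i))\<^sup>2))" 0 1]
        gram_diag[where \<tau> = "\<lambda>n. t n * ?z _ ^ n" and i = i, OF \<tau>]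
      by (simp add: norm_mult norm_power)
  next
    case 3
    then show ?thesis
      using has_integral_cnj[THEN iffD2, OF lt[OF 3]]
      by (subst gram_cnj[OF \<tau>]) (simp add: o_def)
  qed
qed

section \<open>Interpolation between the two endpoints\<close>

text \<open>Both boundary bounds are normalised to 1, so the interpolated bound is again 1 and no
  exponents appear. A Gaussian factor reduces the strip to a tall rectangle, where the maximum
  modulus principle applies.\<close>

lemma three_lines:
  assumes hol: "F holomorphic_on UNIV"
    and bdd: "\<And>z. 0 \<le> Re z \<Longrightarrow> Re z \<le> 1 \<Longrightarrow> cmod (F z) \<le> M"
    and left: "\<And>z. Re z = 0 \<Longrightarrow> cmod (F z) \<le> 1"
    and right: "\<And>z. Re z = 1 \<Longrightarrow> cmod (F z) \<le> 1"
    and x: "0 \<le> x" "x \<le> 1"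
  shows "cmod (F (of_real x)) \<le> 1"
proof (rule ccontr)
  assume "\<not> ?thesis"
  then have gt: "1 < cmod (F (of_real x))" by simp
  \<comment> \<open>With this choice \<open>cmod (F (of_real x))\<close> is
    \<open>exp (2 * \<epsilon>)\<close>, while the damping factor costs at most
    \<open>exp (- \<epsilon>)\<close> at a real point of the strip. The surplus
    \<open>exp \<epsilon>\<close> gives the contradiction.\<close>
  define \<epsilon> where "\<epsilon> = ln (cmod (F (of_real x))) / 2"
  have \<epsilon>: "0 < \<epsilon>" using ln_gt_zero[OF gt] by (simp add: \<epsilon>_def)
  define G where "G z = F z * exp (of_real \<epsilon> * (z\<^sup>2 - 1))" for z
  have nG: "cmod (G z) = cmod (F z) * exp (\<epsilon> * ((Re z)\<^sup>2 - (Im z)\<^sup>2 - 1))" for z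
    by (simp add: G_def norm_mult norm_exp_eq_Re power2_eq_square)
  \<comment> \<open>A height at which the Gaussian decay beats the bound M on the horizontal
    sides.\<close>
  define Y where "Y = max 1 (M / \<epsilon>)"
  have Y: "1 \<le> Y" "M \<le> \<epsilon> * Y" using \<epsilon> by (auto simp: Y_def field_simps max_def)
  have MY: "M * exp (- \<epsilon> * Y\<^sup>2) \<le> 1"
  proof -
    have "M \<le> \<epsilon> * Y\<^sup>2" using Y \<epsilon> self_le_power[of Y 2] by (meson less_imp_le mult_left_mono order_trans zero_less_numeral)
    also have "\<dots> \<le> exp (\<epsilon> * Y\<^sup>2)" using exp_ge_add_one_self[of "\<epsilon> * Y\<^sup>2"] by linarith
    finally show ?thesis by (simp add: exp_minus field_simps)
  qed
  let ?S = "cbox (Complex 0 (- Y)) (Complex 1 Y)"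
  have "cmod (G (of_real x)) \<le> 1"
  proof (rule maximum_modulus_frontier[of G ?S])
    show "G holomorphic_on interior ?S" "continuous_on (closure ?S) G"
      using hol unfolding G_def
      by (auto intro!: holomorphic_intros holomorphic_on_imp_continuous_on elim: holomorphic_on_subset)
    show "of_real x \<in> ?S" using x Y by (auto simp: in_cbox_complex_iff)
  next
    fix z assume "z \<in> frontier ?S"
    then have z: "z \<in> ?S" "z \<notin> box (Complex 0 (- Y)) (Complex 1 Y)"
      by (simp_all add: frontier_def)
    then have strip: "0 \<le> Re z" "Re z \<le> 1" by (auto simp: in_cbox_complex_iff)
    then have sq: "(Re z)\<^sup>2 \<le> 1" by (simp add: power_le_one)
    from z consider "Re z = 0 \<or> Re z = 1" | "\<bar>Im z\<bar> = Y"
      by (force simp: in_cbox_complex_iff in_box_complex_iff)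
    then show "cmod (G z) \<le> 1"
    proof cases
      case 1
      have "\<epsilon> * ((Re z)\<^sup>2 - (Im z)\<^sup>2 - 1) \<le> 0"
        using sq \<epsilon> zero_le_power2[of "Im z"] by (intro mult_nonneg_nonpos) linarith+
      then have "cmod (F z) * exp (\<epsilon> * ((Re z)\<^sup>2 - (Im z)\<^sup>2 - 1)) \<le> 1 * 1"
        using 1 left right by (intro mult_mono) auto
      then show ?thesis by (simp add: nG)
    next
      case 2
      then have "(Im z)\<^sup>2 = Y\<^sup>2" by (metis power2_abs)
      then have "\<epsilon> * ((Re z)\<^sup>2 - (Im z)\<^sup>2 - 1) \<le> - \<epsilon> * Y\<^sup>2"
        using sq \<epsilon> by (simp add: algebra_simps mult_left_le)
      then have "cmod (G z) \<le> M * exp (- \<epsilon> * Y\<^sup>2)"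
        unfolding nG using bdd[OF strip] order_trans[OF norm_ge_zero bdd[OF strip]] by (intro mult_mono) auto
      then show ?thesis using MY by simp
    qed
  qed (simp add: bounded_cbox)
  then have "cmod (F (of_real x)) * exp (\<epsilon> * (x\<^sup>2 - 1)) \<le> 1" by (simp add: nG)
  moreover have "exp (- \<epsilon>) \<le> exp (\<epsilon> * (x\<^sup>2 - 1))" using \<epsilon> by (simp add: algebra_simps)
  ultimately have "cmod (F (of_real x)) * exp (- \<epsilon>) \<le> 1"
    by (meson mult_left_mono norm_ge_zero order_trans)
  moreover have "0 < cmod (F (of_real x))" using gt by linarith
  then have "cmod (F (of_real x)) = exp (2 * \<epsilon>)" by (simp add: \<epsilon>_def)
  ultimately have "exp (2 * \<epsilon>) * exp (- \<epsilon>) \<le> 1" by simp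
  then show False using \<epsilon> by (simp flip: exp_add)
qed

text \<open>The interpolating family is a finite sum of integrals of this shape: u and v collect the
  logarithms of the density and of the coefficients, w the Gram entry.\<close>

lemma exp_affine_integral_holomorphic:
  fixes u v :: "real \<Rightarrow> real" and w :: "real \<Rightarrow> complex"
  assumes "continuous_on {0..1} u" "continuous_on {0..1} v" "continuous_on {0..1} w"
  shows "(\<lambda>z. integral {0..1} (\<lambda>x. exp (of_real (u x) + z * of_real (v x)) * w x)) holomorphic_on UNIV"
proof -
  have "(\<lambda>z. integral (cbox 0 1) (\<lambda>x. exp (of_real (u x) + z * of_real (v x)) * w x)) holomorphic_on UNIV"
  proof (rule leibniz_rule_holomorphic[where fx = "\<lambda>z x. of_real (v x) * exp (of_real (u x) + z * of_real (v x)) * w x"])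
    show "((\<lambda>z. exp (of_real (u x) + z * of_real (v x)) * w x) has_field_derivative
        of_real (v x) * exp (of_real (u x) + z * of_real (v x)) * w x) (at z within UNIV)" for z x
      by (auto intro!: derivative_eq_intros)
    show "(\<lambda>x. exp (of_real (u x) + z * of_real (v x)) * w x) integrable_on cbox 0 1" for z
      using assms by (intro integrable_continuous) (auto intro!: continuous_intros)
    have s: "continuous_on (UNIV \<times> {0..1::real}) (\<lambda>p. h (snd p))" if "continuous_on {0..1} h"
      for h :: "real \<Rightarrow> 'b::topological_space"
      by (rule continuous_on_compose2[OF that]) (auto intro!: continuous_intros)
    show "continuous_on (UNIV \<times> cbox 0 1) (\<lambda>(z, x). of_real (v x) * exp (of_real (u x) + z * of_real (v x)) * w x)"
      unfolding case_prod_beta using assms by (auto intro!: continuous_intros s)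
  qed auto
  then show ?thesis by simp
qed

lemma exp_affine_integral_bounded:
  fixes u v :: "real \<Rightarrow> real" and w :: "real \<Rightarrow> complex"
  assumes "continuous_on {0..1} u" "continuous_on {0..1} v" "continuous_on {0..1} w"
    and "0 \<le> Re z" "Re z \<le> 1"
  shows "cmod (integral {0..1} (\<lambda>x. exp (of_real (u x) + z * of_real (v x)) * w x))
     \<le> integral {0..1} (\<lambda>x. exp (\<bar>u x\<bar> + \<bar>v x\<bar>) * cmod (w x))"
proof (rule integral_norm_bound_integral)
  show "(\<lambda>x. exp (of_real (u x) + z * of_real (v x)) * w x) integrable_on {0..1}"
    using assms by (intro integrable_continuous_interval) (auto intro!: continuous_intros)
  show "(\<lambda>x. exp (\<bar>u x\<bar> + \<bar>v x\<bar>) * cmod (w x)) integrable_on {0..1}"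
    using assms by (intro integrable_continuous_interval) (auto intro!: continuous_intros)
  fix x
  have "Re z * v x \<le> \<bar>Re z * v x\<bar>" by simp
  also have "\<dots> \<le> \<bar>v x\<bar>" using assms(4,5) by (simp add: abs_mult mult_left_le_one_le)
  finally have "u x + Re z * v x \<le> \<bar>u x\<bar> + \<bar>v x\<bar>" by linarith
  then show "norm (exp (of_real (u x) + z * of_real (v x)) * w x) \<le> exp (\<bar>u x\<bar> + \<bar>v x\<bar>) * cmod (w x)"
    by (auto simp: norm_mult norm_exp_eq_Re intro!: mult_right_mono)
qed

text \<open>Isolates what interpolation uses: a positivity statement for the form, the entry bound
  for the supremum endpoint, and the means for the square endpoint. Two different vectors occur in
  \<open>form_bound\<close> because the analytic family is bilinear rather than
  sesquilinear.\<close>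

locale gram_family =
  fixes E :: "nat \<Rightarrow> nat \<Rightarrow> real \<Rightarrow> complex" and c :: "nat \<Rightarrow> real" and N :: nat
  assumes cont: "\<And>i j. continuous_on {0..1} (E i j)"
    and c_nonneg: "\<And>i. 0 \<le> c i"
    and form_bound: "\<And>x X Y. cmod (\<Sum>i<N. \<Sum>j<N. cnj (X i) * Y j * E i j x)
     \<le> (Re (\<Sum>i<N. \<Sum>j<N. cnj (X i) * X j * E i j x) + Re (\<Sum>i<N. \<Sum>j<N. cnj (Y i) * Y j * E i j x)) / 2"
    and entry_bound: "\<And>i j x. cmod (E i j x) \<le> c i * c j"
    and entry_integral: "\<And>i j. (E i j has_integral (if i = j then of_real ((c i)\<^sup>2) else 0)) {0..1}"
begin

lemma form_integral:
  "((\<lambda>x. Re (\<Sum>i<N. \<Sum>j<N. cnj (X i) * X j * E i j x)) has_integral (\<Sum>i<N. (cmod (X i) * c i)\<^sup>2)) {0..1}"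
proof -
  have "((\<lambda>x. (\<Sum>i<N. \<Sum>j<N. cnj (X i) * X j * E i j x)) has_integral
      (\<Sum>i<N. \<Sum>j<N. cnj (X i) * X j * (if i = j then of_real ((c i)\<^sup>2) else 0))) {0..1}"
    by (intro has_integral_sum has_integral_mult_right entry_integral) auto
  moreover have "(\<Sum>i<N. \<Sum>j<N. cnj (X i) * X j * (if i = j then of_real ((c i)\<^sup>2) else 0))
      = (\<Sum>i<N. cnj (X i) * X i * of_real ((c i)\<^sup>2))"
    by (intro sum.cong refl) (simp add: if_distrib cong: if_cong)
  moreover have "\<dots> = of_real (\<Sum>i<N. (cmod (X i) * c i)\<^sup>2)"
  proof -
    have "cnj z * z = of_real ((cmod z)\<^sup>2)" for z
      by (metis complex_norm_square mult.commute of_real_power)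
    then show ?thesis by (simp add: power_mult_distrib)
  qed
  ultimately have "((\<lambda>x. (\<Sum>i<N. \<Sum>j<N. cnj (X i) * X j * E i j x)) has_integral
     of_real (\<Sum>i<N. (cmod (X i) * c i)\<^sup>2)) {0..1}" by simp
  from has_integral_Re[OF this] show ?thesis by (simp only: Re_complex_of_real)
qed

text \<open>Hausdorff-Young in dual form. The double sum is tested against a density normalised in
  the exponent q = p/(2-p), which is conjugate to p/(2(p-1)). The matrix E stays fixed while the
  coefficients and the density move in z.\<close>

lemma weighted_form_bound:
  fixes \<phi> :: "real \<Rightarrow> real"
  assumes p: "1 < p" "p < 2"
    and \<phi>: "continuous_on {0..1} \<phi>" "\<And>x. x \<in> {0..1} \<Longrightarrow> 0 < \<phi> x"
    and \<phi>int: "((\<lambda>x. \<phi> x powr (p / (2 - p))) has_integral 1) {0..1}"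
    and pos: "0 < (\<Sum>i<N. c i powr p)"
  shows "cmod (integral {0..1} (\<lambda>x. of_real (\<phi> x) * (\<Sum>i<N. \<Sum>j<N. E i j x)))
      \<le> (\<Sum>i<N. c i powr p) powr (2 / p)"
proof -
  define A where "A = (\<Sum>i<N. c i powr p) powr (1 / p)"
  define q where "q = p / (2 - p)"
  have q: "0 < q" using p by (simp add: q_def)
  have A: "0 < A" using pos by (simp add: A_def)
  have Ap: "A powr p = (\<Sum>i<N. c i powr p)"
    using pos p by (simp add: A_def powr_powr)
  have norm1: "(\<Sum>i<N. (c i / A) powr p) = 1"
    using pos A c_nonneg by (simp add: powr_divide Ap flip: sum_divide_distrib)
  \<comment> \<open>The exponents \<open>\<alpha>\<close>, \<open>\<beta>\<close> of density and
    coefficients are q, p at z = 0 and 0, p/2 at z = 1. Being affine, both equal 1 at z = 2 - 2/p,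
    the point where the original integral is recovered up to the factor
    \<open>1 / A^2\<close>.\<close>
  define \<alpha> where "\<alpha> z = of_real q * (1 - z)" for z :: complex
  define \<beta> where "\<beta> z = of_real p * (1 - z / 2)" for z :: complex
  define k where "k i = ln (c i / A)" for i
  \<comment> \<open>If \<open>c i\<close> is 0 the quotient is 0; this is harmless because the entry
    bound makes row and column i of E vanish.\<close>
  define d where "d z i = exp (\<beta> z * of_real (k i)) / of_real (c i)" for z i
  \<comment> \<open>No conjugate on \<open>d z i\<close>, since T must be holomorphic in z. On the
    line Re z = 1 the form is recovered by taking the first vector of \<open>form_bound\<close> to
    be \<open>cnj (d z i)\<close>.\<close>
  define T where "T z x = exp (\<alpha> z * of_real (ln (\<phi> x))) * (\<Sum>i<N. \<Sum>j<N. d z i * d z j * E i j x)" for z x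
  define F where "F z = integral {0..1} (T z)" for z
  define u where "u i j x = q * ln (\<phi> x) + p * (k i + k j)" for i j x
  define v where "v i j x = - q * ln (\<phi> x) - p * (k i + k j) / 2" for i j x
  define w where "w i j x = E i j x / of_real (c i * c j)" for i j x
  have ln\<phi>: "continuous_on {0..1} (\<lambda>x. ln (\<phi> x))"
    using \<phi> by (intro continuous_intros) (auto simp: less_imp_neq[symmetric] less_imp_le dest: \<phi>(2))
  have cu: "continuous_on {0..1} (u i j)" and cv: "continuous_on {0..1} (v i j)"
    and cw: "continuous_on {0..1} (w i j)" for i j
    unfolding u_def v_def w_def divide_inverse using ln\<phi> cont by (auto intro!: continuous_intros)
  have T_eq: "T z x = (\<Sum>i<N. \<Sum>j<N. exp (of_real (u i j x) + z * of_real (v i j x)) * w i j x)" for z x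
  proof -
    have "exp (of_real (u i j x) + z * of_real (v i j x)) * w i j x
        = exp (\<alpha> z * of_real (ln (\<phi> x))) * (d z i * d z j * E i j x)" for i j
    proof -
      have "of_real (u i j x) + z * of_real (v i j x) = \<alpha> z * of_real (ln (\<phi> x)) + \<beta> z * of_real (k i) + \<beta> z * of_real (k j)"
        by (simp add: u_def v_def \<alpha>_def \<beta>_def field_simps)
      then show ?thesis by (simp add: exp_add w_def d_def)
    qed
    then show ?thesis by (simp add: T_def sum_distrib_left)
  qed
  have Ti: "(\<lambda>x. exp (of_real (u i j x) + z * of_real (v i j x)) * w i j x) integrable_on {0..1}" for z i j
    by (intro integrable_continuous_interval continuous_intros cu cv cw)
  have Tint: "T z integrable_on {0..1}" for z
    unfolding T_eq[abs_def] by (intro integrable_sum Ti) auto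
  have F_eq: "F z = (\<Sum>i<N. \<Sum>j<N. integral {0..1} (\<lambda>x. exp (of_real (u i j x) + z * of_real (v i j x)) * w i j x))" for z
    unfolding F_def T_eq[abs_def] by (simp add: integral_sum integrable_sum Ti)
  have hol: "F holomorphic_on UNIV"
    unfolding F_eq[abs_def] by (intro holomorphic_intros exp_affine_integral_holomorphic cu cv cw)
  define M where "M = (\<Sum>i<N. \<Sum>j<N. integral {0..1} (\<lambda>x. exp (\<bar>u i j x\<bar> + \<bar>v i j x\<bar>) * cmod (w i j x)))"
  have bdd: "cmod (F z) \<le> M" if "0 \<le> Re z" "Re z \<le> 1" for z
    unfolding F_eq M_def
    by (intro sum_norm_le exp_affine_integral_bounded cu cv cw that)
  have dn: "cmod (d z i) * c i = (c i / A) powr Re (\<beta> z)" for z i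
    using c_nonneg[of i] A by (cases "c i = 0") (simp_all add: d_def norm_divide norm_exp_eq_Re k_def powr_def)
  have left: "cmod (F z) \<le> 1" if z: "Re z = 0" for z
  proof -
    have "cmod (T z x) \<le> \<phi> x powr q" if x: "x \<in> {0..1}" for x
    proof -
      have "cmod (\<Sum>i<N. \<Sum>j<N. d z i * d z j * E i j x) \<le> (\<Sum>i<N. \<Sum>j<N. (cmod (d z i) * c i) * (cmod (d z j) * c j))"
      proof (intro sum_norm_le)
        fix i j
        have "cmod (d z i * d z j * E i j x) \<le> cmod (d z i) * cmod (d z j) * (c i * c j)"
          unfolding norm_mult by (intro mult_left_mono entry_bound) auto
        then show "cmod (d z i * d z j * E i j x) \<le> (cmod (d z i) * c i) * (cmod (d z j) * c j)"
          by (simp add: mult_ac)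
      qed
      also have "\<dots> = 1"
        unfolding sum_product[symmetric] dn using z norm1 by (simp add: \<beta>_def)
      finally have "cmod (\<Sum>i<N. \<Sum>j<N. d z i * d z j * E i j x) \<le> 1" .
      moreover have "cmod (exp (\<alpha> z * of_real (ln (\<phi> x)))) = \<phi> x powr q"
        using \<phi>(2)[OF x] z by (simp add: norm_exp_eq_Re \<alpha>_def powr_def)
      ultimately show ?thesis unfolding T_def norm_mult by (simp add: mult_left_le)
    qed
    then have "cmod (F z) \<le> integral {0..1} (\<lambda>x. \<phi> x powr q)"
      unfolding F_def using \<phi>int by (intro integral_norm_bound_integral Tint) (auto simp: q_def)
    then show ?thesis using \<phi>int by (simp add: q_def integral_unique)
  qed
  have right: "cmod (F z) \<le> 1" if z: "Re z = 1" for z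
  proof -
    let ?b = "\<lambda>X x. Re (\<Sum>i<N. \<Sum>j<N. cnj (X i) * X j * E i j x)"
    have sq: "(\<Sum>i<N. (cmod (d z i) * c i)\<^sup>2) = 1"
    proof -
      have "((c i / A) powr (p / 2))\<^sup>2 = (c i / A) powr p" for i
        by (simp add: power2_eq_square flip: powr_add)
      then show ?thesis unfolding dn using z norm1 by (simp add: \<beta>_def)
    qed
    have i: "((\<lambda>x. (?b (\<lambda>i. cnj (d z i)) x + ?b (d z) x) / 2) has_integral ((1 + 1) / 2)) {0..1}"
      using form_integral[of "\<lambda>i. cnj (d z i)"] form_integral[of "d z"] sq
      by (intro has_integral_divide has_integral_add) (simp_all only: complex_mod_cnj)
    have "cmod (T z x) \<le> (?b (\<lambda>i. cnj (d z i)) x + ?b (d z) x) / 2" for x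
    proof -
      have "cmod (exp (\<alpha> z * of_real (ln (\<phi> x)))) = 1"
        using z by (simp add: norm_exp_eq_Re \<alpha>_def)
      then show ?thesis
        using form_bound[of "\<lambda>i. cnj (d z i)" "d z" x] by (simp only: T_def norm_mult complex_cnj_cnj mult_1)
    qed
    then have "cmod (F z) \<le> integral {0..1} (\<lambda>x. (?b (\<lambda>i. cnj (d z i)) x + ?b (d z) x) / 2)"
      unfolding F_def using i by (intro integral_norm_bound_integral Tint) auto
    also have "\<dots> = 1" using integral_unique[OF i] by simp
    finally show ?thesis .
  qed
  define \<theta> where "\<theta> = 2 - 2 / p"
  have \<theta>: "0 \<le> \<theta>" "\<theta> \<le> 1" using p by (auto simp: \<theta>_def field_simps)
  have b1: "\<beta> (of_real \<theta>) = 1" "\<alpha> (of_real \<theta>) = 1"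
  proof -
    have "p * (1 - \<theta> / 2) = 1" "q * (1 - \<theta>) = 1"
      using p by (simp_all add: \<theta>_def q_def field_simps)
    moreover have "\<beta> (of_real \<theta>) = of_real (p * (1 - \<theta> / 2))" "\<alpha> (of_real \<theta>) = of_real (q * (1 - \<theta>))"
      by (simp_all add: \<alpha>_def \<beta>_def)
    ultimately show "\<beta> (of_real \<theta>) = 1" "\<alpha> (of_real \<theta>) = 1" by simp_all
  qed
  have "T (of_real \<theta>) x = of_real (\<phi> x) * (\<Sum>i<N. \<Sum>j<N. E i j x) / of_real (A\<^sup>2)" if x: "x \<in> {0..1}" for x
  proof -
    have "d (of_real \<theta>) i * d (of_real \<theta>) j * E i j x = E i j x / of_real (A\<^sup>2)" for i j
    proof (cases "c i = 0 \<or> c j = 0")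
      case True
      then show ?thesis using entry_bound[of i j x] by (auto simp: d_def)
    next
      case False
      then have "0 < c i" "0 < c j" using c_nonneg[of i] c_nonneg[of j] by auto
      then have "d (of_real \<theta>) i = 1 / of_real A" "d (of_real \<theta>) j = 1 / of_real A"
        using A by (simp_all add: d_def b1 k_def exp_of_real)
      then show ?thesis by (simp add: power2_eq_square)
    qed
    then show ?thesis
      using \<phi>(2)[OF x] by (simp add: T_def b1 exp_of_real flip: sum_divide_distrib)
  qed
  then have "F (of_real \<theta>) = integral {0..1} (\<lambda>x. of_real (\<phi> x) * (\<Sum>i<N. \<Sum>j<N. E i j x) / of_real (A\<^sup>2))"
    unfolding F_def by (intro integral_cong) auto
  also have "\<dots> = integral {0..1} (\<lambda>x. of_real (\<phi> x) * (\<Sum>i<N. \<Sum>j<N. E i j x)) / of_real (A\<^sup>2)"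
    by simp
  finally have "cmod (integral {0..1} (\<lambda>x. of_real (\<phi> x) * (\<Sum>i<N. \<Sum>j<N. E i j x))) / A\<^sup>2 \<le> 1"
    using three_lines[OF hol bdd left right \<theta>] A by (simp add: norm_divide norm_power)
  then have "cmod (integral {0..1} (\<lambda>x. of_real (\<phi> x) * (\<Sum>i<N. \<Sum>j<N. E i j x))) \<le> A\<^sup>2"
    using A by (simp add: divide_le_eq)
  also have "A\<^sup>2 = (\<Sum>i<N. c i powr p) powr (2 / p)"
    using pos by (simp add: A_def power2_eq_square flip: powr_add)
  finally show ?thesis .
qed

text \<open>Duality with the extremal density of Hoelder's inequality, a multiple of U powr (s-1).
  The previous bound takes the logarithm of the density, so U is first replaced by the positive
  function U + \<epsilon>, and \<epsilon> tends to 0 at the end.\<close>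

lemma hausdorff_young:
  assumes p: "1 < p" "p < 2"
    and U: "\<And>x. (\<Sum>i<N. \<Sum>j<N. E i j x) = of_real (U x)" "\<And>x. 0 \<le> U x"
  shows "integral {0..1} (\<lambda>x. U x powr (p / (2 * (p - 1))))
      \<le> (\<Sum>i<N. c i powr p) powr (1 / (p - 1))"
proof (cases "0 < (\<Sum>i<N. c i powr p)")
  case False
  moreover have "0 \<le> (\<Sum>i<N. c i powr p)" by (intro sum_nonneg) auto
  ultimately have "(\<Sum>i<N. c i powr p) = 0" by linarith
  then have "c i = 0" if "i < N" for i
    using that sum_nonneg_eq_0_iff[of "{..<N}" "\<lambda>i. c i powr p"] by simp
  then have "(\<Sum>i<N. \<Sum>j<N. E i j x) = 0" for x
    using entry_bound by (intro sum.neutral ballI) (metis lessThan_iff mult_zero_left norm_le_zero_iff)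
  then have "U x = 0" for x using U(1)[of x] by simp
  then show ?thesis by simp
next
  case True
  define s where "s = p / (2 * (p - 1))"
  define q where "q = p / (2 - p)"
  define B where "B = (\<Sum>i<N. c i powr p) powr (2 / p)"
  have s: "1 < s" and q: "1 < q" using p by (auto simp: s_def q_def field_simps)
  have s1: "s - 1 = (2 - p) / (2 * (p - 1))" using p by (simp add: s_def field_simps)
  have nz: "2 - p \<noteq> 0" "p - 1 \<noteq> 0" using p by auto
  have qs: "(s - 1) * q = s" "1 - 1 / q = 1 / s"
    unfolding s1 using nz p by (simp add: s_def q_def, simp add: s_def q_def field_simps)
  have B: "0 < B" using True by (simp add: B_def)
  have Ucont: "continuous_on {0..1} U"
  proof -
    have "continuous_on {0..1} (\<lambda>x. Re (\<Sum>i<N. \<Sum>j<N. E i j x))"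
      by (intro continuous_intros cont)
    then show ?thesis by (simp add: U(1))
  qed
  have Us: "continuous_on {0..1} (\<lambda>x. U x powr s)"
    using s U(2) by (intro continuous_on_powr' Ucont continuous_intros) auto
  have step: "integral {0..1} (\<lambda>x. U x powr s) \<le> (B + \<epsilon>) powr s" if \<epsilon>: "0 < \<epsilon>" for \<epsilon>
  proof -
    define V where "V x = U x + \<epsilon>" for x
    have V: "0 < V x" "U x \<le> V x" for x using U(2)[of x] \<epsilon> by (auto simp: V_def)
    have Vc: "continuous_on {0..1} (\<lambda>x. V x powr r)" for r
      unfolding V_def using U(2) \<epsilon> by (intro continuous_intros Ucont) (auto simp: add_nonneg_eq_0_iff)
    define I where "I = integral {0..1} (\<lambda>x. V x powr s)"
    have "0 < \<epsilon> powr s" using \<epsilon> by simp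
    also have "\<epsilon> powr s = integral {0..1} (\<lambda>x::real. \<epsilon> powr s)" by simp
    also have "\<dots> \<le> I" unfolding I_def
      using \<epsilon> s U(2) by (intro integral_le integrable_continuous_interval Vc powr_mono2) (auto simp: V_def)
    finally have I: "0 < I" .
    \<comment> \<open>Since (s-1) * q = s, the q-th power of \<open>\<phi>\<close> is
      \<open>V x powr s / I\<close>, which has integral 1.\<close>
    define \<phi> where "\<phi> x = V x powr (s - 1) * I powr (- 1 / q)" for x
    have \<phi>pos: "0 < \<phi> x" for x using I V(1)[of x] by (simp add: \<phi>_def)
    have \<phi>c: "continuous_on {0..1} \<phi>" unfolding \<phi>_def by (intro continuous_intros Vc)
    have \<phi>q: "\<phi> x powr q = V x powr s / I" for x
    proof -
      have "\<phi> x powr q = V x powr ((s - 1) * q) * I powr (- 1 / q * q)"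
        unfolding \<phi>_def using V(1)[of x] I by (simp only: powr_mult powr_powr)
      then show ?thesis using q I by (simp only: qs) (simp add: powr_minus_divide)
    qed
    have \<phi>int: "((\<lambda>x. \<phi> x powr q) has_integral 1) {0..1}"
    proof -
      have "((\<lambda>x. V x powr s) has_integral I) {0..1}"
        unfolding I_def by (intro integrable_integral integrable_continuous_interval Vc)
      from has_integral_divide[OF this, of I] show ?thesis using I by (simp add: \<phi>q)
    qed
    have "cmod (integral {0..1} (\<lambda>x. of_real (\<phi> x) * (\<Sum>i<N. \<Sum>j<N. E i j x))) \<le> B"
      unfolding B_def using weighted_form_bound[OF p \<phi>c \<phi>pos _ True] \<phi>int by (simp add: q_def)
    moreover have "(\<lambda>x. of_real (\<phi> x) * (\<Sum>i<N. \<Sum>j<N. E i j x)) = (\<lambda>x. complex_of_real (\<phi> x * U x))"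
      by (simp add: U(1))
    moreover have \<phi>Ui: "(\<lambda>x. \<phi> x * U x) integrable_on {0..1}"
      by (intro integrable_continuous_interval continuous_intros \<phi>c Ucont)
    ultimately have 1: "integral {0..1} (\<lambda>x. \<phi> x * U x) \<le> B"
      using integral_linear[OF \<phi>Ui bounded_linear_of_real[where 'a = complex]]
      by (simp add: o_def)
    \<comment> \<open>The interval has length 1, so normalisation in the exponent q also bounds the
      plain integral. This keeps the cost of the shift in V below \<epsilon>.\<close>
    have 2: "integral {0..1} \<phi> \<le> 1"
    proof -
      have "\<phi> x \<le> \<phi> x powr q / q + (1 - 1 / q)" for x
        using Youngs_inequality[of q "s" "\<phi> x" 1] \<phi>pos[of x] q s qs by simp
      moreover have "((\<lambda>x. \<phi> x powr q / q + (1 - 1 / q)) has_integral (1 / q + (1 - 1 / q))) {0..1}"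
        using has_integral_const_real[of "1 - 1 / q" 0 1]
        by (intro has_integral_add has_integral_divide \<phi>int) simp
      ultimately show ?thesis
        using has_integral_le[OF integrable_integral[OF integrable_continuous_interval[OF \<phi>c]]] by fastforce
    qed
    have "integral {0..1} (\<lambda>x. \<phi> x * V x) = I powr (1 / s)"
    proof -
      have "\<phi> x * V x = V x powr s * I powr (- 1 / q)" for x
      proof -
        have "V x powr s = V x powr (s - 1) * V x"
          using powr_add[of "V x" "s - 1" 1] V(1)[of x] by simp
        then show ?thesis by (simp add: \<phi>_def mult_ac)
      qed
      then have "integral {0..1} (\<lambda>x. \<phi> x * V x) = I * I powr (- 1 / q)" by (simp add: I_def)
      also have "\<dots> = I powr (1 + - 1 / q)" using I by (simp only: powr_add) simp
      finally show ?thesis using qs by simp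
    qed
    moreover have "integral {0..1} (\<lambda>x. \<phi> x * V x)
        = integral {0..1} (\<lambda>x. \<phi> x * U x) + \<epsilon> * integral {0..1} \<phi>"
    proof -
      have "(\<lambda>x. \<phi> x * V x) = (\<lambda>x. \<phi> x * U x + \<epsilon> * \<phi> x)" by (simp add: V_def algebra_simps)
      moreover have "(\<lambda>x. \<epsilon> * \<phi> x) integrable_on {0..1}"
        by (intro integrable_continuous_interval continuous_intros \<phi>c)
      ultimately show ?thesis using \<phi>Ui by (simp add: integral_add)
    qed
    ultimately have "I powr (1 / s) \<le> B + \<epsilon>"
      using 1 mult_left_mono[OF 2, of \<epsilon>] \<epsilon> by linarith
    then have "(I powr (1 / s)) powr s \<le> (B + \<epsilon>) powr s"
      using s by (intro powr_mono2) auto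
    then have "I \<le> (B + \<epsilon>) powr s" using s I by (simp add: powr_powr)
    moreover have "integral {0..1} (\<lambda>x. U x powr s) \<le> I"
      unfolding I_def using s U(2) V by (intro integral_le integrable_continuous_interval Us Vc powr_mono2) auto
    ultimately show ?thesis by simp
  qed
  have "((\<lambda>\<epsilon>. (B + \<epsilon>) powr s) \<longlongrightarrow> (B + 0) powr s) (at_right 0)"
    using B by (intro tendsto_intros) auto
  then have "integral {0..1} (\<lambda>x. U x powr s) \<le> (B + 0) powr s"
    by (rule tendsto_lowerbound) (auto simp: eventually_at_filter step)
  also have "\<dots> = (\<Sum>i<N. c i powr p) powr (2 / p * s)" by (simp add: B_def powr_powr)
  also have "2 / p * s = 1 / (p - 1)" using p by (simp add: s_def field_simps)
  finally show ?thesis by (simp add: s_def)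
qed

end

section \<open>Products of SU(1,1) matrices\<close>

text \<open>The explicit Euler scheme of the equation: a product of matrices with rows (1, cnj
  \<tau>) and (\<tau>, 1). Each lacks the factor 1/sqrt(1 - |\<tau>|^2) that would put it into
  SU(1,1); the missing determinants are accounted for separately.\<close>

fun nlft_discrete :: "(nat \<Rightarrow> complex) \<Rightarrow> nat \<Rightarrow> complex \<times> complex" where
  "nlft_discrete \<tau> 0 = (1, 0)"
| "nlft_discrete \<tau> (Suc n) =
     (fst (nlft_discrete \<tau> n) + cnj (\<tau> n) * snd (nlft_discrete \<tau> n),
      snd (nlft_discrete \<tau> n) + \<tau> n * fst (nlft_discrete \<tau> n))"

lemma nlft_discrete_det:
  "(cmod (fst (nlft_discrete \<tau> n)))\<^sup>2 - (cmod (snd (nlft_discrete \<tau> n)))\<^sup>2 = (\<Prod>i<n. 1 - (cmod (\<tau> i))\<^sup>2)"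
proof (induction n)
  case (Suc n)
  let ?A = "fst (nlft_discrete \<tau> n)" and ?B = "snd (nlft_discrete \<tau> n)"
  have "(cmod (?A + cnj (\<tau> n) * ?B))\<^sup>2 - (cmod (?B + \<tau> n * ?A))\<^sup>2
      = ((cmod ?A)\<^sup>2 - (cmod ?B)\<^sup>2) * (1 - (cmod (\<tau> n))\<^sup>2)"
    unfolding cmod_power2 by (simp add: power2_eq_square algebra_simps)
  then show ?case using Suc by simp
qed simp

text \<open>Conjugation by a diagonal unitary matrix. It lets a phase common to all steps be
  discarded, such as the one caused by the grid starting at -R.\<close>

lemma nlft_discrete_phase:
  assumes "cmod \<kappa> = 1"
  shows "nlft_discrete (\<lambda>n. \<kappa> * \<tau> n) N = (fst (nlft_discrete \<tau> N), \<kappa> * snd (nlft_discrete \<tau> N))"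
proof (induction N)
  case (Suc N)
  have "cnj \<kappa> * \<kappa> = 1" using assms by (metis complex_norm_square mult.commute of_real_1 power_one)
  then have "cnj \<kappa> * cnj (\<tau> N) * (\<kappa> * s) = cnj (\<tau> N) * s" for s
    by (metis mult.assoc mult.left_commute mult_1)
  then have "cnj \<kappa> * cnj (\<tau> N) * (\<kappa> * snd (nlft_discrete \<tau> N)) = cnj (\<tau> N) * snd (nlft_discrete \<tau> N)" .
  then show ?case unfolding nlft_discrete.simps Suc fst_conv snd_conv complex_cnj_mult by (simp add: algebra_simps)
qed simp

text \<open>The path is the fractional linear action of the matrix product, where scalar
  normalisations cancel. At w = 0 its modulus is |b/a|.\<close>

lemma disc_path_eq_nlft_discrete:
  assumes "\<And>k. cmod (\<tau> k) < 1" "cmod w < 1"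
  shows "disc_path \<tau> N w = (fst (nlft_discrete \<tau> N) * w - snd (nlft_discrete \<tau> N)) /
            (cnj (fst (nlft_discrete \<tau> N)) - cnj (snd (nlft_discrete \<tau> N)) * w)"
  using assms(2)
proof (induction N arbitrary: w)
  case (Suc N)
  let ?A = "fst (nlft_discrete \<tau> N)" and ?B = "snd (nlft_discrete \<tau> N)"
  have D: "1 - cnj (\<tau> N) * w \<noteq> 0"
    using Re_one_minus_pos[OF cmod_cnj_mult_less_1[OF assms(1)[of N] Suc.prems]]
    by (metis less_irrefl zero_complex.sel(1))
  have "disc_path \<tau> (Suc N) w = (?A * disc_step (\<tau> N) w - ?B) / (cnj ?A - cnj ?B * disc_step (\<tau> N) w)"
    using Suc.IH[OF disc_step_norm_less_1[OF assms(1) Suc.prems]] by simp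
  also have "\<dots> = ((?A * disc_step (\<tau> N) w - ?B) * (1 - cnj (\<tau> N) * w)) /
      ((cnj ?A - cnj ?B * disc_step (\<tau> N) w) * (1 - cnj (\<tau> N) * w))"
    using D by simp
  also have "(?A * disc_step (\<tau> N) w - ?B) * (1 - cnj (\<tau> N) * w) = ?A * (w - \<tau> N) - ?B * (1 - cnj (\<tau> N) * w)"
    using D by (simp add: disc_step_def left_diff_distrib)
  also have "(cnj ?A - cnj ?B * disc_step (\<tau> N) w) * (1 - cnj (\<tau> N) * w)
      = cnj ?A * (1 - cnj (\<tau> N) * w) - cnj ?B * (w - \<tau> N)"
    using D by (simp add: disc_step_def left_diff_distrib)
  finally show ?case by (simp add: algebra_simps)
qed simp

lemma nlft_discrete_fst_nonzero:
  assumes "\<And>k. cmod (\<tau> k) < 1"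
  shows "(\<Prod>i<N. 1 - (cmod (\<tau> i))\<^sup>2) \<le> (cmod (fst (nlft_discrete \<tau> N)))\<^sup>2"
    "0 < (\<Prod>i<N. 1 - (cmod (\<tau> i))\<^sup>2)" "fst (nlft_discrete \<tau> N) \<noteq> 0"
proof -
  show 1: "0 < (\<Prod>i<N. 1 - (cmod (\<tau> i))\<^sup>2)"
    using assms by (intro prod_pos) (simp add: abs_square_less_1)
  show 2: "(\<Prod>i<N. 1 - (cmod (\<tau> i))\<^sup>2) \<le> (cmod (fst (nlft_discrete \<tau> N)))\<^sup>2"
    using nlft_discrete_det[of \<tau> N] zero_le_power2[of "cmod (snd (nlft_discrete \<tau> N))"] by linarith
  show "fst (nlft_discrete \<tau> N) \<noteq> 0" using 1 2 by auto
qed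

text \<open>The sum is minus the logarithm of the determinant: it converts the unnormalised first
  entry into that of the normalised product.\<close>

lemma disc_path_norm_eq:
  assumes "\<And>k. cmod (\<tau> k) < 1"
  shows "- ln (1 - (cmod (disc_path \<tau> N 0))\<^sup>2)
     = ln ((cmod (fst (nlft_discrete \<tau> N)))\<^sup>2) + (\<Sum>i<N. - ln (1 - (cmod (\<tau> i))\<^sup>2))"
proof -
  let ?A = "fst (nlft_discrete \<tau> N)" and ?P = "\<Prod>i<N. 1 - (cmod (\<tau> i))\<^sup>2"
  note nz = nlft_discrete_fst_nonzero[where \<tau> = \<tau> and N = N, OF assms]
  have "(cmod (disc_path \<tau> N 0))\<^sup>2 = (cmod (snd (nlft_discrete \<tau> N)))\<^sup>2 / (cmod ?A)\<^sup>2"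
    using disc_path_eq_nlft_discrete[where \<tau> = \<tau> and w = 0 and N = N, OF assms] by (simp add: norm_divide power_divide)
  also have "\<dots> = ((cmod ?A)\<^sup>2 - ?P) / (cmod ?A)\<^sup>2"
    using nlft_discrete_det[of \<tau> N] by (simp add: algebra_simps)
  finally have "1 - (cmod (disc_path \<tau> N 0))\<^sup>2 = ?P / (cmod ?A)\<^sup>2"
    using nz(3) by (simp add: field_simps)
  moreover have "ln (?P / (cmod ?A)\<^sup>2) = ln ?P - ln ((cmod ?A)\<^sup>2)"
    by (rule ln_divide_pos) (use nz in auto)
  ultimately have "- ln (1 - (cmod (disc_path \<tau> N 0))\<^sup>2) = ln ((cmod ?A)\<^sup>2) - ln ?P"
    by (simp only: minus_diff_eq)
  also have "ln ?P = (\<Sum>i<N. ln (1 - (cmod (\<tau> i))\<^sup>2))"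
  proof (intro ln_prod)
    show "1 - (cmod (\<tau> i))\<^sup>2 \<noteq> 0" for i
      using assms[of i] abs_square_less_1[of "cmod (\<tau> i)"] by simp
  qed simp
  finally show ?thesis by (simp add: sum_negf)
qed

section \<open>The discrete transform as a function on the circle\<close>

definition circle_point :: "real \<Rightarrow> complex" where
  "circle_point x = - exp (2 * pi * \<i> * of_real x)"

definition circle_log :: "(nat \<Rightarrow> complex) \<Rightarrow> nat \<Rightarrow> real \<Rightarrow> real" where
  "circle_log t N x = ln ((cmod (fst (nlft_discrete (\<lambda>n. t n * circle_point x ^ n) N)))\<^sup>2)
      + (\<Sum>i<N. - ln (1 - (cmod (t i))\<^sup>2))"

lemma continuous_on_nlft_discrete:
  assumes "\<And>n. continuous_on S (\<lambda>x. \<tau> x n)"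
  shows "continuous_on S (\<lambda>x. nlft_discrete (\<tau> x) N)"
proof (induction N)
  case (Suc N)
  then show ?case unfolding nlft_discrete.simps by (intro continuous_intros assms)
qed simp

context
  fixes t :: "nat \<Rightarrow> complex"
  assumes t: "\<And>n. cmod (t n) < 1"
begin

lemma circle_point_less: "cmod (t n * circle_point x ^ n) < 1"
  using t[of n] by (simp add: norm_mult norm_power circle_point_def)

lemma circle_log_eq: "circle_log t N x = - ln (1 - (cmod (disc_path (\<lambda>n. t n * circle_point x ^ n) N 0))\<^sup>2)"
  unfolding disc_path_norm_eq[where \<tau> = "\<lambda>n. t n * circle_point x ^ n", OF circle_point_less]
  by (simp add: circle_log_def norm_mult norm_power circle_point_def)

lemma circle_log_nonneg: "0 \<le> circle_log t N x"
proof -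
  let ?w = "disc_path (\<lambda>n. t n * circle_point x ^ n) N 0"
  have "cmod ?w < 1" by (rule disc_path_norm_less_1[where \<tau> = "\<lambda>n. t n * circle_point x ^ n", OF circle_point_less]) simp
  then have "(cmod ?w)\<^sup>2 < 1" by (simp add: abs_square_less_1)
  then show ?thesis unfolding circle_log_eq by (simp add: ln_le_zero_iff)
qed

lemma circle_log_gram:
  "(\<Sum>i<N. \<Sum>j<N. gram (\<lambda>n. t n * circle_point x ^ n) i j) = of_real (circle_log t N x)"
  unfolding circle_log_eq by (rule gram_sum[where \<tau> = "\<lambda>n. t n * circle_point x ^ n", OF circle_point_less])

lemma gram_family_circle:
  "gram_family (\<lambda>i j x. gram (\<lambda>n. t n * circle_point x ^ n) i j) (\<lambda>i. sqrt (- ln (1 - (cmod (t i))\<^sup>2))) N"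
proof
  have c: "0 \<le> - ln (1 - (cmod (t i))\<^sup>2)" for i
    using t[of i] by (simp add: abs_square_less_1 ln_le_zero_iff)
  fix i j
  show "continuous_on {0..1} (\<lambda>x. gram (\<lambda>n. t n * circle_point x ^ n) i j)"
    using gram_continuous_on[of t, OF t] by (simp add: circle_point_def)
  show "0 \<le> sqrt (- ln (1 - (cmod (t i))\<^sup>2))" using c by simp
  show "((\<lambda>x. gram (\<lambda>n. t n * circle_point x ^ n) i j) has_integral
     (if i = j then of_real ((sqrt (- ln (1 - (cmod (t i))\<^sup>2)))\<^sup>2) else 0)) {0..1}"
    using gram_integral[of t, OF t, of i j] real_sqrt_pow2[OF c[of i]]
    by (simp only: circle_point_def)
  fix x
  show "cmod (gram (\<lambda>n. t n * circle_point x ^ n) i j)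
      \<le> sqrt (- ln (1 - (cmod (t i))\<^sup>2)) * sqrt (- ln (1 - (cmod (t j))\<^sup>2))"
    using gram_le[where \<tau> = "\<lambda>n. t n * circle_point x ^ n", OF circle_point_less, of i j] by (simp add: norm_mult norm_power circle_point_def)
next
  fix x X Y
  show "cmod (\<Sum>i<N. \<Sum>j<N. cnj (X i) * Y j * gram (\<lambda>n. t n * circle_point x ^ n) i j)
     \<le> (Re (\<Sum>i<N. \<Sum>j<N. cnj (X i) * X j * gram (\<lambda>n. t n * circle_point x ^ n) i j)
       + Re (\<Sum>i<N. \<Sum>j<N. cnj (Y i) * Y j * gram (\<lambda>n. t n * circle_point x ^ n) i j)) / 2"
    by (rule gram_form_bound[where \<tau> = "\<lambda>n. t n * circle_point x ^ n", OF circle_point_less])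
qed

lemma circle_log_hausdorff_young:
  assumes "1 < p" "p < 2"
  shows "integral {0..1} (\<lambda>x. circle_log t N x powr (p / (2 * (p - 1))))
      \<le> (\<Sum>i<N. sqrt (- ln (1 - (cmod (t i))\<^sup>2)) powr p) powr (1 / (p - 1))"
  using gram_family.hausdorff_young[OF gram_family_circle assms circle_log_gram circle_log_nonneg] .

text \<open>The supremum endpoint by itself: the entry bounds factor into a square. This gives the
  case p = 1.\<close>

lemma circle_log_le: "circle_log t N x \<le> (\<Sum>i<N. sqrt (- ln (1 - (cmod (t i))\<^sup>2)))\<^sup>2"
proof -
  interpret gram_family "\<lambda>i j x. gram (\<lambda>n. t n * circle_point x ^ n) i j" "\<lambda>i. sqrt (- ln (1 - (cmod (t i))\<^sup>2))" N
    by (rule gram_family_circle)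
  have "circle_log t N x = cmod (\<Sum>i<N. \<Sum>j<N. gram (\<lambda>n. t n * circle_point x ^ n) i j)"
    unfolding circle_log_gram using circle_log_nonneg by simp
  also have "\<dots> \<le> (\<Sum>i<N. \<Sum>j<N. sqrt (- ln (1 - (cmod (t i))\<^sup>2)) * sqrt (- ln (1 - (cmod (t j))\<^sup>2)))"
    by (intro sum_norm_le entry_bound)
  finally show ?thesis by (simp add: power2_eq_square sum_product)
qed

lemma circle_log_continuous: "continuous_on UNIV (circle_log t N)"
proof -
  have "continuous_on UNIV (\<lambda>x. nlft_discrete (\<lambda>n. t n * circle_point x ^ n) N)"
    by (intro continuous_on_nlft_discrete) (auto simp: circle_point_def intro!: continuous_intros)
  then show ?thesis
    unfolding circle_log_def using nlft_discrete_fst_nonzero(3)[where \<tau> = "\<lambda>n. t n * circle_point _ ^ n", OF circle_point_less]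
    by (intro continuous_intros) auto
qed

end

section \<open>The uniform grid on the support of the potential\<close>

locale grid =
  fixes g :: "real \<Rightarrow> complex" and R :: real
  assumes g: "g absolutely_integrable_on UNIV" and R: "0 < R"
    and support: "\<And>x. R \<le> \<bar>x\<bar> \<Longrightarrow> g x = 0"
begin

definition node :: "nat \<Rightarrow> nat \<Rightarrow> real" where
  "node N j = - R + 2 * R * real j / real N"

definition cell :: "nat \<Rightarrow> nat \<Rightarrow> real set" where
  "cell N j = {node N j..node N (Suc j)}"

definition weight :: "nat \<Rightarrow> nat \<Rightarrow> complex" where
  "weight N j = (if j < N then integral (cell N j) g else 0)"

definition cell_mass :: "nat \<Rightarrow> nat \<Rightarrow> real" where
  "cell_mass N j = integral (cell N j) (\<lambda>x. cmod (g x))"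

abbreviation total :: real where "total \<equiv> integral UNIV (\<lambda>x. cmod (g x))"

lemma node_Suc: "node N (Suc j) = node N j + 2 * R / real N"
  by (simp add: node_def add_divide_distrib algebra_simps)

lemma node_le: "node N j \<le> node N (Suc j)"
  using R by (simp add: node_Suc)

lemma node_0: "node N 0 = - R" by (simp add: node_def)

lemma node_N: "0 < N \<Longrightarrow> node N N = R" by (simp add: node_def)

lemma node_bounds: "j \<le> N \<Longrightarrow> - R \<le> node N j" "j \<le> N \<Longrightarrow> node N j \<le> R"
proof -
  assume "j \<le> N"
  then have "R * real j / real N \<le> R" "0 \<le> R * real j / real N"
    using R by (cases "N = 0"; simp add: divide_le_eq mult_left_mono)+
  then show "- R \<le> node N j" "node N j \<le> R" by (auto simp: node_def)
qed

lemma cell_integrable: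
  fixes h :: "real \<Rightarrow> 'a::euclidean_space"
  shows "h absolutely_integrable_on UNIV \<Longrightarrow> h integrable_on cell N j"
  using abs_integrable_subset[of h "cell N j"] by (simp add: absolutely_integrable_on_def cell_def)

lemma sum_cells:
  fixes h :: "real \<Rightarrow> real"
  assumes "h absolutely_integrable_on UNIV" "\<And>x. 0 \<le> h x"
  shows "(\<Sum>j<n. integral (cell N j) h) \<le> integral UNIV h"
proof -
  have "(\<Sum>j<n. integral (cell N j) h) = primitive h (node N n) - primitive h (node N 0)"
    unfolding cell_def primitive_diff[OF assms(1) node_le, symmetric] by (rule sum_lessThan_telescope)
  also have "\<dots> \<le> primitive h (node N n)"
    using assms abs_integrable_subset[OF assms(1), of "{..node N 0}"]
    by (simp add: primitive_def absolutely_integrable_on_def integral_nonneg)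
  also have "\<dots> \<le> integral UNIV h"
    unfolding primitive_def using assms abs_integrable_subset[OF assms(1), of "{..node N n}"]
    by (intro integral_subset_le) (auto simp: absolutely_integrable_on_def)
  finally show ?thesis .
qed

lemma cell_mass_nonneg: "0 \<le> cell_mass N j"
  unfolding cell_mass_def using cell_integrable[OF norm_absolutely_integrable[OF g]] by (intro integral_nonneg) auto

lemma weight_le: "cmod (weight N j) \<le> cell_mass N j"
  using cell_mass_nonneg cell_integrable[OF norm_absolutely_integrable[OF g]] cell_integrable[OF g]
  by (auto simp: weight_def cell_mass_def intro: integral_norm_bound_integral)

lemma sum_cell_mass: "(\<Sum>j<n. cell_mass N j) \<le> total"
  unfolding cell_mass_def by (rule sum_cells[OF norm_absolutely_integrable[OF g]]) simp

text \<open>Uniform continuity of the mass makes all cells small simultaneously. This puts the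
  parameters into the disc and makes the sum of their squares negligible.\<close>

lemma cell_mass_small:
  assumes "0 < \<epsilon>"
  shows "\<forall>\<^sub>F N in sequentially. \<forall>j. cell_mass N j < \<epsilon>"
proof -
  have "uniformly_continuous_on UNIV (mass g)"
    unfolding mass_def by (intro abs_continuous_on_uniformly_continuous primitive_abs_continuous norm_absolutely_integrable g)
  then obtain d where d: "0 < d" "\<And>x y. dist y x < d \<Longrightarrow> dist (mass g y) (mass g x) < \<epsilon>"
    using assms unfolding uniformly_continuous_on_def by (metis UNIV_I)
  have "(\<lambda>N. 2 * R / real N) \<longlonglongrightarrow> 0" by real_asymp
  then have "\<forall>\<^sub>F N in sequentially. 2 * R / real N < d" using d(1) by (simp add: order_tendsto_iff)
  then show ?thesis
  proof eventually_elim
    case (elim N)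
    have "cell_mass N j < \<epsilon>" for j
    proof -
      have "cell_mass N j = mass g (node N (Suc j)) - mass g (node N j)"
        unfolding cell_mass_def cell_def mass_def by (rule primitive_diff[OF norm_absolutely_integrable[OF g] node_le, symmetric])
      also have "\<dots> < \<epsilon>"
        using d(2)[of "node N (Suc j)" "node N j"] elim R by (simp add: dist_real_def node_Suc)
      finally show ?thesis .
    qed
    then show ?case by simp
  qed
qed

end

section \<open>Discretization of a compactly supported potential\<close>

lemma norm_cnj_Pair: "norm (cnj c * u, c * v) = cmod c * norm (u, v)"
proof -
  have "norm (cnj c * u, c * v) = sqrt ((cmod c)\<^sup>2 * ((cmod u)\<^sup>2 + (cmod v)\<^sup>2))"
    by (simp add: norm_Pair norm_mult power_mult_distrib algebra_simps)
  also have "\<dots> = cmod c * norm (u, v)" by (simp add: real_sqrt_mult norm_Pair)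
  finally show ?thesis .
qed

lemma norm_Pair_swap: "norm (snd z, fst z) = norm z"
  by (cases z) (simp add: norm_Pair add.commute)

context grid
begin

definition phased_weight :: "real \<Rightarrow> nat \<Rightarrow> nat \<Rightarrow> complex" where
  "phased_weight \<xi> N j = weight N j * exp (- (2 * pi * \<i> * node N j * \<xi>))"

lemma phased_weight_norm: "cmod (phased_weight \<xi> N j) = cmod (weight N j)"
  by (simp add: phased_weight_def norm_mult norm_exp_eq_Re)

text \<open>Convergence of the Euler scheme for a merely integrable potential. Since g has no
  regularity, it is integrated exactly over each cell and only the continuous factor multiplying it
  is frozen at the left node. The local errors are collected by a discrete Gronwall argument with
  the cell masses as step sizes.\<close>

theorem nlft_discrete_tendsto:
  "(\<lambda>N. fst (nlft_discrete (phased_weight \<xi> N) N)) \<longlonglongrightarrow> nlft_a g \<xi>"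
proof -
  obtain y B where y: "continuous_on UNIV y" "\<And>x. norm (y x) \<le> B"
    "\<And>x. y x = (1, 0) + primitive (\<lambda>x. nlft_field g \<xi> x (y x)) x"
    and lim: "((\<lambda>x. fst (y x)) \<longlongrightarrow> nlft_a g \<xi>) at_top"
    using nlft_a_integral_equation[OF g, of \<xi>] by blast
  define h where "h x = nlft_field g \<xi> x (y x)" for x
  have ai: "h absolutely_integrable_on UNIV"
    unfolding h_def by (rule nlft_field_absolutely_integrable[OF g y(1,2)])
  have h0: "h x = 0" if "R \<le> \<bar>x\<bar>" for x
    using support[OF that] by (simp add: h_def nlft_field_def zero_prod_def)
  have y_eq: "y x = (1, 0) + primitive h x" for x
    using y(3)[of x] by (simp add: h_def[abs_def])
  have "integral {..- R} h = integral {..- R} (\<lambda>_. 0)"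
    by (rule integral_cong) (use R in \<open>auto intro!: h0\<close>)
  then have start: "y (- R) = (1, 0)" unfolding y_eq by (simp add: primitive_def)
  have inc: "y b = y a + integral {a..b} h" if "a \<le> b" for a b
    unfolding y_eq using primitive_diff[OF ai that] by (simp add: algebra_simps)
  have const: "y x = y R" if "R \<le> x" for x
  proof -
    have "integral {R..x} h = integral {R..x} (\<lambda>_. 0)"
      by (rule integral_cong) (use R in \<open>auto intro!: h0\<close>)
    then show ?thesis using inc[OF that] by simp
  qed
  have "\<forall>\<^sub>F x in at_top. fst (y x) = fst (y R)"
    using eventually_ge_at_top[of R] by eventually_elim (rule arg_cong[OF const])
  then have "((\<lambda>x. fst (y x)) \<longlongrightarrow> fst (y R)) at_top" by (rule tendsto_eventually)
  then have aR: "nlft_a g \<xi> = fst (y R)"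
    using lim tendsto_unique trivial_limit_at_top_linorder by blast
  \<comment> \<open>The continuous part of the field, with the oscillation included:
    \<open>h x\<close> has the components \<open>cnj (g x)\<close> times the first and
    \<open>g x\<close> times the second component of \<open>Q x\<close>.\<close>
  define Q where "Q x = (exp (2 * pi * \<i> * of_real x * \<xi>) * snd (y x), exp (- (2 * pi * \<i> * of_real x * \<xi>)) * fst (y x))" for x :: real
  have "continuous_on UNIV Q" unfolding Q_def by (intro continuous_intros y)
  then have uc: "uniformly_continuous_on {- R..R} Q"
    by (intro compact_uniformly_continuous) (auto intro: continuous_on_subset)
  show ?thesis
  proof (rule LIMSEQ_I)
    fix e :: real assume e: "0 < e"
    define \<omega> where "\<omega> = e / (2 * exp total)"
    have \<omega>: "0 < \<omega>" "\<omega> * exp total < e" using e by (simp_all add: \<omega>_def)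
    obtain d where d: "0 < d" "\<And>x x'. x \<in> {- R..R} \<Longrightarrow> x' \<in> {- R..R} \<Longrightarrow> dist x' x < d \<Longrightarrow> dist (Q x') (Q x) < \<omega>"
      using uc \<omega>(1) unfolding uniformly_continuous_on_def by metis
    have "(\<lambda>N. 2 * R / real N) \<longlonglongrightarrow> 0" by real_asymp
    then have "\<forall>\<^sub>F N in sequentially. 2 * R / real N < d" using d(1) by (simp add: order_tendsto_iff)
    then obtain N0 where N0: "\<And>N. N0 \<le> N \<Longrightarrow> 2 * R / real N < d"
      by (auto simp: eventually_sequentially)
    have "norm (fst (nlft_discrete (phased_weight \<xi> N) N) - nlft_a g \<xi>) < e" if N: "max 1 N0 \<le> N" for N
    proof -
      have Npos: "0 < N" and small: "2 * R / real N < d" using N N0 by auto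
      let ?\<tau> = "phased_weight \<xi> N"
      let ?x = "node N"
      \<comment> \<open>The form exp - 1 reproduces itself: with E the exponential so far, (1 +
        \<mu>)(E - 1) + \<mu> = (1 + \<mu>)E - 1, and 1 + \<mu> \<le> exp \<mu>.\<close>
      have main: "norm (nlft_discrete ?\<tau> j - y (?x j)) \<le> \<omega> * (exp (\<Sum>i<j. cell_mass N i) - 1)" if "j \<le> N" for j
        using that
      proof (induction j)
        case 0
        then show ?case by (simp add: node_0 start)
      next
        case (Suc j)
        let ?Y = "nlft_discrete ?\<tau> j" and ?y = "y (?x j)" and ?\<mu> = "cell_mass N j"
        let ?u = "fst (Q (?x j))" and ?v = "snd (Q (?x j))"
        define D where "D z = (cnj (?\<tau> j) * snd z, ?\<tau> j * fst z)" for z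
        have jN: "j < N" using Suc.prems by simp
        have IH: "norm (?Y - ?y) \<le> \<omega> * (exp (\<Sum>i<j. cell_mass N i) - 1)" using Suc by simp
        have step: "nlft_discrete ?\<tau> (Suc j) = ?Y + D ?Y" by (simp add: D_def prod_eq_iff)
        have Dd: "D ?Y - D ?y = (cnj (?\<tau> j) * snd (?Y - ?y), ?\<tau> j * fst (?Y - ?y))"
          by (simp add: D_def algebra_simps)
        have n1: "norm (D ?Y - D ?y) \<le> ?\<mu> * norm (?Y - ?y)"
          unfolding Dd norm_cnj_Pair norm_Pair_swap phased_weight_norm by (intro mult_right_mono weight_le) auto
        have bl: "bounded_linear (\<lambda>c. (cnj c * ?u, c * ?v))"
          by (intro bounded_linear_Pair bounded_linear_mult_const bounded_linear_compose[OF bounded_linear_mult_left bounded_linear_cnj] bounded_linear_mult_left)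
        have gi: "g integrable_on cell N j" and hi: "h integrable_on cell N j"
          by (intro cell_integrable g ai)+
        have ce: "cnj (exp (- (2 * pi * \<i> * of_real (?x j) * \<xi>))) = exp (2 * pi * \<i> * of_real (?x j) * \<xi>)"
          by (simp add: exp_cnj)
        have Deq: "D ?y = integral (cell N j) (\<lambda>x. (cnj (g x) * ?u, g x * ?v))"
          using integral_linear[OF gi bl] jN ce
          by (simp add: o_def D_def phased_weight_def weight_def Q_def mult_ac)
        have ii: "(\<lambda>x. (cnj (g x) * ?u, g x * ?v)) integrable_on cell N j"
          using integrable_linear[OF gi bl] by (simp add: o_def)
        have n2: "norm (D ?y - integral (cell N j) h) \<le> ?\<mu> * \<omega>"
        proof -
          have "D ?y - integral (cell N j) h = integral (cell N j) (\<lambda>x. (cnj (g x) * ?u, g x * ?v) - h x)"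
            unfolding Deq by (rule integral_diff[OF ii hi, symmetric])
          also have "norm \<dots> \<le> integral (cell N j) (\<lambda>x. cmod (g x) * \<omega>)"
          proof (rule integral_norm_bound_integral)
            show "(\<lambda>x. (cnj (g x) * ?u, g x * ?v) - h x) integrable_on cell N j"
              by (intro integrable_diff ii hi)
            show "(\<lambda>x. cmod (g x) * \<omega>) integrable_on cell N j"
              by (intro integrable_on_mult_left cell_integrable norm_absolutely_integrable g)
            fix x assume x: "x \<in> cell N j"
            have "(cnj (g x) * ?u, g x * ?v) - h x = (cnj (g x) * fst (Q (?x j) - Q x), g x * snd (Q (?x j) - Q x))"
              by (simp add: h_def nlft_field_def Q_def algebra_simps)
            then have "norm ((cnj (g x) * ?u, g x * ?v) - h x) = cmod (g x) * norm (Q (?x j) - Q x)"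
              by (simp only: norm_cnj_Pair prod.collapse)
            moreover have "norm (Q (?x j) - Q x) \<le> \<omega>"
            proof -
              have "?x j \<in> {- R..R}" "?x (Suc j) \<le> R" using node_bounds[of j N] node_bounds[of "Suc j" N] jN by auto
              then have "x \<in> {- R..R}" "dist (?x j) x < d"
                using x small by (auto simp: cell_def dist_real_def node_Suc)
              then show ?thesis
                using d(2)[of x "?x j"] \<open>?x j \<in> {- R..R}\<close> by (simp add: dist_norm)
            qed
            ultimately show "norm ((cnj (g x) * ?u, g x * ?v) - h x) \<le> cmod (g x) * \<omega>"
              by (simp add: mult_left_mono)
          qed
          also have "\<dots> = ?\<mu> * \<omega>" by (simp add: cell_mass_def)
          finally show ?thesis .
        qed
        have "nlft_discrete ?\<tau> (Suc j) - y (?x (Suc j))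
            = (?Y - ?y) + (D ?Y - D ?y) + (D ?y - integral (cell N j) h)"
          unfolding step inc[OF node_le[of N j]] cell_def by (simp add: algebra_simps)
        also have "norm \<dots> \<le> norm (?Y - ?y) + ?\<mu> * norm (?Y - ?y) + ?\<mu> * \<omega>"
          using n1 n2 by (intro norm_triangle_le add_mono) auto
        also have "\<dots> = (1 + ?\<mu>) * norm (?Y - ?y) + ?\<mu> * \<omega>" by (simp add: algebra_simps)
        also have "\<dots> \<le> (1 + ?\<mu>) * (\<omega> * (exp (\<Sum>i<j. cell_mass N i) - 1)) + ?\<mu> * \<omega>"
          using IH cell_mass_nonneg by (intro add_right_mono mult_left_mono) (auto intro: add_nonneg_nonneg)
        also have "\<dots> = \<omega> * ((1 + ?\<mu>) * exp (\<Sum>i<j. cell_mass N i) - 1)" by (simp add: algebra_simps)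
        also have "\<dots> \<le> \<omega> * (exp ?\<mu> * exp (\<Sum>i<j. cell_mass N i) - 1)"
          using \<omega>(1) by (intro mult_left_mono diff_right_mono mult_right_mono exp_ge_add_one_self) auto
        finally show ?case by (simp add: exp_add mult.commute)
      qed
      have "norm (fst (nlft_discrete ?\<tau> N) - nlft_a g \<xi>) = norm (fst (nlft_discrete ?\<tau> N - y R))"
        by (simp add: aR)
      also have "\<dots> \<le> norm (nlft_discrete ?\<tau> N - y R)"
        by (metis norm_fst_le prod.collapse)
      also have "\<dots> \<le> \<omega> * (exp (\<Sum>i<N. cell_mass N i) - 1)"
        using main[of N] node_N[OF Npos] by simp
      also have "\<dots> \<le> \<omega> * exp total"
        using sum_cell_mass[of N N] \<omega>(1) by (intro mult_left_mono) (auto intro: order_trans[of _ "exp (\<Sum>i<N. cell_mass N i)"])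
      finally show ?thesis using \<omega>(2) by simp
    qed
    then show "\<exists>no. \<forall>n\<ge>no. norm (fst (nlft_discrete (phased_weight \<xi> n) n) - nlft_a g \<xi>) < e" by blast
  qed
qed

text \<open>The 1/2 compensates the sign in \<open>circle_point\<close>. As \<xi> runs through
  [-N/(4R), N/(4R)], the parameter covers [0,1] exactly once.\<close>

definition circle_param :: "nat \<Rightarrow> real \<Rightarrow> real" where
  "circle_param N \<xi> = 1 / 2 - 2 * R / real N * \<xi>"

text \<open>Equal spacing of the nodes turns the phases into powers of a single unit number, times
  the phase of the first node -R.\<close>

lemma phased_weight_circle_point:
  "phased_weight \<xi> N j = exp (2 * pi * \<i> * R * \<xi>) * (weight N j * circle_point (circle_param N \<xi>) ^ j)"
proof -
  have "circle_point (circle_param N \<xi>) = - exp (pi * \<i> - 2 * pi * \<i> * (2 * R / real N * \<xi>))"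
    by (simp add: circle_point_def circle_param_def algebra_simps)
  also have "\<dots> = exp (- (2 * pi * \<i> * (2 * R / real N * \<xi>)))"
    by (simp add: exp_diff exp_minus field_simps)
  finally have "circle_point (circle_param N \<xi>) ^ j = exp (of_nat j * (- (2 * pi * \<i> * (2 * R / real N * \<xi>))))"
    by (simp only: exp_of_nat_mult)
  then have "exp (2 * pi * \<i> * R * \<xi>) * circle_point (circle_param N \<xi>) ^ j
      = exp (- (2 * pi * \<i> * node N j * \<xi>))"
    by (simp add: node_def algebra_simps add_divide_distrib flip: exp_add)
  then show ?thesis by (simp add: phased_weight_def mult_ac)
qed

lemma nlft_discrete_circle:
  "fst (nlft_discrete (phased_weight \<xi> N) N)
     = fst (nlft_discrete (\<lambda>j. weight N j * circle_point (circle_param N \<xi>) ^ j) N)"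
proof -
  have "cmod (exp (2 * pi * \<i> * R * \<xi>)) = 1" by (simp add: norm_exp_eq_Re)
  from nlft_discrete_phase[OF this] show ?thesis
    by (simp add: phased_weight_circle_point[abs_def])
qed

text \<open>The ratio allowed between step length and Euclidean length for parameters of modulus at
  most \<epsilon>, obtained from -ln(1-x) \<le> x/(1-x). It tends to 1 with \<epsilon>.\<close>

definition factor :: "real \<Rightarrow> real" where
  "factor \<epsilon> = 1 / sqrt (1 - \<epsilon>\<^sup>2)"

text \<open>The hyperbolic lengths of the steps are asymptotically the Euclidean ones.\<close>

lemma step_length_le:
  assumes "0 < \<epsilon>" "\<epsilon> < 1" "cmod w \<le> \<epsilon>"
  shows "sqrt (- ln (1 - (cmod w)\<^sup>2)) \<le> factor \<epsilon> * cmod w"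
proof -
  let ?x = "(cmod w)\<^sup>2"
  have x: "?x \<le> \<epsilon>\<^sup>2" "\<epsilon>\<^sup>2 < 1" using assms by (simp_all add: power_mono abs_square_less_1)
  then have x1: "0 < 1 - ?x" by linarith
  have "- ln (1 - ?x) = ln (1 / (1 - ?x))" using x1 by (simp add: ln_divide_pos)
  also have "\<dots> \<le> 1 / (1 - ?x) - 1" using x1 by (intro ln_le_minus_one) simp
  also have "\<dots> = ?x / (1 - ?x)" using x1 by (simp add: field_simps)
  also have "\<dots> \<le> ?x / (1 - \<epsilon>\<^sup>2)" using x by (intro divide_left_mono mult_pos_pos) auto
  finally have "sqrt (- ln (1 - ?x)) \<le> sqrt (?x / (1 - \<epsilon>\<^sup>2))" by (rule real_sqrt_le_mono)
  then show ?thesis by (simp add: real_sqrt_divide factor_def)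
qed

lemma eventually_small_weights:
  assumes "0 < \<epsilon>" "\<epsilon> < 1"
  shows "\<forall>\<^sub>F N in sequentially. (\<forall>j. cmod (weight N j) < \<epsilon>) \<and> 0 < N"
  using cell_mass_small[OF assms(1)] eventually_gt_at_top[of 0]
  by eventually_elim (auto intro: le_less_trans[OF weight_le])

lemma eventually_weights_less_1: "\<forall>\<^sub>F N in sequentially. \<forall>j. cmod (weight N j) < 1"
proof -
  have "\<forall>\<^sub>F N in sequentially. (\<forall>j. cmod (weight N j) < 1/2) \<and> 0 < N"
    by (rule eventually_small_weights) simp_all
  then show ?thesis
    by eventually_elim (auto intro: less_trans[of _ "1/2"])
qed

text \<open>The determinant correction disappears in the limit because the weights have bounded sum
  and are uniformly small, so their squares sum to almost nothing. The same fact gives |a| \<ge> 1,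
  from the corresponding bound for the discrete products.\<close>

lemma circle_log_tendsto:
  "(\<lambda>N. circle_log (weight N) N (circle_param N \<xi>)) \<longlonglongrightarrow> ln ((cmod (nlft_a g \<xi>))\<^sup>2)"
    and nlft_a_norm_ge_1: "1 \<le> cmod (nlft_a g \<xi>)"
proof -
  define S where "S N = (\<Sum>i<N. - ln (1 - (cmod (weight N i))\<^sup>2))" for N
  let ?A = "\<lambda>N. fst (nlft_discrete (phased_weight \<xi> N) N)"
  have S: "S \<longlonglongrightarrow> 0"
  proof (rule LIMSEQ_I)
    fix r :: real assume r: "0 < r"
    have tot: "0 \<le> total" using norm_absolutely_integrable[OF g] by (intro integral_nonneg) (auto simp: absolutely_integrable_on_def)
    \<comment> \<open>The first bound gives \<open>(factor \<epsilon>)^2 \<le> 2\<close>; the second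
      makes \<open>2 * \<epsilon> * total\<close> smaller than r, where the added 1 covers a
      vanishing total.\<close>
    define \<epsilon> where "\<epsilon> = min (1/2) (r / (4 * (total + 1)))"
    have "0 < \<epsilon>" using r tot by (simp add: \<epsilon>_def)
    moreover have "\<epsilon> \<le> 1/2" "\<epsilon> \<le> r / (4 * (total + 1))"
      unfolding \<epsilon>_def by (rule min.cobounded1, rule min.cobounded2)
    ultimately have \<epsilon>: "0 < \<epsilon>" "\<epsilon> < 1" "\<epsilon> \<le> 1/2" "\<epsilon> \<le> r / (4 * (total + 1))"
      by linarith+
    then have \<epsilon>r: "\<epsilon> * (4 * (total + 1)) \<le> r"
      using tot by (simp add: pos_le_divide_eq)
    have "\<bar>S N\<bar> < r" if w: "\<forall>j. cmod (weight N j) < \<epsilon>" for N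
    proof -
      have t: "0 \<le> - ln (1 - (cmod (weight N i))\<^sup>2)" "- ln (1 - (cmod (weight N i))\<^sup>2) \<le> 2 * \<epsilon> * cell_mass N i" for i
      proof -
        have w1: "cmod (weight N i) \<le> \<epsilon>" using w less_imp_le by blast
        have "(cmod (weight N i))\<^sup>2 < 1" using w1 \<epsilon> by (simp add: abs_square_less_1)
        then show nn: "0 \<le> - ln (1 - (cmod (weight N i))\<^sup>2)" by (simp add: ln_le_zero_iff)
        have "\<epsilon>\<^sup>2 \<le> 1/2" using \<epsilon> power_mono[of \<epsilon> "1/2" 2] by (simp add: power2_eq_square)
        then have f: "(factor \<epsilon>)\<^sup>2 \<le> 2" by (simp add: factor_def power_divide field_simps)
        have "- ln (1 - (cmod (weight N i))\<^sup>2) = (sqrt (- ln (1 - (cmod (weight N i))\<^sup>2)))\<^sup>2"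
          by (rule real_sqrt_pow2[OF nn, symmetric])
        also have "\<dots> \<le> (factor \<epsilon> * cmod (weight N i))\<^sup>2"
          by (intro power_mono step_length_le \<epsilon> w1 real_sqrt_ge_zero nn)
        also have "\<dots> = (factor \<epsilon>)\<^sup>2 * (cmod (weight N i) * cmod (weight N i))" by (simp add: power2_eq_square)
        also have "\<dots> \<le> 2 * (\<epsilon> * cell_mass N i)"
          using f w1 weight_le \<epsilon> by (intro mult_mono) auto
        finally show "- ln (1 - (cmod (weight N i))\<^sup>2) \<le> 2 * \<epsilon> * cell_mass N i" by simp
      qed
      have "S N \<le> 2 * \<epsilon> * (\<Sum>i<N. cell_mass N i)"
        unfolding S_def sum_distrib_left by (intro sum_mono t)
      also have "\<dots> \<le> 2 * \<epsilon> * total" using \<epsilon> by (intro mult_left_mono sum_cell_mass) auto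
      also have "\<dots> < r"
      proof -
        have "4 * \<epsilon> + 4 * (\<epsilon> * total) \<le> r" using \<epsilon>r by (simp add: algebra_simps)
        moreover have "0 \<le> \<epsilon> * total" using \<epsilon>(1) tot by simp
        moreover have "2 * \<epsilon> * total = 2 * (\<epsilon> * total)" by simp
        ultimately show ?thesis using \<epsilon>(1) by linarith
      qed
      finally show ?thesis using t(1) unfolding S_def by (simp add: sum_nonneg abs_of_nonneg)
    qed
    then have "\<forall>\<^sub>F N in sequentially. \<bar>S N\<bar> < r"
      using eventually_small_weights[OF \<epsilon>(1,2)] by (auto elim!: eventually_mono)
    then show "\<exists>no. \<forall>n\<ge>no. norm (S n - 0) < r" by (auto simp: eventually_sequentially)
  qed
  \<comment> \<open>The left side is the determinant of the product, which is |a|^2 - |b|^2 for the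
    discrete entries.\<close>
  have lb: "\<forall>\<^sub>F N in sequentially. exp (- S N) \<le> (cmod (?A N))\<^sup>2"
    using eventually_weights_less_1
  proof eventually_elim
    case (elim N)
    have w: "cmod (phased_weight \<xi> N k) < 1" for k
      using elim by (simp add: phased_weight_norm)
    have "exp (- S N) = (\<Prod>i<N. exp (ln (1 - (cmod (weight N i))\<^sup>2)))"
      unfolding S_def by (simp add: sum_negf exp_sum)
    also have "\<dots> = (\<Prod>i<N. 1 - (cmod (phased_weight \<xi> N i))\<^sup>2)"
      using w by (intro prod.cong refl) (simp add: phased_weight_norm abs_square_less_1)
    also have "\<dots> \<le> (cmod (?A N))\<^sup>2"
      by (rule nlft_discrete_fst_nonzero(1)[where \<tau> = "phased_weight \<xi> N", OF w])
    finally show ?case .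
  qed
  have "(\<lambda>N. exp (- S N)) \<longlonglongrightarrow> exp (- 0)" by (intro tendsto_intros S)
  moreover have A: "(\<lambda>N. (cmod (?A N))\<^sup>2) \<longlonglongrightarrow> (cmod (nlft_a g \<xi>))\<^sup>2"
    by (intro tendsto_intros nlft_discrete_tendsto)
  ultimately have "exp (- 0) \<le> (cmod (nlft_a g \<xi>))\<^sup>2"
    using lb by (intro tendsto_le[OF sequentially_bot])
  then have ge: "1 \<le> (cmod (nlft_a g \<xi>))\<^sup>2" by simp
  then show "1 \<le> cmod (nlft_a g \<xi>)"
    by (metis norm_ge_zero one_power2 power2_le_imp_le)
  have "(\<lambda>N. ln ((cmod (?A N))\<^sup>2) + S N) \<longlonglongrightarrow> ln ((cmod (nlft_a g \<xi>))\<^sup>2) + 0"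
    using ge by (intro tendsto_intros A S) auto
  then show "(\<lambda>N. circle_log (weight N) N (circle_param N \<xi>)) \<longlonglongrightarrow> ln ((cmod (nlft_a g \<xi>))\<^sup>2)"
    by (simp add: circle_log_def S_def nlft_discrete_circle)
qed

end

section \<open>Passage to the limit\<close>

lemma circle_log_measurable: "circle_log t N \<in> borel_measurable borel"
proof -
  have "continuous_on UNIV (\<lambda>x. nlft_discrete (\<lambda>n. t n * circle_point x ^ n) N)"
    by (intro continuous_on_nlft_discrete) (auto simp: circle_point_def intro!: continuous_intros)
  then have "(\<lambda>x. (cmod (fst (nlft_discrete (\<lambda>n. t n * circle_point x ^ n) N)))\<^sup>2) \<in> borel_measurable borel"
    by (intro borel_measurable_continuous_onI continuous_intros)
  then show ?thesis unfolding circle_log_def by measurable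
qed

context grid
begin

lemma nlft_a_measurable: "nlft_a g \<in> borel_measurable borel"
proof (rule borel_measurable_LIMSEQ_metric)
  show "(\<lambda>N. fst (nlft_discrete (phased_weight \<xi> N) N)) \<longlonglongrightarrow> nlft_a g \<xi>" for \<xi>
    by (rule nlft_discrete_tendsto)
  show "(\<lambda>\<xi>. fst (nlft_discrete (phased_weight \<xi> N) N)) \<in> borel_measurable borel" for N
    by (intro borel_measurable_continuous_onI continuous_intros continuous_on_nlft_discrete)
       (auto simp: phased_weight_def intro!: continuous_intros)
qed

lemma factor_tendsto: "(factor \<longlongrightarrow> 1) (at_right 0)"
proof -
  have "(factor \<longlongrightarrow> 1 / sqrt (1 - 0\<^sup>2)) (at_right 0)"
    unfolding factor_def by (intro tendsto_intros) auto
  then show ?thesis by simp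
qed

lemma eventually_at_right_unit: "\<forall>\<^sub>F \<epsilon> in at_right 0. 0 < \<epsilon> \<and> \<epsilon> < (1::real)"
  by (rule eventually_at_right_real[of 0 1, simplified, THEN eventually_mono]) auto

text \<open>The case p = 1: the supremum endpoint applied to the discretizations, valid at every
  frequency. The number of cells tends to infinity for fixed \<epsilon>, and only then \<epsilon>
  tends to 0.\<close>

lemma ln_nlft_a_le: "ln ((cmod (nlft_a g \<xi>))\<^sup>2) \<le> total\<^sup>2"
proof -
  have bound: "ln ((cmod (nlft_a g \<xi>))\<^sup>2) \<le> (factor \<epsilon> * total)\<^sup>2" if \<epsilon>: "0 < \<epsilon>" "\<epsilon> < 1" for \<epsilon>
  proof (rule tendsto_upperbound[OF circle_log_tendsto])
    have f0: "0 \<le> factor \<epsilon>" using \<epsilon> by (simp add: factor_def abs_square_le_1)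
    show "\<forall>\<^sub>F N in sequentially. circle_log (weight N) N (circle_param N \<xi>) \<le> (factor \<epsilon> * total)\<^sup>2"
      using eventually_small_weights[OF \<epsilon>]
    proof eventually_elim
      case (elim N)
      then have w: "cmod (weight N j) \<le> \<epsilon>" "cmod (weight N j) < 1" for j
        using \<epsilon> less_trans less_imp_le by blast+
      have "circle_log (weight N) N (circle_param N \<xi>) \<le> (\<Sum>i<N. sqrt (- ln (1 - (cmod (weight N i))\<^sup>2)))\<^sup>2"
        by (rule circle_log_le[of "weight N", OF w(2)])
      also have "\<dots> \<le> (\<Sum>i<N. factor \<epsilon> * cell_mass N i)\<^sup>2"
      proof (intro power_mono sum_mono sum_nonneg)
        fix i
        show "sqrt (- ln (1 - (cmod (weight N i))\<^sup>2)) \<le> factor \<epsilon> * cell_mass N i"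
          using step_length_le[OF \<epsilon> w(1)] mult_left_mono[OF weight_le f0] by (rule order_trans)
        have "(cmod (weight N i))\<^sup>2 < 1" using w(2)[of i] by (simp add: abs_square_less_1)
        then show "0 \<le> sqrt (- ln (1 - (cmod (weight N i))\<^sup>2))" by (simp add: ln_le_zero_iff)
      qed
      also have "\<dots> \<le> (factor \<epsilon> * total)\<^sup>2"
        unfolding sum_distrib_left[symmetric]
        by (intro power_mono mult_left_mono sum_cell_mass f0 mult_nonneg_nonneg sum_nonneg cell_mass_nonneg)
      finally show ?case .
    qed
  qed simp
  have "((\<lambda>\<epsilon>. (factor \<epsilon> * total)\<^sup>2) \<longlongrightarrow> (1 * total)\<^sup>2) (at_right 0)"
    by (intro tendsto_intros factor_tendsto)
  then have "ln ((cmod (nlft_a g \<xi>))\<^sup>2) \<le> (1 * total)\<^sup>2"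
    by (rule tendsto_lowerbound) (use eventually_at_right_unit bound in \<open>auto elim!: eventually_mono\<close>)
  then show ?thesis by simp
qed

text \<open>Jensen's inequality on one cell, proved by integrating the tangent line of the p-th
  power at the mean value m. The case of zero mass is separate because it would give m = 0.\<close>

lemma cell_mass_powr_le:
  assumes p: "1 < p" and Lp: "(\<lambda>x. cmod (g x) powr p) absolutely_integrable_on UNIV" and N: "0 < N"
  shows "cell_mass N j powr p \<le> (2 * R / real N) powr (p - 1) * integral (cell N j) (\<lambda>x. cmod (g x) powr p)"
proof (cases "cell_mass N j = 0")
  case True
  have "0 \<le> integral (cell N j) (\<lambda>x. cmod (g x) powr p)"
    by (intro integral_nonneg cell_integrable Lp) simp
  then show ?thesis using True by simp
next
  case False
  define \<delta> where "\<delta> = 2 * R / real N"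
  define m where "m = cell_mass N j / \<delta>"
  have \<delta>: "0 < \<delta>" using R N by (simp add: \<delta>_def)
  have m: "0 < m" "cell_mass N j = \<delta> * m" using False cell_mass_nonneg[of N j] \<delta> by (auto simp: m_def)
  define q where "q = p / (p - 1)"
  have q: "1 < q" "1 / p + 1 / q = 1" "(p - 1) * q = p" using p by (auto simp: q_def field_simps)
  \<comment> \<open>The tangent inequality v^p \<ge> m^p + p m^(p-1) (v - m), rearranged.\<close>
  have pt: "p * m powr (p - 1) * v \<le> v powr p + (p - 1) * m powr p" if "0 \<le> v" for v
  proof -
    have "v * m powr (p - 1) \<le> v powr p / p + (m powr (p - 1)) powr q / q"
      using p q that by (intro Youngs_inequality) auto
    also have "(m powr (p - 1)) powr q = m powr p" using q by (simp add: powr_powr)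
    finally have "p * (v * m powr (p - 1)) \<le> p * (v powr p / p + m powr p / q)"
      using p by (intro mult_left_mono) auto
    also have "\<dots> = v powr p + (p - 1) * m powr p" using p by (simp add: q_def field_simps)
    finally show ?thesis by (simp add: mult_ac)
  qed
  have ci: "((\<lambda>x. (p - 1) * m powr p) has_integral \<delta> * ((p - 1) * m powr p)) (cell N j)"
    unfolding cell_def using has_integral_const_real[of "(p - 1) * m powr p" "node N j" "node N (Suc j)"] node_le[of N j]
    by (simp add: node_Suc \<delta>_def)
  have gi: "((\<lambda>x. cmod (g x)) has_integral cell_mass N j) (cell N j)"
    unfolding cell_mass_def by (intro integrable_integral cell_integrable norm_absolutely_integrable g)
  have pi: "((\<lambda>x. cmod (g x) powr p) has_integral integral (cell N j) (\<lambda>x. cmod (g x) powr p)) (cell N j)"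
    by (intro integrable_integral cell_integrable Lp)
  have "p * m powr (p - 1) * cell_mass N j
      \<le> integral (cell N j) (\<lambda>x. cmod (g x) powr p) + \<delta> * ((p - 1) * m powr p)"
    by (rule has_integral_le[OF has_integral_mult_right[OF gi] has_integral_add[OF pi ci]]) (simp add: pt)
  moreover have "m powr (p - 1) * m = m powr p" using m(1) powr_add[of m "p - 1" 1] by simp
  then have "p * m powr (p - 1) * cell_mass N j = \<delta> * (p * m powr p)" unfolding m(2) by (simp add: mult_ac)
  moreover have "\<delta> * ((p - 1) * m powr p) = \<delta> * (p * m powr p) - \<delta> * m powr p"
    by (simp add: algebra_simps)
  ultimately have "\<delta> * m powr p \<le> integral (cell N j) (\<lambda>x. cmod (g x) powr p)"
    by linarith
  then have "\<delta> powr (p - 1) * (\<delta> * m powr p) \<le> \<delta> powr (p - 1) * integral (cell N j) (\<lambda>x. cmod (g x) powr p)"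
    by (intro mult_left_mono) auto
  moreover have "\<delta> powr (p - 1) * (\<delta> * m powr p) = cell_mass N j powr p"
    using \<delta> m powr_add[of \<delta> "p - 1" 1] by (simp add: powr_mult flip: mult.assoc)
  ultimately show ?thesis by (simp add: \<delta>_def)
qed

text \<open>The integrand is periodic in the frequency and the window is one period, of length
  N/(2R). The window must grow with N so that the limit sees every frequency.\<close>

lemma nn_integral_circle_log:
  assumes t: "\<And>n. cmod (weight N n) < 1" and N: "0 < N" and s: "0 < s"
  shows "(\<integral>\<^sup>+\<xi>. ennreal (indicator {- real N / (4 * R)..real N / (4 * R)} \<xi> * circle_log (weight N) N (circle_param N \<xi>) powr s) \<partial>lborel)
     = ennreal (real N / (2 * R) * integral {0..1} (\<lambda>x. circle_log (weight N) N x powr s))"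
proof -
  let ?U = "\<lambda>x. circle_log (weight N) N x powr s"
  let ?f = "\<lambda>\<xi>. ennreal (indicator {- real N / (4 * R)..real N / (4 * R)} \<xi> * ?U (circle_param N \<xi>))"
  have Um: "?U \<in> borel_measurable borel" using circle_log_measurable[of "weight N" N] by measurable
  have cm: "circle_param N \<in> borel_measurable borel"
    unfolding circle_param_def by measurable
  have fm: "?f \<in> borel_measurable borel"
    using measurable_compose[OF cm Um] by measurable
  have "(\<integral>\<^sup>+\<xi>. ?f \<xi> \<partial>lborel) = ennreal \<bar>- real N / (2 * R)\<bar> * (\<integral>\<^sup>+x. ?f (real N / (4 * R) + (- real N / (2 * R)) * x) \<partial>lborel)"
    using N R by (intro nn_integral_real_affine fm) auto
  also have "(\<lambda>x. ?f (real N / (4 * R) + (- real N / (2 * R)) * x)) = (\<lambda>x. ennreal (if x \<in> {0..1} then ?U x else 0))"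
  proof
    fix x
    have "circle_param N (real N / (4 * R) + (- real N / (2 * R)) * x) = x"
      using N R by (simp add: circle_param_def field_simps)
    moreover have "real N / (4 * R) + (- real N / (2 * R)) * x \<in> {- real N / (4 * R)..real N / (4 * R)} \<longleftrightarrow> x \<in> {0..1}"
    proof -
      define c where "c = real N / (4 * R)"
      have c: "0 < c" using N R by (simp add: c_def)
      have e: "real N / (4 * R) + (- real N / (2 * R)) * x = c * (1 - 2 * x)" "- real N / (4 * R) = c * (-1)"
        using R by (simp_all add: c_def field_simps)
      have "c * (-1) \<le> c * (1 - 2 * x) \<longleftrightarrow> -1 \<le> 1 - 2 * x" "c * (1 - 2 * x) \<le> c * 1 \<longleftrightarrow> 1 - 2 * x \<le> 1"
        using c by (simp_all only: mult_le_cancel_left_pos)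
      then show ?thesis unfolding e using c by (auto simp: c_def[symmetric])
    qed
    ultimately show "?f (real N / (4 * R) + (- real N / (2 * R)) * x) = ennreal (if x \<in> {0..1} then ?U x else 0)"
      by (simp add: indicator_def)
  qed
  also have "(\<integral>\<^sup>+x. ennreal (if x \<in> {0..1} then ?U x else 0) \<partial>lborel) = ennreal (integral {0..1} ?U)"
  proof (rule nn_integral_has_integral_lborel)
    show "(\<lambda>x. if x \<in> {0..1} then ?U x else 0) \<in> borel_measurable borel" using Um by measurable
    have "continuous_on {0..1} ?U"
      using s circle_log_nonneg[of "weight N", OF t]
      by (intro continuous_on_powr' continuous_intros continuous_on_subset[OF circle_log_continuous[of "weight N", OF t]]) auto
    then have "(?U has_integral integral {0..1} ?U) {0..1}"
      by (intro integrable_integral integrable_continuous_interval)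
    then show "((\<lambda>x. if x \<in> {0..1} then ?U x else 0) has_integral integral {0..1} ?U) UNIV"
      by (simp only: has_integral_restrict_UNIV)
  qed simp
  finally show ?thesis
    using ennreal_mult'[of "real N / (2 * R)" "integral {0..1} ?U"] R by simp
qed

text \<open>Fatou's lemma along the discretizations. The bound is uniform in N because the cell
  length from Jensen's inequality cancels the period length from the change of variables.\<close>

theorem nlft_hausdorff_young:
  assumes p: "1 < p" "p < 2" and Lp: "(\<lambda>x. cmod (g x) powr p) absolutely_integrable_on UNIV"
  shows "(\<integral>\<^sup>+\<xi>. ennreal (ln ((cmod (nlft_a g \<xi>))\<^sup>2) powr (p / (2 * (p - 1)))) \<partial>lborel)
     \<le> ennreal (integral UNIV (\<lambda>x. cmod (g x) powr p) powr (1 / (p - 1)))" (is "?X \<le> _")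
proof -
  define s where "s = p / (2 * (p - 1))"
  have s: "0 < s" using p by (simp add: s_def)
  define I where "I = integral UNIV (\<lambda>x. cmod (g x) powr p)"
  have I: "0 \<le> I" unfolding I_def using Lp by (intro integral_nonneg) (auto simp: absolutely_integrable_on_def)
  \<comment> \<open>The cut-off to one period does not affect the pointwise limit, since every \<xi>
    lies in the window for all large N.\<close>
  define u where "u N \<xi> = indicator {- real N / (4 * R)..real N / (4 * R)} \<xi> * circle_log (weight N) N (circle_param N \<xi>) powr s" for N \<xi>
  have um: "u N \<in> borel_measurable borel" for N
  proof -
    have cm: "circle_param N \<in> borel_measurable borel"
      unfolding circle_param_def by measurable
    show ?thesis
      unfolding u_def using measurable_compose[OF cm circle_log_measurable[of "weight N" N]] by measurable
  qed
  have ulim: "(\<lambda>N. u N \<xi>) \<longlonglongrightarrow> ln ((cmod (nlft_a g \<xi>))\<^sup>2) powr s" for \<xi>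
  proof -
    have nn: "\<forall>\<^sub>F N in sequentially. 0 \<le> circle_log (weight N) N (circle_param N \<xi>)"
      using eventually_weights_less_1 by eventually_elim (rule circle_log_nonneg, simp)
    have "(\<lambda>N. circle_log (weight N) N (circle_param N \<xi>) powr s) \<longlonglongrightarrow> ln ((cmod (nlft_a g \<xi>))\<^sup>2) powr s"
      by (rule tendsto_powr2[OF circle_log_tendsto tendsto_const nn s])
    moreover have "\<forall>\<^sub>F N in sequentially. u N \<xi> = circle_log (weight N) N (circle_param N \<xi>) powr s"
    proof -
      obtain n :: nat where n: "4 * R * \<bar>\<xi>\<bar> \<le> real n" using real_arch_simple by blast
      show ?thesis
        using eventually_ge_at_top[of n]
      proof eventually_elim
        case (elim N)
        then have "4 * R * \<bar>\<xi>\<bar> \<le> real N" using n by linarith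
        then have "\<bar>\<xi>\<bar> \<le> real N / (4 * R)" using R by (simp add: field_simps)
        then have "\<xi> \<in> {- real N / (4 * R)..real N / (4 * R)}" by auto
        then show ?case by (simp add: u_def)
      qed
    qed
    ultimately show ?thesis by (simp add: tendsto_cong)
  qed
  have bound: "?X \<le> ennreal (factor \<epsilon> powr (p / (p - 1)) * I powr (1 / (p - 1)))" if \<epsilon>: "0 < \<epsilon>" "\<epsilon> < 1" for \<epsilon>
  proof -
    have f0: "0 \<le> factor \<epsilon>" using \<epsilon> by (simp add: factor_def abs_square_le_1)
    have "?X = (\<integral>\<^sup>+\<xi>. liminf (\<lambda>N. ennreal (u N \<xi>)) \<partial>lborel)"
      using ulim unfolding s_def by (intro nn_integral_cong lim_imp_Liminf[symmetric] tendsto_ennrealI) auto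
    also have "\<dots> \<le> liminf (\<lambda>N. \<integral>\<^sup>+\<xi>. ennreal (u N \<xi>) \<partial>lborel)"
      using um by (intro nn_integral_liminf) measurable
    also have "\<dots> \<le> ennreal (factor \<epsilon> powr (p / (p - 1)) * I powr (1 / (p - 1)))"
    proof (rule Liminf_le)
      show "\<forall>\<^sub>F N in sequentially. (\<integral>\<^sup>+\<xi>. ennreal (u N \<xi>) \<partial>lborel)
          \<le> ennreal (factor \<epsilon> powr (p / (p - 1)) * I powr (1 / (p - 1)))"
        using eventually_small_weights[OF \<epsilon>]
      proof eventually_elim
        case (elim N)
        then have w: "cmod (weight N j) \<le> \<epsilon>" "cmod (weight N j) < 1" and N: "0 < N" for j
          using \<epsilon> less_trans less_imp_le by blast+
        define \<delta> where "\<delta> = 2 * R / real N"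
        have \<delta>: "0 < \<delta>" using R N by (simp add: \<delta>_def)
        have c: "sqrt (- ln (1 - (cmod (weight N i))\<^sup>2)) powr p
            \<le> factor \<epsilon> powr p * (\<delta> powr (p - 1) * integral (cell N i) (\<lambda>x. cmod (g x) powr p))" for i
        proof -
          have "(cmod (weight N i))\<^sup>2 < 1" using w(2)[of i] by (simp add: abs_square_less_1)
          then have "0 \<le> sqrt (- ln (1 - (cmod (weight N i))\<^sup>2))" by (simp add: ln_le_zero_iff)
          then have "sqrt (- ln (1 - (cmod (weight N i))\<^sup>2)) powr p \<le> (factor \<epsilon> * cell_mass N i) powr p"
            using p order_trans[OF step_length_le[OF \<epsilon> w(1)] mult_left_mono[OF weight_le f0]]
            by (intro powr_mono2) auto
          also have "\<dots> = factor \<epsilon> powr p * cell_mass N i powr p"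
            using f0 cell_mass_nonneg by (simp add: powr_mult)
          also have "\<dots> \<le> factor \<epsilon> powr p * (\<delta> powr (p - 1) * integral (cell N i) (\<lambda>x. cmod (g x) powr p))"
            unfolding \<delta>_def by (intro mult_left_mono cell_mass_powr_le p Lp N) auto
          finally show ?thesis .
        qed
        have "(\<Sum>i<N. sqrt (- ln (1 - (cmod (weight N i))\<^sup>2)) powr p)
            \<le> factor \<epsilon> powr p * (\<delta> powr (p - 1) * (\<Sum>i<N. integral (cell N i) (\<lambda>x. cmod (g x) powr p)))"
          unfolding sum_distrib_left by (intro sum_mono c)
        also have "\<dots> \<le> factor \<epsilon> powr p * (\<delta> powr (p - 1) * I)"
          unfolding I_def by (intro mult_left_mono sum_cells Lp) auto
        finally have "(\<Sum>i<N. sqrt (- ln (1 - (cmod (weight N i))\<^sup>2)) powr p) powr (1 / (p - 1))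
            \<le> (factor \<epsilon> powr p * (\<delta> powr (p - 1) * I)) powr (1 / (p - 1))"
          using p by (intro powr_mono2) (auto intro: sum_nonneg)
        \<comment> \<open>Here \<open>\<delta> powr (p - 1)\<close> becomes \<open>\<delta>\<close>;
          the prefactor \<open>1 / \<delta>\<close> of the frequency integral removes it.\<close>
        also have "\<dots> = factor \<epsilon> powr (p / (p - 1)) * (\<delta> * I powr (1 / (p - 1)))"
          using p \<delta> I f0 by (simp add: powr_mult powr_powr)
        finally have "integral {0..1} (\<lambda>x. circle_log (weight N) N x powr s)
            \<le> factor \<epsilon> powr (p / (p - 1)) * (\<delta> * I powr (1 / (p - 1)))"
          unfolding s_def using circle_log_hausdorff_young[of "weight N", OF w(2) p, where N = N] by linarith
        then have "1 / \<delta> * integral {0..1} (\<lambda>x. circle_log (weight N) N x powr s)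
            \<le> 1 / \<delta> * (factor \<epsilon> powr (p / (p - 1)) * (\<delta> * I powr (1 / (p - 1))))"
          using \<delta> by (intro mult_left_mono) auto
        also have "\<dots> = factor \<epsilon> powr (p / (p - 1)) * I powr (1 / (p - 1))" using \<delta> by simp
        finally show ?case
          unfolding u_def nn_integral_circle_log[OF w(2) N s] by (intro ennreal_leI) (simp add: \<delta>_def)
      qed
    qed simp
    finally show ?thesis .
  qed
  have "((\<lambda>\<epsilon>. ennreal (factor \<epsilon> powr (p / (p - 1)) * I powr (1 / (p - 1)))) \<longlongrightarrow>
      ennreal (1 powr (p / (p - 1)) * I powr (1 / (p - 1)))) (at_right 0)"
    by (intro tendsto_ennrealI tendsto_mult tendsto_powr factor_tendsto tendsto_const) auto
  then have "?X \<le> ennreal (1 powr (p / (p - 1)) * I powr (1 / (p - 1)))"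
    by (rule tendsto_lowerbound) (use eventually_at_right_unit bound in \<open>auto elim!: eventually_mono\<close>)
  then show ?thesis by (simp add: I_def)
qed

end

section \<open>Truncations\<close>

lemma Lp_norm_finite:
  fixes f :: "real \<Rightarrow> complex"
  assumes p: "1 \<le> p" and fin: "Lp_norm (ennreal p) f < \<infinity>"
  shows "f \<in> borel_measurable lebesgue"
    and "(\<lambda>x. cmod (f x) powr p) absolutely_integrable_on UNIV"
    and "Lp_norm (ennreal p) f = ennreal (integral UNIV (\<lambda>x. cmod (f x) powr p) powr (1 / p))"
proof -
  show m: "f \<in> borel_measurable lebesgue"
    using fin by (auto simp: Lp_norm_def split: if_splits)
  define J where "J = (\<integral>\<^sup>+ x. ennreal (cmod (f x) powr p) \<partial>lebesgue)"
  have L: "Lp_norm (ennreal p) f = (if J = \<infinity> then \<infinity> else ennreal (enn2real J powr (1 / p)))"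
    using m p by (simp add: Lp_norm_def J_def Let_def)
  then have J: "J \<noteq> \<infinity>" using fin by auto
  have pm: "(\<lambda>x. cmod (f x) powr p) \<in> borel_measurable lebesgue" using m by measurable
  have i: "integrable lebesgue (\<lambda>x. cmod (f x) powr p)"
    using J pm by (intro integrableI_nonneg) (auto simp: J_def top.not_eq_extremum)
  then show ai: "(\<lambda>x. cmod (f x) powr p) absolutely_integrable_on UNIV"
    by (simp add: set_integrable_def)
  have "J = ennreal (LINT x|lebesgue. cmod (f x) powr p)"
    unfolding J_def by (rule nn_integral_eq_integral[OF i]) simp
  also have "(LINT x|lebesgue. cmod (f x) powr p) = integral UNIV (\<lambda>x. cmod (f x) powr p)"
    using set_lebesgue_integral_eq_integral(2)[OF ai] by (simp add: set_lebesgue_integral_def)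
  finally have "enn2real J = integral UNIV (\<lambda>x. cmod (f x) powr p)"
    using ai by (simp add: integral_nonneg absolutely_integrable_on_def)
  then show "Lp_norm (ennreal p) f = ennreal (integral UNIV (\<lambda>x. cmod (f x) powr p) powr (1 / p))"
    using L J by simp
qed

lemma truncation_norm_le: "cmod (truncation R f x) \<le> cmod (f x)"
  by (simp add: truncation_def indicator_def)

context
  fixes p :: real and f :: "real \<Rightarrow> complex"
  assumes p: "1 \<le> p" and m: "f \<in> borel_measurable lebesgue"
    and Lp: "(\<lambda>x. cmod (f x) powr p) absolutely_integrable_on UNIV"
begin

lemma truncation_measurable: "truncation R f \<in> borel_measurable lebesgue"
proof -
  have "(\<lambda>x. indicator {-R..R} x * f x) \<in> borel_measurable lebesgue"
    using m by (intro borel_measurable_times borel_measurable_indicator) auto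
  then show ?thesis by (simp add: truncation_def[abs_def])
qed

text \<open>Pointwise |f| \<le> 1 + |f|^p, and the constant is integrable over the window.\<close>

lemma truncation_absolutely_integrable: "truncation R f absolutely_integrable_on UNIV"
proof (rule measurable_bounded_by_integrable_imp_absolutely_integrable)
  show "truncation R f \<in> borel_measurable (lebesgue_on UNIV)"
    using truncation_measurable by (simp add: lebesgue_on_UNIV_eq)
  have "(\<lambda>x. if x \<in> {-R..R} then 1 else (0::real)) integrable_on UNIV"
    unfolding integrable_restrict_UNIV by (rule integrable_const_ivl)
  then show "(\<lambda>x. (if x \<in> {-R..R} then 1 else 0) + cmod (f x) powr p) integrable_on UNIV"
    using Lp by (intro integrable_add) (auto simp: absolutely_integrable_on_def)
  show "norm (truncation R f x) \<le> (if x \<in> {-R..R} then 1 else 0) + cmod (f x) powr p" for x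
  proof -
    have "cmod (f x) \<le> 1 + cmod (f x) powr p"
    proof (cases "cmod (f x) \<le> 1")
      case True
      then show ?thesis using powr_ge_zero[of "cmod (f x)" p] by linarith
    next
      case False
      then have "cmod (f x) powr 1 \<le> cmod (f x) powr p" using p by (intro powr_mono) auto
      then show ?thesis using False by simp
    qed
    then show ?thesis by (simp add: truncation_def indicator_def)
  qed
qed auto

lemma truncation_Lp:
  "(\<lambda>x. cmod (truncation R f x) powr p) absolutely_integrable_on UNIV"
  "integral UNIV (\<lambda>x. cmod (truncation R f x) powr p) \<le> integral UNIV (\<lambda>x. cmod (f x) powr p)"
proof -
  have le: "cmod (truncation R f x) powr p \<le> cmod (f x) powr p" for x
    using truncation_norm_le p by (intro powr_mono2) auto
  show 1: "(\<lambda>x. cmod (truncation R f x) powr p) absolutely_integrable_on UNIV"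
  proof (rule measurable_bounded_by_integrable_imp_absolutely_integrable)
    show "(\<lambda>x. cmod (truncation R f x) powr p) \<in> borel_measurable (lebesgue_on UNIV)"
      unfolding lebesgue_on_UNIV_eq using truncation_measurable by measurable
    show "(\<lambda>x. cmod (f x) powr p) integrable_on UNIV" using Lp by (simp add: absolutely_integrable_on_def)
  qed (use le in auto)
  show "integral UNIV (\<lambda>x. cmod (truncation R f x) powr p) \<le> integral UNIV (\<lambda>x. cmod (f x) powr p)"
    using 1 Lp le by (intro integral_le) (auto simp: absolutely_integrable_on_def)
qed

text \<open>The radius n + 1 is positive also for n = 0 and keeps the closed window strictly inside,
  as the grid wants the potential to vanish at the endpoints.\<close>

lemma truncation_grid: "grid (truncation (real n) f) (real n + 1)"
  by unfold_locales (auto intro: truncation_absolutely_integrable simp: truncation_def indicator_def)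

end

text \<open>Where the limit over real radii exists, \<open>Lim\<close> denotes it and integer radii
  suffice. A sequence is what measurability and Fatou's lemma require. The bound |a| \<ge> 1 passes
  to the limit and keeps the logarithm continuous there.\<close>

lemma nlft_a_Lp_limit:
  assumes p: "1 \<le> p" and m: "f \<in> borel_measurable lebesgue"
    and Lp: "(\<lambda>x. cmod (f x) powr p) absolutely_integrable_on UNIV"
    and lim: "AE \<xi> in lebesgue. \<exists>l. ((\<lambda>R. nlft_a (truncation R f) \<xi>) \<longlongrightarrow> l) at_top"
  shows "AE \<xi> in lebesgue. (\<lambda>n. nlft_a (truncation (real n) f) \<xi>) \<longlonglongrightarrow> nlft_a_Lp f \<xi>"
    and "nlft_a_Lp f \<in> borel_measurable lebesgue"
    and "AE \<xi> in lebesgue. (\<lambda>n. ln ((cmod (nlft_a (truncation (real n) f) \<xi>))\<^sup>2)) \<longlonglongrightarrow> ln ((cmod (nlft_a_Lp f \<xi>))\<^sup>2)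
            \<and> 0 \<le> ln ((cmod (nlft_a_Lp f \<xi>))\<^sup>2)"
proof -
  note grid = truncation_grid[OF p m Lp]
  show 1: "AE \<xi> in lebesgue. (\<lambda>n. nlft_a (truncation (real n) f) \<xi>) \<longlonglongrightarrow> nlft_a_Lp f \<xi>"
    using lim
  proof eventually_elim
    case (elim \<xi>)
    then obtain l where l: "((\<lambda>R. nlft_a (truncation R f) \<xi>) \<longlongrightarrow> l) at_top" by blast
    then have "nlft_a_Lp f \<xi> = l" unfolding nlft_a_Lp_def by (intro tendsto_Lim) auto
    then show ?case using filterlim_compose[OF l filterlim_real_sequentially] by simp
  qed
  have am: "nlft_a (truncation (real n) f) \<in> borel_measurable borel" for n
    by (rule grid.nlft_a_measurable[OF grid])
  \<comment> \<open>This function is Borel measurable outright; it agrees with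
    \<open>nlft_a_Lp f\<close> almost everywhere, which is enough for the complete Lebesgue
    measure.\<close>
  have "(\<lambda>\<xi>. lim (\<lambda>n. nlft_a (truncation (real n) f) \<xi>)) \<in> borel_measurable borel"
    using am by measurable
  then have "(\<lambda>\<xi>. lim (\<lambda>n. nlft_a (truncation (real n) f) \<xi>)) \<in> borel_measurable lebesgue"
    by (simp add: measurable_completion)
  moreover have "AE \<xi> in lebesgue. lim (\<lambda>n. nlft_a (truncation (real n) f) \<xi>) = nlft_a_Lp f \<xi>"
    using 1 by eventually_elim (rule limI)
  ultimately show "nlft_a_Lp f \<in> borel_measurable lebesgue"
    by (rule borel_measurable_AE)
  show "AE \<xi> in lebesgue. (\<lambda>n. ln ((cmod (nlft_a (truncation (real n) f) \<xi>))\<^sup>2)) \<longlonglongrightarrow> ln ((cmod (nlft_a_Lp f \<xi>))\<^sup>2)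
            \<and> 0 \<le> ln ((cmod (nlft_a_Lp f \<xi>))\<^sup>2)"
    using 1
  proof eventually_elim
    case (elim \<xi>)
    have "(\<lambda>n. cmod (nlft_a (truncation (real n) f) \<xi>)) \<longlonglongrightarrow> cmod (nlft_a_Lp f \<xi>)"
      by (intro tendsto_norm elim)
    then have ge: "1 \<le> cmod (nlft_a_Lp f \<xi>)"
      using grid.nlft_a_norm_ge_1[OF grid] by (intro LIMSEQ_le_const) auto
    then have "1 \<le> (cmod (nlft_a_Lp f \<xi>))\<^sup>2" by (rule one_le_power)
    moreover have "(\<lambda>n. ln ((cmod (nlft_a (truncation (real n) f) \<xi>))\<^sup>2)) \<longlonglongrightarrow> ln ((cmod (nlft_a_Lp f \<xi>))\<^sup>2)"
      using ge by (intro tendsto_ln tendsto_power tendsto_norm elim) auto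
    ultimately show ?case by simp
  qed
qed

text \<open>Truncation does not increase the norm of f, so the bounds for compactly supported
  potentials are uniform in the radius. They pass to the limit pointwise for p = 1 and by Fatou's
  lemma otherwise. The theorem of Christ and Kiselev enters as the hypothesis
  \<open>christ_kiselev\<close>.\<close>

theorem corollary1p3:
  fixes p :: real and f :: "real \<Rightarrow> complex"
  assumes "1 \<le> p" and "p < 2"
    and "Lp_norm (ennreal p) f < \<infinity>"
    and christ_kiselev: "AE \<xi> in lebesgue. \<exists>l. ((\<lambda>R. nlft_a (truncation R f) \<xi>) \<longlongrightarrow> l) at_top"
  shows "Lp_norm (conj_exponent p) (\<lambda>\<xi>. sqrt (ln ((cmod (nlft_a_Lp f \<xi>))\<^sup>2)))
           \<le> Lp_norm (ennreal p) f"
proof -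
  note Lpf = Lp_norm_finite[OF assms(1,3)]
  note lim = nlft_a_Lp_limit[OF assms(1) Lpf(1,2) christ_kiselev]
  note grid = truncation_grid[OF assms(1) Lpf(1,2)]
  define I where "I = integral UNIV (\<lambda>x. cmod (f x) powr p)"
  have I: "0 \<le> I" unfolding I_def using Lpf(2) by (intro integral_nonneg) (auto simp: absolutely_integrable_on_def)
  let ?u = "\<lambda>\<xi>. ln ((cmod (nlft_a_Lp f \<xi>))\<^sup>2)"
  let ?v = "\<lambda>n \<xi>. ln ((cmod (nlft_a (truncation (real n) f) \<xi>))\<^sup>2)"
  have um: "(\<lambda>\<xi>. sqrt (?u \<xi>)) \<in> borel_measurable lebesgue" using lim(2) by measurable
  have vl: "?v n \<in> borel_measurable lebesgue" for n
  proof -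
    have "?v n \<in> borel_measurable borel" using grid.nlft_a_measurable[OF grid] by measurable
    then show ?thesis by (simp add: measurable_completion)
  qed
  have v0: "0 \<le> ?v n \<xi>" for n \<xi>
  proof -
    have "1 \<le> cmod (nlft_a (truncation (real n) f) \<xi>)" by (rule grid.nlft_a_norm_ge_1[OF grid])
    from one_le_power[OF this, of 2] show ?thesis by simp
  qed
  show ?thesis
  proof (cases "p = 1")
    case True
    have "AE \<xi> in lebesgue. ennreal (norm (sqrt (?u \<xi>))) \<le> ennreal I"
      using lim(3)
    proof eventually_elim
      case (elim \<xi>)
      have "?v n \<xi> \<le> I\<^sup>2" for n
      proof -
        have "?v n \<xi> \<le> (integral UNIV (\<lambda>x. cmod (truncation (real n) f x)))\<^sup>2"
          by (rule grid.ln_nlft_a_le[OF grid])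
        also have "\<dots> \<le> I\<^sup>2"
          using truncation_Lp[OF assms(1) Lpf(1,2), of "real n"] True
          by (intro power_mono integral_nonneg) (auto simp: I_def absolutely_integrable_on_def)
        finally show ?thesis .
      qed
      then have "?u \<xi> \<le> I\<^sup>2" using elim by (intro LIMSEQ_le_const2[where X = "\<lambda>n. ?v n \<xi>"]) auto
      then have "sqrt (?u \<xi>) \<le> I" using I by (intro real_le_lsqrt) auto
      then show ?case using elim by (intro ennreal_leI) simp
    qed
    then have "esssup lebesgue (\<lambda>\<xi>. ennreal (norm (sqrt (?u \<xi>)))) \<le> ennreal I"
      by (rule esssup_I[rotated]) (use lim(2) in measurable)
    moreover have "Lp_norm (ennreal p) f = ennreal I"
      using Lpf(3) True I by (simp add: I_def)
    ultimately show ?thesis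
      using um True by (simp add: Lp_norm_def conj_exponent_def)
  next
    case False
    then have p: "1 < p" using assms(1) by simp
    \<comment> \<open>Half of the conjugate exponent, since the square root of the logarithm is
      raised to the power p/(p-1).\<close>
    define s where "s = p / (2 * (p - 1))"
    have s: "0 < s" using p by (simp add: s_def)
    define J where "J = (\<integral>\<^sup>+ \<xi>. ennreal (norm (sqrt (?u \<xi>)) powr (p / (p - 1))) \<partial>lebesgue)"
    have "J = (\<integral>\<^sup>+ \<xi>. liminf (\<lambda>n. ennreal (?v n \<xi> powr s)) \<partial>lebesgue)"
      unfolding J_def
    proof (rule nn_integral_cong_AE)
      show "AE \<xi> in lebesgue. ennreal (norm (sqrt (?u \<xi>)) powr (p / (p - 1))) = liminf (\<lambda>n. ennreal (?v n \<xi> powr s))"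
        using lim(3)
      proof eventually_elim
        case (elim \<xi>)
        have "(\<lambda>n. ?v n \<xi> powr s) \<longlonglongrightarrow> ?u \<xi> powr s"
          using elim v0 s by (intro tendsto_powr2[OF _ tendsto_const]) auto
        then have "liminf (\<lambda>n. ennreal (?v n \<xi> powr s)) = ennreal (?u \<xi> powr s)"
          by (intro lim_imp_Liminf tendsto_ennrealI) auto
        moreover have "norm (sqrt (?u \<xi>)) powr (p / (p - 1)) = ?u \<xi> powr s"
        proof -
          have "norm (sqrt (?u \<xi>)) = ?u \<xi> powr (1 / 2)" using elim by (simp add: powr_half_sqrt)
          then show ?thesis by (simp only: powr_powr) (simp add: s_def)
        qed
        ultimately show ?case by simp
      qed
    qed
    also have "\<dots> \<le> liminf (\<lambda>n. \<integral>\<^sup>+ \<xi>. ennreal (?v n \<xi> powr s) \<partial>lebesgue)"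
    proof (rule nn_integral_liminf)
      show "(\<lambda>\<xi>. ennreal (?v n \<xi> powr s)) \<in> borel_measurable lebesgue" for n
        using vl[of n] by measurable
    qed
    also have "\<dots> \<le> ennreal (I powr (1 / (p - 1)))"
    proof (intro Liminf_le always_eventually allI)
      fix n
      have "(\<integral>\<^sup>+ \<xi>. ennreal (?v n \<xi> powr s) \<partial>lebesgue) = (\<integral>\<^sup>+ \<xi>. ennreal (?v n \<xi> powr s) \<partial>lborel)"
        by (rule nn_integral_completion)
      also have "\<dots> \<le> ennreal (integral UNIV (\<lambda>x. cmod (truncation (real n) f x) powr p) powr (1 / (p - 1)))"
        unfolding s_def
        by (rule grid.nlft_hausdorff_young[OF grid p assms(2) truncation_Lp(1)[OF assms(1) Lpf(1,2)]])
      also have "\<dots> \<le> ennreal (I powr (1 / (p - 1)))"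
        using p truncation_Lp[OF assms(1) Lpf(1,2), of "real n"] unfolding I_def
        by (intro ennreal_leI powr_mono2) (auto intro!: integral_nonneg simp: absolutely_integrable_on_def)
      finally show "(\<integral>\<^sup>+ \<xi>. ennreal (?v n \<xi> powr s) \<partial>lebesgue) \<le> ennreal (I powr (1 / (p - 1)))" .
    qed simp
    finally have J: "J \<le> ennreal (I powr (1 / (p - 1)))" .
    then have Jfin: "J \<noteq> \<infinity>" by (auto simp: top_unique)
    have "enn2real J powr ((p - 1) / p) \<le> (I powr (1 / (p - 1))) powr ((p - 1) / p)"
      using p J by (intro powr_mono2) (auto intro: enn2real_leI)
    also have "\<dots> = I powr (1 / p)" using p by (simp add: powr_powr)
    finally have le: "enn2real J powr ((p - 1) / p) \<le> I powr (1 / p)" .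
    have "Lp_norm (conj_exponent p) (\<lambda>\<xi>. sqrt (?u \<xi>)) = ennreal (enn2real J powr ((p - 1) / p))"
      using um p Jfin False by (simp add: Lp_norm_def conj_exponent_def J_def Let_def)
    also have "\<dots> \<le> Lp_norm (ennreal p) f"
      unfolding Lpf(3) using le by (intro ennreal_leI) (simp add: I_def)
    finally show ?thesis .
  qed
qed

end
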